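(* Assume the setting and notation described in the context. Let $\mathcal{F}$ be a countable family of measurable functions $f:E\to\mathbb{R}$ satisfying Assumption 1 with constants $C>0$, $\rho>0$, and let $(d(f))_{f\in\mathcal{F}}$ be positive constants with $\sum_{f\in\mathcal{F}} d(f)\|f\|<\infty$. Assume the seminorm $N$ satisfies, for every finite signed measure $\nu$ on $E$, $$N(\nu)\le \sum_{f\in\mathcal{F}} d(f)\,|\nu(f)|.$$ Assume there is a positive sequence $(b_n)$ such that $\mathbb{P}[N(P_n-Q_n)>b_n]\to 1$ as $n\to\infty$. Fix $\epsilon\in(0,1)$ and set $\bar\rho=\min(1-\epsilon,\rho)$. If $$b_n^{-1}\Big[n^{-\bar\rho/2}\big(1+\ln(n)\,\mathbb{1}_{\{\gamma-1+\bar\rho/2=0\}}\big)+n^{\gamma-1}\Big]\to 0\quad\text{as } n\to\infty,$$ then $\hat\theta_n-\theta=O_p\big(n^{-1}b_n^{-2/\bar\rho}\big)$.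
   Context: For each $n\ge 1$ let $X_1,\dots,X_n$ (dependence on $n$ suppressed) be random variables on a common probability space with values in a measurable space $E$. Fix $0<\theta<1$. There are probability measures $P_n,Q_n$ on $E$ (possibly depending on $n$) such that the law of $X_i$ is $P_n$ if $i\le n\theta$ and $Q_n$ if $i>n\theta$; no stationarity of the dependence structure is assumed. For a finite signed measure $\nu$ on $E$ and measurable $f$, $\nu(f)=\int f\,d\nu$. $N$ is a (possibly random, i.e. data-dependent) seminorm on the space of finite signed measures on $E$. Fix $\gamma\in[0,1)$. For $1\le k<n$ let $$D_k=\Big[\tfrac{k}{n}\big(1-\tfrac{k}{n}\big)\Big]^{1-\gamma}\Big(\frac1k\sum_{i=1}^k\delta_{X_i}-\frac1{n-k}\sum_{i=k+1}^n\delta_{X_i}\Big),\qquad \hat\theta_n=\frac1n\min\Big(\arg\max_{1\le k<n}N(D_k)\Big).$$ For measurable $f:E\to\mathbb{R}$, $\|f\|=\sup_{n\in\mathbb{N}}\big(P_n(f^2)+Q_n(f^2)\big)^{1/2}$. A family $\mathcal{F}$ of measurable real functions on $E$ satisfies Assumption 1 if there are constants $C>0,\rho>0$ independent of $n$ such that for all $n$ and all $1\le m<n$: $\sup_{f\in\mathcal{F}}\sup_{1\le i\le n-m}|\mathrm{corr}(f(X_i),f(X_{i+m}))|\le Cm^{-\rho}$. $Y_n=O_p(a_n)$ means: for every $\delta>0$ there exist $M$ and $n_0$ with $\mathbb{P}(|Y_n|>Ma_n)<\delta$ for all $n\ge n_0$. *)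

theory Defs
  imports "HOL-Probability.Probability"
begin

definition fsm :: "'e measure \<Rightarrow> ('e set \<Rightarrow> real) \<Rightarrow> bool" where
  "fsm E \<nu> \<longleftrightarrow> (\<forall>A. A \<notin> sets E \<longrightarrow> \<nu> A = 0) \<and> \<nu> {} = 0 \<and>
     (\<forall>A :: nat \<Rightarrow> 'e set. range A \<subseteq> sets E \<longrightarrow> disjoint_family A \<longrightarrow>
        (\<lambda>i. \<nu> (A i)) sums \<nu> (\<Union>i. A i))"

text \<open>Positive variation (Jordan decomposition): nu^+(A) = sup { nu(B) : B subset A measurable }.\<close>

definition sm_pos :: "'e measure \<Rightarrow> ('e set \<Rightarrow> real) \<Rightarrow> 'e measure" where
  "sm_pos E \<nu> = measure_of (space E) (sets E)
     (\<lambda>A. SUP B\<in>{B \<in> sets E. B \<subseteq> A}. ennreal (\<nu> B))"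

definition sm_neg :: "'e measure \<Rightarrow> ('e set \<Rightarrow> real) \<Rightarrow> 'e measure" where
  "sm_neg E \<nu> = sm_pos E (\<lambda>A. - \<nu> A)"

definition sm_integrable :: "'e measure \<Rightarrow> ('e set \<Rightarrow> real) \<Rightarrow> ('e \<Rightarrow> real) \<Rightarrow> bool" where
  "sm_integrable E \<nu> f \<longleftrightarrow> integrable (sm_pos E \<nu>) f \<and> integrable (sm_neg E \<nu>) f"

definition sm_integral :: "'e measure \<Rightarrow> ('e set \<Rightarrow> real) \<Rightarrow> ('e \<Rightarrow> real) \<Rightarrow> real" where
  "sm_integral E \<nu> f = (\<integral>x. f x \<partial>sm_pos E \<nu>) - (\<integral>x. f x \<partial>sm_neg E \<nu>)"

definition sm_seminorm :: "'e measure \<Rightarrow> (('e set \<Rightarrow> real) \<Rightarrow> real) \<Rightarrow> bool" where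
  "sm_seminorm E N \<longleftrightarrow>
     (\<forall>\<nu>. fsm E \<nu> \<longrightarrow> 0 \<le> N \<nu>) \<and>
     (\<forall>c \<nu>. fsm E \<nu> \<longrightarrow> N (\<lambda>A. c * \<nu> A) = \<bar>c\<bar> * N \<nu>) \<and>
     (\<forall>\<nu> \<mu>. fsm E \<nu> \<longrightarrow> fsm E \<mu> \<longrightarrow> N (\<lambda>A. \<nu> A + \<mu> A) \<le> N \<nu> + N \<mu>)"

text \<open>Signed measure P - Q (measure is 0 outside the sigma-algebra).\<close>

definition msub :: "'e measure \<Rightarrow> 'e measure \<Rightarrow> 'e set \<Rightarrow> real" where
  "msub P Q = (\<lambda>A. measure P A - measure Q A)"

definition cov :: "'w measure \<Rightarrow> ('w \<Rightarrow> real) \<Rightarrow> ('w \<Rightarrow> real) \<Rightarrow> real" where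
  "cov M U V = (\<integral>\<omega>. (U \<omega> - (\<integral>x. U x \<partial>M)) * (V \<omega> - (\<integral>x. V x \<partial>M)) \<partial>M)"

definition corr :: "'w measure \<Rightarrow> ('w \<Rightarrow> real) \<Rightarrow> ('w \<Rightarrow> real) \<Rightarrow> real" where
  "corr M U V = cov M U V / sqrt (cov M U U * cov M V V)"

definition fnorm :: "(nat \<Rightarrow> 'e measure) \<Rightarrow> (nat \<Rightarrow> 'e measure) \<Rightarrow> ('e \<Rightarrow> real) \<Rightarrow> ennreal" where
  "fnorm P Q f = (SUP n. (let s = (\<integral>\<^sup>+ x. ennreal ((f x)\<^sup>2) \<partial>P n) + (\<integral>\<^sup>+ x. ennreal ((f x)\<^sup>2) \<partial>Q n)
                          in if s = \<infinity> then \<infinity> else ennreal (sqrt (enn2real s))))"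

text \<open>The weighted CUSUM signed measure D_k (for sample size n, at outcome omega);
  X n i is the i-th observation, i = 1..n.\<close>

definition Dk :: "'e measure \<Rightarrow> (nat \<Rightarrow> nat \<Rightarrow> 'w \<Rightarrow> 'e) \<Rightarrow> real \<Rightarrow> nat \<Rightarrow> nat \<Rightarrow> 'w \<Rightarrow> 'e set \<Rightarrow> real" where
  "Dk E X \<gamma> n k \<omega> = (\<lambda>A. if A \<in> sets E then
      ((real k / real n) * (1 - real k / real n)) powr (1 - \<gamma>) *
      ((1 / real k) * (\<Sum>i\<in>{1..k}. indicator A (X n i \<omega>))
        - (1 / real (n - k)) * (\<Sum>i\<in>{k+1..n}. indicator A (X n i \<omega>)))
    else 0)"

definition thetahat :: "'e measure \<Rightarrow> (nat \<Rightarrow> nat \<Rightarrow> 'w \<Rightarrow> 'e) \<Rightarrow> (nat \<Rightarrow> 'w \<Rightarrow> ('e set \<Rightarrow> real) \<Rightarrow> real)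
     \<Rightarrow> real \<Rightarrow> nat \<Rightarrow> 'w \<Rightarrow> real" where
  "thetahat E X N \<gamma> n \<omega> = real (LEAST k. 1 \<le> k \<and> k < n \<and>
      (\<forall>j. 1 \<le> j \<and> j < n \<longrightarrow> N n \<omega> (Dk E X \<gamma> n j \<omega>) \<le> N n \<omega> (Dk E X \<gamma> n k \<omega>))) / real n"

end

theory Submission
  imports Defs
begin

text \<open>Let \<open>k*\<close> be the integer part of \<open>n \<theta>\<close>. Up to noise, \<open>D_k\<close> is \<open>a_k (P - Q)\<close>, where
  \<open>a_(k*) - a_k\<close> is at least a constant times \<open>|k - k*| / n\<close>. If \<open>k\<close> maximises \<open>N (D_k)\<close>, comparing
  \<open>D_k\<close> with \<open>(a_k / a_(k*)) D_(k*)\<close>, which removes the \<open>P - Q\<close> part, shows that \<open>b_n |k - k*| / n\<close>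
  is bounded by the weighted sum over \<open>\<F>\<close> of the noise increments between \<open>k*\<close> and \<open>k\<close>. The
  correlation decay bounds the second moment of a sum of \<open>m\<close> terms by a multiple of \<open>m^(2 - r)\<close> with
  \<open>r = min (1 - \<epsilon>) \<rho> < 1\<close>, and dyadic chaining turns this into a bound of order \<open>m^(1 - r/2)\<close> for
  the expected maximum over all partial sums of length at most \<open>m\<close>. Applied on dyadic blocks counted
  from both ends of the sample, it bounds all noise terms by \<open>o(b_n)\<close>, which yields consistency;
  applied on dyadic shells around \<open>k*\<close>, it yields the rate.\<close>

section \<open>Signed measures as differences of finite measures\<close>

text \<open>Two obstacles shape the proof. The weight of the noise is singular at both ends of the
  sample, so noise at \<open>ks\<close> and at \<open>k\<close> can be compared sharply only once
  \<open>k\<close> is known to stay away from the ends; consistency is a prerequisite of the rate,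
  not a by-product. And \<open>N\<close> may depend on the outcome, so the noise events are phrased
  through \<open>osc\<close>, which does not mention \<open>N\<close>, and \<open>N\<close> of a
  CUSUM measure is treated only pathwise.

  The rate is the balance on one shell. At distance about 2^j from \<open>ks\<close> the drift
  supplies b_n 2^j, while partial sums oscillate by 2^(j (1 - r/2)) on average. Markov's inequality
  gives a failure probability of order 2^(-j r/2) / b_n, and the sum over j \<ge> p is small once
  2^p is a large multiple of b_n^(-2/r). The strict bound r < 1, the reason for \<epsilon>, keeps
  the geometric ratio in the chaining above 1, so no logarithm is lost there.

  Signed integrals are defined by the Jordan decomposition, which hides their linearity; hence the
  detour through arbitrary differences of finite measures.\<close>

lemma nn_integral_sum_measure:
  assumes sets: "sets m1 = sets m" "sets m2 = sets m"
    and em: "\<And>A. A \<in> sets m \<Longrightarrow> emeasure m A = emeasure m1 A + emeasure m2 A"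
    and f: "f \<in> borel_measurable m"
  shows "(\<integral>\<^sup>+x. f x \<partial>m) = (\<integral>\<^sup>+x. f x \<partial>m1) + (\<integral>\<^sup>+x. f x \<partial>m2)"
  using f
proof (induction rule: borel_measurable_induct)
  case (cong f g)
  have "space m1 = space m" "space m2 = space m"
    using sets sets_eq_imp_space_eq by blast+
  then show ?case
    using cong by (metis nn_integral_cong)
next
  case (set A)
  then show ?case using em sets by simp
next
  case (mult u c)
  have "u \<in> borel_measurable m1" "u \<in> borel_measurable m2"
    using mult sets measurable_cong_sets by blast+
  then show ?case using mult by (simp add: nn_integral_cmult distrib_left)
next
  case (add u v)
  have "u \<in> borel_measurable m1" "u \<in> borel_measurable m2"
    "v \<in> borel_measurable m1" "v \<in> borel_measurable m2"
    using add sets measurable_cong_sets by blast+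
  then show ?case using add by (simp add: nn_integral_add algebra_simps)
next
  case (seq U)
  have *: "U i \<in> borel_measurable m1" "U i \<in> borel_measurable m2" for i
    using seq sets measurable_cong_sets by blast+
  have inc: "incseq (\<lambda>i. \<integral>\<^sup>+x. U i x \<partial>m1)" "incseq (\<lambda>i. \<integral>\<^sup>+x. U i x \<partial>m2)"
    by (intro monoI nn_integral_mono le_funD[OF monoD[OF seq(3)]]; simp)+
  have S: "(SUP i. U i) = (\<lambda>x. SUP i. U i x)" by (auto simp: fun_eq_iff image_comp)
  have "(\<integral>\<^sup>+x. (SUP i. U i) x \<partial>m) = (SUP i. \<integral>\<^sup>+x. U i x \<partial>m)"
    unfolding S using seq by (intro nn_integral_monotone_convergence_SUP) auto
  also have "\<dots> = (SUP i. (\<integral>\<^sup>+x. U i x \<partial>m1) + (\<integral>\<^sup>+x. U i x \<partial>m2))"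
    using seq by simp
  also have "\<dots> = (SUP i. \<integral>\<^sup>+x. U i x \<partial>m1) + (SUP i. \<integral>\<^sup>+x. U i x \<partial>m2)"
    by (rule ennreal_SUP_add[OF inc])
  also have "(SUP i. \<integral>\<^sup>+x. U i x \<partial>m1) = (\<integral>\<^sup>+x. (SUP i. U i) x \<partial>m1)"
    unfolding S using seq * by (intro nn_integral_monotone_convergence_SUP[symmetric]) auto
  also have "(SUP i. \<integral>\<^sup>+x. U i x \<partial>m2) = (\<integral>\<^sup>+x. (SUP i. U i) x \<partial>m2)"
    unfolding S using seq * by (intro nn_integral_monotone_convergence_SUP[symmetric]) auto
  finally show ?case .
qed

lemma integral_sum_measure:
  fixes f :: "'a \<Rightarrow> real"
  assumes sets: "sets m1 = sets m" "sets m2 = sets m"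
    and em: "\<And>A. A \<in> sets m \<Longrightarrow> emeasure m A = emeasure m1 A + emeasure m2 A"
  shows "integrable m f \<longleftrightarrow> integrable m1 f \<and> integrable m2 f"
    and "integrable m f \<Longrightarrow> (\<integral>x. f x \<partial>m) = (\<integral>x. f x \<partial>m1) + (\<integral>x. f x \<partial>m2)"
proof -
  have meas: "f \<in> borel_measurable m1 \<longleftrightarrow> f \<in> borel_measurable m"
    "f \<in> borel_measurable m2 \<longleftrightarrow> f \<in> borel_measurable m"
    using sets measurable_cong_sets by blast+
  note nn = nn_integral_sum_measure[OF sets em]
  show iff: "integrable m f \<longleftrightarrow> integrable m1 f \<and> integrable m2 f"
    unfolding integrable_iff_bounded meas using nn[of "\<lambda>x. ennreal (norm (f x))"] by auto
  assume i: "integrable m f"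
  then have i12: "integrable m1 f" "integrable m2 f" using iff by auto
  have fin: "(\<integral>\<^sup>+x. ennreal (f x) \<partial>m1) \<noteq> \<infinity>" "(\<integral>\<^sup>+x. ennreal (f x) \<partial>m2) \<noteq> \<infinity>"
    "(\<integral>\<^sup>+x. ennreal (- f x) \<partial>m1) \<noteq> \<infinity>" "(\<integral>\<^sup>+x. ennreal (- f x) \<partial>m2) \<noteq> \<infinity>"
    using i12 by (auto simp: real_integrable_def)
  show "(\<integral>x. f x \<partial>m) = (\<integral>x. f x \<partial>m1) + (\<integral>x. f x \<partial>m2)"
    unfolding real_lebesgue_integral_def[OF i] real_lebesgue_integral_def[OF i12(1)]
      real_lebesgue_integral_def[OF i12(2)]
    using i fin nn[of "\<lambda>x. ennreal (f x)"] nn[of "\<lambda>x. ennreal (- f x)"]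
    by (simp add: enn2real_plus top.not_eq_extremum)
qed

definition add_measure :: "'a measure \<Rightarrow> 'a measure \<Rightarrow> 'a measure" where
  "add_measure M N = measure_of (space M) (sets M) (\<lambda>A. emeasure M A + emeasure N A)"

lemma sets_add_measure [simp]: "sets (add_measure M N) = sets M"
  by (simp add: add_measure_def)

lemma emeasure_add_measure:
  assumes "sets N = sets M" "A \<in> sets M"
  shows "emeasure (add_measure M N) A = emeasure M A + emeasure N A"
  unfolding add_measure_def
proof (rule emeasure_measure_of_sigma)
  show "countably_additive (sets M) (\<lambda>A. emeasure M A + emeasure N A)"
    unfolding countably_additive_def
  proof safe
    fix A :: "nat \<Rightarrow> 'a set" assume A: "range A \<subseteq> sets M" "disjoint_family A"
    then have "(\<Sum>i. emeasure M (A i) + emeasure N (A i))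
        = (\<Sum>i. emeasure M (A i)) + (\<Sum>i. emeasure N (A i))"
      by (intro suminf_add[symmetric]) auto
    then show "(\<Sum>i. emeasure M (A i) + emeasure N (A i))
        = emeasure M (\<Union> (range A)) + emeasure N (\<Union> (range A))"
      using A assms by (simp add: suminf_emeasure)
  qed
qed (use assms in \<open>auto simp: positive_def sets.sigma_algebra_axioms\<close>)

text \<open>On a Hahn set \<open>Y\<close> the supremum that defines \<open>sm_pos\<close> is
  attained at \<open>A \<inter> Y\<close>, so the positive part is the difference of the two
  restrictions to \<open>Y\<close>. Integrals follow because this difference plus the smaller
  restriction is the larger one, and integration is additive in the measure.\<close>

lemma sm_pos_msub:
  assumes fin: "finite_measure \<mu>1" "finite_measure \<mu>2"
    and sets: "sets \<mu>1 = sets E" "sets \<mu>2 = sets E"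
    and Y: "Y \<in> sets E"
    and pos: "\<And>A. A \<in> sets E \<Longrightarrow> A \<subseteq> Y \<Longrightarrow> measure \<mu>2 A \<le> measure \<mu>1 A"
    and neg: "\<And>A. A \<in> sets E \<Longrightarrow> A \<inter> Y = {} \<Longrightarrow> measure \<mu>1 A \<le> measure \<mu>2 A"
    and f: "integrable \<mu>1 f" "integrable \<mu>2 f"
  shows "integrable (sm_pos E (msub \<mu>1 \<mu>2)) f"
    and "(\<integral>x. f x \<partial>sm_pos E (msub \<mu>1 \<mu>2)) =
      (\<integral>x. indicator Y x * f x \<partial>\<mu>1) - (\<integral>x. indicator Y x * (f x::real) \<partial>\<mu>2)"
proof -
  interpret m1: finite_measure \<mu>1 by fact
  interpret m2: finite_measure \<mu>2 by fact
  have spc: "space \<mu>1 = space E" "space \<mu>2 = space E" using sets sets_eq_imp_space_eq by blast+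
  define d1 where "d1 = density \<mu>1 (\<lambda>x. indicator Y x)"
  define d2 where "d2 = density \<mu>2 (\<lambda>x. indicator Y x)"
  have sd[simp]: "sets d1 = sets E" "sets d2 = sets E" by (auto simp: d1_def d2_def sets)
  have spd[simp]: "space d1 = space E" "space d2 = space E" by (auto simp: d1_def d2_def spc)
  have e1: "emeasure d1 A = ennreal (measure \<mu>1 (A \<inter> Y))" if "A \<in> sets E" for A
    unfolding d1_def using that Y sets
    by (subst emeasure_density) (auto simp: m1.emeasure_eq_measure[symmetric] nn_integral_indicator[symmetric]
      indicator_inter_arith ac_simps simp del: nn_integral_indicator intro!: nn_integral_cong split: split_indicator)
  have e2: "emeasure d2 A = ennreal (measure \<mu>2 (A \<inter> Y))" if "A \<in> sets E" for A
    unfolding d2_def using that Y sets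
    by (subst emeasure_density) (auto simp: m2.emeasure_eq_measure[symmetric] nn_integral_indicator[symmetric]
      indicator_inter_arith ac_simps simp del: nn_integral_indicator intro!: nn_integral_cong split: split_indicator)
  have fd: "finite_measure d1" "finite_measure d2"
    by (auto intro!: finite_measureI simp: e1 e2)
  have le: "emeasure d2 A \<le> emeasure d1 A" if "A \<in> sets d1" for A
    using that Y by (auto simp: e1 e2 intro!: ennreal_leI pos)
  define m where "m = diff_measure d1 d2"
  have sm[simp]: "sets m = sets E" "space m = space E" by (auto simp: m_def diff_measure_def)
  have em: "emeasure m A = emeasure d1 A - emeasure d2 A" if "A \<in> sets E" for A
    unfolding m_def using that by (intro emeasure_diff_measure fd le) auto
  have em': "emeasure m A = (SUP B\<in>{B \<in> sets E. B \<subseteq> A}. ennreal (msub \<mu>1 \<mu>2 B))"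
    if A: "A \<in> sets E" for A
  proof -
    have v: "emeasure m A = ennreal (msub \<mu>1 \<mu>2 (A \<inter> Y))"
      using A by (simp add: em e1 e2 msub_def ennreal_minus)
    show ?thesis unfolding v
    proof (rule antisym)
      show "ennreal (msub \<mu>1 \<mu>2 (A \<inter> Y)) \<le> (SUP B\<in>{B \<in> sets E. B \<subseteq> A}. ennreal (msub \<mu>1 \<mu>2 B))"
        using A Y by (intro SUP_upper) auto
      show "(SUP B\<in>{B \<in> sets E. B \<subseteq> A}. ennreal (msub \<mu>1 \<mu>2 B)) \<le> ennreal (msub \<mu>1 \<mu>2 (A \<inter> Y))"
      proof (rule SUP_least)
        fix B assume "B \<in> {B \<in> sets E. B \<subseteq> A}"
        then have B: "B \<in> sets E" "B \<subseteq> A" by auto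
        have s: "measure \<mu> B = measure \<mu> (B \<inter> Y) + measure \<mu> (B - Y)"
          "measure \<mu> (A \<inter> Y) = measure \<mu> (B \<inter> Y) + measure \<mu> ((A - B) \<inter> Y)"
          if "finite_measure \<mu>" "sets \<mu> = sets E" for \<mu>
        proof -
          interpret finite_measure \<mu> by fact
          show "measure \<mu> B = measure \<mu> (B \<inter> Y) + measure \<mu> (B - Y)"
            using B Y that by (subst finite_measure_Union[symmetric]) (auto intro!: arg_cong[where f="measure \<mu>"])
          show "measure \<mu> (A \<inter> Y) = measure \<mu> (B \<inter> Y) + measure \<mu> ((A - B) \<inter> Y)"
            using A B Y that by (subst finite_measure_Union[symmetric]) (auto intro!: arg_cong[where f="measure \<mu>"])
        qed
        \<comment> \<open>Passing from \<open>B\<close> to \<open>A \<inter> Y\<close> drops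
          \<open>B - Y\<close>, where \<open>\<mu>2\<close> dominates, and gains
          \<open>(A - B) \<inter> Y\<close>, where \<open>\<mu>1\<close> dominates; neither move
          lowers the difference.\<close>
        have "measure \<mu>1 (B - Y) \<le> measure \<mu>2 (B - Y)" using B Y by (intro neg) auto
        moreover have "measure \<mu>2 ((A - B) \<inter> Y) \<le> measure \<mu>1 ((A - B) \<inter> Y)"
          using A B Y by (intro pos) auto
        ultimately show "ennreal (msub \<mu>1 \<mu>2 B) \<le> ennreal (msub \<mu>1 \<mu>2 (A \<inter> Y))"
          using s[OF fin(1) sets(1)] s[OF fin(2) sets(2)] by (intro ennreal_leI) (simp add: msub_def)
      qed
    qed
  qed
  have eq: "sm_pos E (msub \<mu>1 \<mu>2) = m"
  proof -
    have "sm_pos E (msub \<mu>1 \<mu>2) = measure_of (space E) (sets E) (emeasure m)"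
      unfolding sm_pos_def by (intro measure_of_eq) (auto simp: em' sets.space_closed sets.sigma_sets_eq)
    also have "\<dots> = m" using measure_of_of_measure[of m] by simp
    finally show ?thesis .
  qed
  have fm: "f \<in> borel_measurable \<mu>1" "f \<in> borel_measurable \<mu>2" using f by auto
  have ind: "indicator Y \<in> borel_measurable \<mu>1" "indicator Y \<in> borel_measurable \<mu>2"
    using Y sets by auto
  have di: "density \<mu>1 (\<lambda>x. indicator Y x) = density \<mu>1 (\<lambda>x. ennreal (indicator Y x))"
    "density \<mu>2 (\<lambda>x. indicator Y x) = density \<mu>2 (\<lambda>x. ennreal (indicator Y x))"
    by (auto intro!: arg_cong[where f="density _"] simp: fun_eq_iff split: split_indicator)
  have i1: "integrable d1 f"
    unfolding d1_def di using fm ind f Y sets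
      integrable_mult_indicator[of Y \<mu>1 f]
    by (subst integrable_density) auto
  have v1: "(\<integral>x. f x \<partial>d1) = (\<integral>x. indicator Y x * f x \<partial>\<mu>1)"
    unfolding d1_def di using fm ind Y sets by (subst integral_density) auto
  have v2: "(\<integral>x. f x \<partial>d2) = (\<integral>x. indicator Y x * f x \<partial>\<mu>2)"
    unfolding d2_def di using fm ind Y sets by (subst integral_density) auto
  have add: "emeasure d1 A = emeasure m A + emeasure d2 A" if "A \<in> sets d1" for A
    using that le[of A] by (simp add: em diff_add_cancel_ennreal)
  note s = integral_sum_measure[of m d1 d2 f, OF _ _ add]
  show "integrable (sm_pos E (msub \<mu>1 \<mu>2)) f"
    unfolding eq using s(1) i1 by simp
  show "(\<integral>x. f x \<partial>sm_pos E (msub \<mu>1 \<mu>2)) =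
      (\<integral>x. indicator Y x * f x \<partial>\<mu>1) - (\<integral>x. indicator Y x * f x \<partial>\<mu>2)"
    unfolding eq using s(2) i1 by (simp add: v1 v2)
qed

text \<open>The negative part of the difference is the positive part of the reversed one, with the
  complement of \<open>Y\<close> as Hahn set. The two measures need not be the Jordan parts: mass
  common to both cancels.\<close>

lemma sm_integral_msub:
  assumes fin: "finite_measure \<mu>1" "finite_measure \<mu>2"
    and sets: "sets \<mu>1 = sets E" "sets \<mu>2 = sets E"
    and f: "integrable \<mu>1 f" "integrable \<mu>2 f"
  shows "sm_integrable E (msub \<mu>1 \<mu>2) f"
    and "sm_integral E (msub \<mu>1 \<mu>2) f = (\<integral>x. f x \<partial>\<mu>1) - (\<integral>x. f x \<partial>\<mu>2)"
proof -
  interpret m1: finite_measure \<mu>1 by fact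
  interpret m2: finite_measure \<mu>2 by fact
  have spc: "space \<mu>1 = space E" "space \<mu>2 = space E" using sets sets_eq_imp_space_eq by blast+
  obtain Y where Y: "Y \<in> sets E"
    and pos: "\<And>A. A \<in> sets E \<Longrightarrow> A \<subseteq> Y \<Longrightarrow> measure \<mu>2 A \<le> measure \<mu>1 A"
    and neg: "\<And>A. A \<in> sets E \<Longrightarrow> A \<inter> Y = {} \<Longrightarrow> measure \<mu>1 A \<le> measure \<mu>2 A"
  proof -
    obtain Y where "Y \<in> sets E"
      "\<And>X. X \<in> sets E \<Longrightarrow> X \<subseteq> Y \<Longrightarrow> emeasure \<mu>2 X \<le> emeasure \<mu>1 X"
      "\<And>X. X \<in> sets E \<Longrightarrow> X \<inter> Y = {} \<Longrightarrow> emeasure \<mu>1 X \<le> emeasure \<mu>2 X"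
      using finite_unsigned_Hahn_decomposition[OF fin] sets by auto
    then show ?thesis
      by (intro that[of Y]) (simp_all add: m1.emeasure_eq_measure m2.emeasure_eq_measure)
  qed
  let ?Z = "space E - Y"
  have Z: "?Z \<in> sets E" using Y by auto
  have posZ: "measure \<mu>1 A \<le> measure \<mu>2 A" if "A \<in> sets E" "A \<subseteq> ?Z" for A
    using that by (intro neg) auto
  have negZ: "measure \<mu>2 A \<le> measure \<mu>1 A" if "A \<in> sets E" "A \<inter> ?Z = {}" for A
    using that sets.sets_into_space[OF that(1)] by (intro pos) auto
  have minus: "(\<lambda>A. - msub \<mu>1 \<mu>2 A) = msub \<mu>2 \<mu>1" by (auto simp: msub_def)
  have p: "integrable (sm_pos E (msub \<mu>1 \<mu>2)) f"
    "(\<integral>x. f x \<partial>sm_pos E (msub \<mu>1 \<mu>2)) =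
      (\<integral>x. indicator Y x * f x \<partial>\<mu>1) - (\<integral>x. indicator Y x * f x \<partial>\<mu>2)"
    by (rule sm_pos_msub; fact fin sets Y pos neg f)+
  have q: "integrable (sm_pos E (msub \<mu>2 \<mu>1)) f"
    "(\<integral>x. f x \<partial>sm_pos E (msub \<mu>2 \<mu>1)) =
      (\<integral>x. indicator ?Z x * f x \<partial>\<mu>2) - (\<integral>x. indicator ?Z x * f x \<partial>\<mu>1)"
    by (rule sm_pos_msub; fact fin sets Z posZ negZ f)+
  show "sm_integrable E (msub \<mu>1 \<mu>2) f"
    unfolding sm_integrable_def sm_neg_def minus using p(1) q(1) by simp
  have split: "(\<integral>x. f x \<partial>\<mu>) = (\<integral>x. indicator Y x * f x \<partial>\<mu>) + (\<integral>x. indicator ?Z x * f x \<partial>\<mu>)"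
    if "integrable \<mu> f" "sets \<mu> = sets E" for \<mu>
  proof -
    have sp: "space \<mu> = space E" using that sets_eq_imp_space_eq by blast
    have "(\<integral>x. f x \<partial>\<mu>) = (\<integral>x. indicator Y x * f x + indicator ?Z x * f x \<partial>\<mu>)"
      by (rule Bochner_Integration.integral_cong) (auto simp: sp split: split_indicator)
    also have "\<dots> = (\<integral>x. indicator Y x * f x \<partial>\<mu>) + (\<integral>x. indicator ?Z x * f x \<partial>\<mu>)"
      using integrable_mult_indicator[of Y \<mu> f] integrable_mult_indicator[of ?Z \<mu> f] that Y Z
      by (intro Bochner_Integration.integral_add) auto
    finally show ?thesis .
  qed
  show "sm_integral E (msub \<mu>1 \<mu>2) f = (\<integral>x. f x \<partial>\<mu>1) - (\<integral>x. f x \<partial>\<mu>2)"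
    unfolding sm_integral_def sm_neg_def minus p(2) q(2)
    using split[OF f(1) sets(1)] split[OF f(2) sets(2)] by simp
qed

lemma fsm_msub:
  assumes fin: "finite_measure \<mu>1" "finite_measure \<mu>2"
    and sets: "sets \<mu>1 = sets E" "sets \<mu>2 = sets E"
  shows "fsm E (msub \<mu>1 \<mu>2)"
  unfolding fsm_def msub_def
proof (intro conjI allI impI)
  fix A :: "nat \<Rightarrow> 'a set" assume A: "range A \<subseteq> sets E" "disjoint_family A"
  show "(\<lambda>i. measure \<mu>1 (A i) - measure \<mu>2 (A i)) sums (measure \<mu>1 (\<Union>i. A i) - measure \<mu>2 (\<Union>i. A i))"
    using A sets by (intro sums_diff finite_measure.finite_measure_UNION fin) auto
qed (auto simp: measure_notin_sets sets)

text \<open>The Jordan parts of a sum are not the sums of the Jordan parts, so additivity cannot be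
  read off from \<open>sm_integral\<close>. Admitting any representation by two finite measures
  makes the relation closed under sums and multiples, and it also delivers the integrability that
  the bound on \<open>N\<close> asks for.\<close>

definition sm_functional ::
    "'e measure \<Rightarrow> ('e \<Rightarrow> real) set \<Rightarrow> ('e set \<Rightarrow> real) \<Rightarrow> (('e \<Rightarrow> real) \<Rightarrow> real) \<Rightarrow> bool" where
  "sm_functional E \<F> \<nu> L \<longleftrightarrow> (\<exists>\<mu>1 \<mu>2. finite_measure \<mu>1 \<and> finite_measure \<mu>2 \<and>
     sets \<mu>1 = sets E \<and> sets \<mu>2 = sets E \<and> \<nu> = msub \<mu>1 \<mu>2 \<and>
     (\<forall>f\<in>\<F>. integrable \<mu>1 f \<and> integrable \<mu>2 f \<and> L f = (\<integral>x. f x \<partial>\<mu>1) - (\<integral>x. f x \<partial>\<mu>2)))"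

lemma sm_functionalD:
  assumes "sm_functional E \<F> \<nu> L"
  shows "fsm E \<nu>" "f \<in> \<F> \<Longrightarrow> sm_integrable E \<nu> f" "f \<in> \<F> \<Longrightarrow> sm_integral E \<nu> f = L f"
  using assms unfolding sm_functional_def by (auto simp: fsm_msub sm_integral_msub)

lemma sm_functional_add:
  assumes "sm_functional E \<F> \<nu> L" "sm_functional E \<F> \<nu>' L'"
  shows "sm_functional E \<F> (\<lambda>A. \<nu> A + \<nu>' A) (\<lambda>f. L f + L' f)"
proof -
  from assms obtain a b c d where
    fin: "finite_measure a" "finite_measure b" "finite_measure c" "finite_measure d"
    and sets: "sets a = sets E" "sets b = sets E" "sets c = sets E" "sets d = sets E"
    and \<nu>: "\<nu> = msub a b" "\<nu>' = msub c d"
    and L: "\<And>f. f \<in> \<F> \<Longrightarrow> integrable a f \<and> integrable b f \<and> L f = (\<integral>x. f x \<partial>a) - (\<integral>x. f x \<partial>b)"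
      "\<And>f. f \<in> \<F> \<Longrightarrow> integrable c f \<and> integrable d f \<and> L' f = (\<integral>x. f x \<partial>c) - (\<integral>x. f x \<partial>d)"
    unfolding sm_functional_def by blast
  have add: "finite_measure (add_measure p q)"
      "\<And>A. measure (add_measure p q) A = measure p A + measure q A"
      "\<And>f::'a \<Rightarrow> real. integrable p f \<Longrightarrow> integrable q f \<Longrightarrow> integrable (add_measure p q) f"
      "\<And>f::'a \<Rightarrow> real. integrable p f \<Longrightarrow> integrable q f \<Longrightarrow>
        (\<integral>x. f x \<partial>add_measure p q) = (\<integral>x. f x \<partial>p) + (\<integral>x. f x \<partial>q)"
    if "finite_measure p" "finite_measure q" "sets p = sets E" "sets q = sets E" for p q :: "'a measure"
  proof -
    interpret p: finite_measure p by fact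
    interpret q: finite_measure q by fact
    have e: "emeasure (add_measure p q) A = emeasure p A + emeasure q A" if "A \<in> sets E" for A
      using that \<open>sets p = _\<close> \<open>sets q = _\<close> by (intro emeasure_add_measure) auto
    have sp: "space (add_measure p q) = space E" using \<open>sets p = _\<close> by (metis sets_add_measure sets_eq_imp_space_eq)
    show fm: "finite_measure (add_measure p q)"
      by (rule finite_measureI) (simp add: sp e p.emeasure_eq_measure q.emeasure_eq_measure)
    show "measure (add_measure p q) A = measure p A + measure q A" for A
    proof (cases "A \<in> sets E")
      case True
      then have "ennreal (measure (add_measure p q) A) = ennreal (measure p A + measure q A)"
        using fm e[OF True]
        by (simp add: ennreal_plus p.emeasure_eq_measure q.emeasure_eq_measure finite_measure.emeasure_eq_measure)
      then show ?thesis by (subst (asm) ennreal_inj) auto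
    qed (use that in \<open>simp add: measure_notin_sets\<close>)
    fix f :: "'a \<Rightarrow> real" assume i: "integrable p f" "integrable q f"
    note s = integral_sum_measure[of p "add_measure p q" q f]
    show "integrable (add_measure p q) f"
      using i s(1) that e by simp
    then show "(\<integral>x. f x \<partial>add_measure p q) = (\<integral>x. f x \<partial>p) + (\<integral>x. f x \<partial>q)"
      using s(2) that e by simp
  qed
  note ac = add[OF fin(1,3) sets(1,3)] and bd = add[OF fin(2,4) sets(2,4)]
  show ?thesis
    unfolding sm_functional_def
    by (rule exI[of _ "add_measure a c"], rule exI[of _ "add_measure b d"])
      (use L sets in \<open>auto simp: ac bd \<nu> msub_def fun_eq_iff\<close>)
qed

lemma sm_functional_scale:
  assumes "sm_functional E \<F> \<nu> L"
  shows "sm_functional E \<F> (\<lambda>A. c * \<nu> A) (\<lambda>f. c * L f)"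
proof -
  from assms obtain p q where
    fin: "finite_measure p" "finite_measure q"
    and sets: "sets p = sets E" "sets q = sets E"
    and \<nu>: "\<nu> = msub p q"
    and L: "\<And>f. f \<in> \<F> \<Longrightarrow> integrable p f \<and> integrable q f \<and> L f = (\<integral>x. f x \<partial>p) - (\<integral>x. f x \<partial>q)"
    unfolding sm_functional_def by blast
  have sc: "finite_measure (scale_measure (ennreal k) m)"
      "\<And>A. measure (scale_measure (ennreal k) m) A = k * measure m A"
      "\<And>f::'a \<Rightarrow> real. integrable m f \<Longrightarrow> integrable (scale_measure (ennreal k) m) f"
      "\<And>f::'a \<Rightarrow> real. integrable m f \<Longrightarrow> (\<integral>x. f x \<partial>scale_measure (ennreal k) m) = k * (\<integral>x. f x \<partial>m)"
    if "finite_measure m" "k \<ge> 0" for m :: "'a measure" and k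
  proof -
    interpret finite_measure m by fact
    show "finite_measure (scale_measure (ennreal k) m)"
      by (rule finite_measureI) (simp add: space_scale_measure emeasure_eq_measure ennreal_mult_eq_top_iff)
    show "\<And>A. measure (scale_measure (ennreal k) m) A = k * measure m A"
      using \<open>k \<ge> 0\<close> by (simp add: measure_def enn2real_mult)
    have d: "scale_measure (ennreal k) m = density m (\<lambda>_. ennreal k)"
      by (rule measure_eqI) (auto simp: emeasure_density nn_integral_cmult_indicator)
    fix f :: "'a \<Rightarrow> real" assume i: "integrable m f"
    then have fm: "f \<in> borel_measurable m" by auto
    show "integrable (scale_measure (ennreal k) m) f"
      unfolding d using i fm \<open>k \<ge> 0\<close> by (subst integrable_density) auto
    show "(\<integral>x. f x \<partial>scale_measure (ennreal k) m) = k * (\<integral>x. f x \<partial>m)"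
      unfolding d using i fm \<open>k \<ge> 0\<close> by (subst integral_density) auto
  qed
  have cL: "c * L f = c * (\<integral>x. f x \<partial>p) - c * (\<integral>x. f x \<partial>q)" if "f \<in> \<F>" for f
    using L[OF that] by (simp add: right_diff_distrib)
  show ?thesis
  proof (cases "c \<ge> 0")
    case True
    show ?thesis
      unfolding sm_functional_def
      by (rule exI[of _ "scale_measure (ennreal c) p"], rule exI[of _ "scale_measure (ennreal c) q"])
        (use L sets True in \<open>auto simp: sc fin cL \<nu> msub_def fun_eq_iff right_diff_distrib\<close>)
  next
    case False
    \<comment> \<open>A negative factor exchanges the roles of the two measures.\<close>
    then have c: "- c \<ge> 0" by simp
    show ?thesis
      unfolding sm_functional_def
      by (rule exI[of _ "scale_measure (ennreal (-c)) q"], rule exI[of _ "scale_measure (ennreal (-c)) p"])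
        (use L sets c in \<open>auto simp: sc[OF _ c] fin cL \<nu> msub_def fun_eq_iff right_diff_distrib simp del: ennreal_neg\<close>)
  qed
qed

lemma sm_functional_msub:
  assumes "finite_measure \<mu>1" "finite_measure \<mu>2" "sets \<mu>1 = sets E" "sets \<mu>2 = sets E"
    and "\<And>f. f \<in> \<F> \<Longrightarrow> integrable \<mu>1 f" "\<And>f. f \<in> \<F> \<Longrightarrow> integrable \<mu>2 f"
  shows "sm_functional E \<F> (msub \<mu>1 \<mu>2) (\<lambda>f. (\<integral>x. f x \<partial>\<mu>1) - (\<integral>x. f x \<partial>\<mu>2))"
  unfolding sm_functional_def using assms by blast

lemma sm_functional_sum:
  assumes "finite I" "I \<noteq> {}" "\<And>i. i \<in> I \<Longrightarrow> sm_functional E \<F> (\<nu> i) (L i)"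
  shows "sm_functional E \<F> (\<lambda>A. \<Sum>i\<in>I. \<nu> i A) (\<lambda>f. \<Sum>i\<in>I. L i f)"
  using assms
proof (induction I rule: finite_ne_induct)
  case (insert i I)
  then have "sm_functional E \<F> (\<lambda>A. \<nu> i A + (\<Sum>i\<in>I. \<nu> i A)) (\<lambda>f. L i f + (\<Sum>i\<in>I. L i f))"
    by (intro sm_functional_add) auto
  then show ?case using insert by simp
qed simp

lemma sm_functional_return:
  assumes x: "x \<in> space E" and \<F>: "\<F> \<subseteq> borel_measurable E"
  shows "sm_functional E \<F> (measure (return E x)) (\<lambda>f. f x)"
proof -
  interpret r: prob_space "return E x" by (rule prob_space_return[OF x])
  have *: "integrable (return E x) f" "(\<integral>x. f x \<partial>return E x) = f x"
    "integrable (null_measure E) f" "(\<integral>x. f x \<partial>null_measure E) = 0" if "f \<in> \<F>" for f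
  proof -
    have m: "f \<in> borel_measurable E" using that \<F> by auto
    then show "integrable (return E x) f"
      by (auto simp: integrable_iff_bounded nn_integral_return x)
    show "(\<integral>x. f x \<partial>return E x) = f x" using m x by (simp add: integral_return)
    show n: "integrable (null_measure E) f"
      using m by (simp add: integrable_iff_bounded)
    show "(\<integral>x. f x \<partial>null_measure E) = 0"
      by (simp add: real_lebesgue_integral_def[OF n])
  qed
  have "sm_functional E \<F> (msub (return E x) (null_measure E))
      (\<lambda>f. (\<integral>x. f x \<partial>return E x) - (\<integral>x. f x \<partial>null_measure E))"
    by (intro sm_functional_msub * finite_measureI r.finite_measure_axioms) simp_all
  moreover have "msub (return E x) (null_measure E) = measure (return E x)"
    by (simp add: msub_def fun_eq_iff)
  ultimately show ?thesis
    unfolding sm_functional_def by (auto simp: *)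
qed

section \<open>A maximal inequality for correlated sums\<close>

text \<open>Jensen's inequality for the square root, read off from the fact that the variance of
  \<open>sqrt (Z x)\<close> is non-negative.\<close>

lemma (in prob_space) nn_integral_sqrt_le:
  assumes Z: "integrable M Z" "\<And>x. 0 \<le> Z x" and v: "expectation Z \<le> v"
  shows "(\<integral>\<^sup>+x. ennreal (sqrt (Z x)) \<partial>M) \<le> ennreal (sqrt v)"
proof -
  have Zm[measurable]: "Z \<in> borel_measurable M" using Z by auto
  have sq: "(\<lambda>x. (sqrt (Z x))\<^sup>2) = Z" using Z by auto
  have i: "integrable M (\<lambda>x. sqrt (Z x))"
    by (rule square_integrable_imp_integrable) (use Z in \<open>auto simp: sq\<close>)
  have "0 \<le> variance (\<lambda>x. sqrt (Z x))" by (rule variance_positive)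
  also have "\<dots> = expectation (\<lambda>x. (sqrt (Z x))\<^sup>2) - (expectation (\<lambda>x. sqrt (Z x)))\<^sup>2"
    by (rule variance_eq[OF i]) (use Z in \<open>auto simp: sq\<close>)
  finally have "(expectation (\<lambda>x. sqrt (Z x)))\<^sup>2 \<le> v" using v by (simp add: sq)
  then have "expectation (\<lambda>x. sqrt (Z x)) \<le> sqrt v" by (rule real_le_rsqrt)
  then show ?thesis
    using Z by (subst nn_integral_eq_integral[OF i]) (auto intro: ennreal_leI)
qed

definition max_partial :: "nat \<Rightarrow> (nat \<Rightarrow> 'w \<Rightarrow> real) \<Rightarrow> 'w \<Rightarrow> ennreal" where
  "max_partial p Y \<omega> = (SUP k\<in>{..2^p}. ennreal \<bar>\<Sum>i<k. Y i \<omega>\<bar>)"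

lemma max_partial_ge: "k \<le> 2^p \<Longrightarrow> ennreal \<bar>\<Sum>i<k. Y i \<omega>\<bar> \<le> max_partial p Y \<omega>"
  unfolding max_partial_def by (rule SUP_upper) auto

lemma borel_measurable_max_partial [measurable]:
  assumes [measurable]: "\<And>i. Y i \<in> borel_measurable M"
  shows "max_partial p Y \<in> borel_measurable M"
  unfolding max_partial_def[abs_def] by measurable

lemma sum_pairs: "(\<Sum>i<m. g (2 * i) + g (Suc (2 * i))) = (\<Sum>i<2 * m. g i)" for g :: "nat \<Rightarrow> real"
  by (induction m) (auto simp: algebra_simps)

text \<open>Dyadic chaining: adding up neighbours turns a partial sum over \<open>k \<le> 2^(p+1)\<close> terms into one
  over \<open>k div 2 \<le> 2^p\<close> terms, up to a single remaining term.\<close>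
lemma (in prob_space) nn_integral_max_partial_le:
  assumes "\<And>i. Y i \<in> borel_measurable M" "\<And>i. integrable M (\<lambda>\<omega>. (Y i \<omega>)\<^sup>2)"
    and "\<And>a m. integrable M (\<lambda>\<omega>. (\<Sum>i<m. Y (a + i) \<omega>)\<^sup>2)"
    and "\<And>a m. expectation (\<lambda>\<omega>. (\<Sum>i<m. Y (a + i) \<omega>)\<^sup>2) \<le> v m"
  shows "(\<integral>\<^sup>+\<omega>. max_partial p Y \<omega> \<partial>M) \<le> ennreal (\<Sum>l\<le>p. sqrt (2^(p - l) * v (2^l)))"
  using assms
proof (induction p arbitrary: Y v)
  case 0
  have "max_partial 0 Y \<omega> \<le> ennreal (sqrt ((Y 0 \<omega>)\<^sup>2))" for \<omega>
    unfolding max_partial_def by (rule SUP_least) (auto simp: le_Suc_eq atMost_Suc)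
  then have "(\<integral>\<^sup>+\<omega>. max_partial 0 Y \<omega> \<partial>M) \<le> (\<integral>\<^sup>+\<omega>. ennreal (sqrt ((Y 0 \<omega>)\<^sup>2)) \<partial>M)"
    by (intro nn_integral_mono)
  also have "\<dots> \<le> ennreal (sqrt (v 1))"
  proof (rule nn_integral_sqrt_le)
    have "expectation (\<lambda>\<omega>. (\<Sum>i<1. Y (0 + i) \<omega>)\<^sup>2) \<le> v 1" by (rule 0)
    then show "expectation (\<lambda>\<omega>. (Y 0 \<omega>)\<^sup>2) \<le> v 1" by simp
  qed (use 0(2) in auto)
  finally show ?case by simp
next
  case (Suc p)
  note [measurable] = Suc.prems(1)
  define Y' where "Y' = (\<lambda>i \<omega>. Y (2 * i) \<omega> + Y (Suc (2 * i)) \<omega>)"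
  \<comment> \<open>Whichever index \<open>2 * q\<close> is left over, its square is a summand of
    \<open>R\<close>; so one random variable serves all \<open>k\<close> at once.\<close>
  define R where "R \<omega> = (\<Sum>i<2^Suc p. (Y i \<omega>)\<^sup>2)" for \<omega>
  have pair: "(\<Sum>i<m. Y' (a + i) \<omega>) = (\<Sum>i<2*m. Y (2*a + i) \<omega>)" for a m \<omega>
    unfolding Y'_def by (subst sum_pairs[of "\<lambda>i. Y (2*a+i) \<omega>", symmetric]) (simp add: algebra_simps)
  have intY': "integrable M (\<lambda>\<omega>. (Y' i \<omega>)\<^sup>2)" for i
    using Suc.prems(3)[of "2 * i" 2] by (simp add: Y'_def numeral_2_eq_2)
  have measY': "Y' i \<in> borel_measurable M" for i unfolding Y'_def by measurable
  \<comment> \<open>A block of \<open>m\<close> pair sums is a block of \<open>2 * m\<close>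
    original terms, so \<open>v\<close> is replaced by \<open>\<lambda>m. v (2 * m)\<close>; this is
    why the induction generalises over \<open>v\<close>.\<close>
  have IH: "(\<integral>\<^sup>+\<omega>. max_partial p Y' \<omega> \<partial>M) \<le> ennreal (\<Sum>l\<le>p. sqrt (2^(p - l) * v (2 * 2^l)))"
    by (rule Suc.IH[of Y' "\<lambda>m. v (2 * m)"])
      (use Suc.prems(3,4) intY' measY' in \<open>auto simp: pair\<close>)
  have le: "max_partial (Suc p) Y \<omega> \<le> ennreal (sqrt (R \<omega>)) + max_partial p Y' \<omega>" for \<omega>
    unfolding max_partial_def[of "Suc p"]
  proof (rule SUP_least)
    fix k :: nat assume k: "k \<in> {..2 ^ Suc p}"
    define q where "q = k div 2"
    have q: "q \<le> 2^p" using k by (auto simp: q_def)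
    have R0: "0 \<le> R \<omega>" unfolding R_def by (intro sum_nonneg) auto
    have "\<bar>\<Sum>i<k. Y i \<omega>\<bar> \<le> sqrt (R \<omega>) + \<bar>\<Sum>i<q. Y' i \<omega>\<bar>"
    proof (cases "even k")
      case True
      then have "k = 2 * q" by (simp add: q_def)
      then show ?thesis using pair[of 0 _ q] R0 by simp
    next
      case False
      then have kq: "k = Suc (2 * q)" by (simp add: q_def)
      then have "(Y (2 * q) \<omega>)\<^sup>2 \<le> R \<omega>"
        unfolding R_def using k by (intro member_le_sum) auto
      then have "\<bar>Y (2 * q) \<omega>\<bar> \<le> sqrt (R \<omega>)" by (metis real_sqrt_abs real_sqrt_le_mono)
      then show ?thesis using pair[of 0 _ q] kq by simp
    qed
    then have "ennreal \<bar>\<Sum>i<k. Y i \<omega>\<bar> \<le> ennreal (sqrt (R \<omega>)) + ennreal \<bar>\<Sum>i<q. Y' i \<omega>\<bar>"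
      using R0 ennreal_leI by (subst ennreal_plus[symmetric]) (simp_all del: ennreal_plus)
    also have "\<dots> \<le> ennreal (sqrt (R \<omega>)) + max_partial p Y' \<omega>"
      by (intro add_left_mono max_partial_ge q)
    finally show "ennreal \<bar>\<Sum>i<k. Y i \<omega>\<bar> \<le> ennreal (sqrt (R \<omega>)) + max_partial p Y' \<omega>" .
  qed
  have "expectation R = (\<Sum>i<2^Suc p. expectation (\<lambda>\<omega>. (Y i \<omega>)\<^sup>2))"
    unfolding R_def by (rule Bochner_Integration.integral_sum) (use Suc.prems(2) in auto)
  also have "\<dots> \<le> (\<Sum>i<(2::nat)^Suc p. v 1)"
  proof (rule sum_mono)
    fix i
    have "expectation (\<lambda>\<omega>. (\<Sum>j<1. Y (i + j) \<omega>)\<^sup>2) \<le> v 1" by (rule Suc.prems)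
    then show "expectation (\<lambda>\<omega>. (Y i \<omega>)\<^sup>2) \<le> v 1" by simp
  qed
  finally have ER: "expectation R \<le> 2^Suc p * v 1" by simp
  have "(\<integral>\<^sup>+\<omega>. ennreal (sqrt (R \<omega>)) \<partial>M) \<le> ennreal (sqrt (2^Suc p * v 1))"
    by (rule nn_integral_sqrt_le[OF _ _ ER])
      (use Suc.prems(2) in \<open>auto simp: R_def[abs_def] intro!: sum_nonneg\<close>)
  have v0: "0 \<le> v m" for m
  proof -
    have "0 \<le> expectation (\<lambda>\<omega>. (\<Sum>i<m. Y (0 + i) \<omega>)\<^sup>2)"
      by (rule Bochner_Integration.integral_nonneg) simp
    also have "\<dots> \<le> v m" by (rule Suc.prems)
    finally show ?thesis .
  qed
  have "(\<integral>\<^sup>+\<omega>. max_partial (Suc p) Y \<omega> \<partial>M)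
      \<le> (\<integral>\<^sup>+\<omega>. ennreal (sqrt (R \<omega>)) + max_partial p Y' \<omega> \<partial>M)"
    by (intro nn_integral_mono le)
  also have "\<dots> = (\<integral>\<^sup>+\<omega>. ennreal (sqrt (R \<omega>)) \<partial>M) + (\<integral>\<^sup>+\<omega>. max_partial p Y' \<omega> \<partial>M)"
    by (rule nn_integral_add) (auto simp: R_def[abs_def] Y'_def[abs_def])
  also have "\<dots> \<le> ennreal (sqrt (2^Suc p * v 1)) + ennreal (\<Sum>l\<le>p. sqrt (2^(p - l) * v (2 * 2^l)))"
    by (intro add_mono IH) fact
  also have "\<dots> = ennreal (sqrt (2^Suc p * v 1) + (\<Sum>l\<le>p. sqrt (2^(p - l) * v (2 * 2^l))))"
    using v0 by (intro ennreal_plus[symmetric]) (auto intro!: sum_nonneg)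
  \<comment> \<open>The leftover terms form level 0, and the levels of the paired sequence move up
    by one.\<close>
  also have "sqrt (2^Suc p * v 1) + (\<Sum>l\<le>p. sqrt (2^(p - l) * v (2 * 2^l)))
      = (\<Sum>l\<le>Suc p. sqrt (2^(Suc p - l) * v (2^l)))"
    by (subst sum.atMost_Suc_shift) simp
  finally show ?case .
qed

section \<open>Second moments under polynomial correlation decay\<close>

lemma sum_powr_neg_le:
  fixes r :: real
  assumes r: "0 < r" "r < 1"
  shows "(\<Sum>d=1..m. real d powr (- r)) \<le> real m powr (1 - r) / (1 - r)"
proof (induction m)
  case (Suc m)
  \<comment> \<open>A discrete comparison with the integral of \<open>x powr (- r)\<close>. The mean
    value theorem needs a positive left end; for \<open>m = 0\<close> the claim is
    \<open>1 - r \<le> 1\<close>, since \<open>0 powr (1 - r) = 0\<close>.\<close>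
  have step: "(1 - r) * real (Suc m) powr (- r) \<le> real (Suc m) powr (1 - r) - real m powr (1 - r)"
  proof (cases "m = 0")
    case False
    have "\<exists>z>real m. z < real (Suc m) \<and>
        real (Suc m) powr (1 - r) - real m powr (1 - r) = (real (Suc m) - real m) * ((1 - r) * z powr (- r))"
    proof (rule MVT2)
      fix x assume "real m \<le> x"
      then show "((\<lambda>x. x powr (1 - r)) has_real_derivative (1 - r) * x powr (- r)) (at x)"
        using has_real_derivative_powr[of x "1 - r"] False by simp
    qed simp
    then obtain z where z: "real m < z" "z < real (Suc m)"
      "real (Suc m) powr (1 - r) - real m powr (1 - r) = (1 - r) * z powr (- r)" by auto
    have "real (Suc m) powr (- r) \<le> z powr (- r)"
      using z r by (intro powr_mono2') auto
    then show ?thesis using z r by simp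
  qed (use r in auto)
  have "(\<Sum>d=1..Suc m. real d powr (- r)) \<le> real m powr (1 - r) / (1 - r) + real (Suc m) powr (- r)"
    using Suc by simp
  also have "\<dots> \<le> real (Suc m) powr (1 - r) / (1 - r)"
  proof -
    have "real (Suc m) powr (- r) \<le> (real (Suc m) powr (1 - r) - real m powr (1 - r)) / (1 - r)"
      using step r by (simp add: pos_le_divide_eq mult.commute)
    then show ?thesis by (simp add: diff_divide_distrib)
  qed
  finally show ?case .
qed simp

text \<open>Each new term of the block adds its square and one row of covariances, whose sum is at
  most \<open>C * B\<^sup>2 * H m\<close>. One-sided bounds on the covariances suffice because the
  expanded square has no negative coefficients.\<close>

lemma (in prob_space) second_moment_sum_le:
  assumes [measurable]: "\<And>i. Y i \<in> borel_measurable M"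
    and sq: "\<And>i. integrable M (\<lambda>\<omega>. (Y i \<omega>)\<^sup>2)"
    and var: "\<And>i. expectation (\<lambda>\<omega>. (Y i \<omega>)\<^sup>2) \<le> B\<^sup>2"
    and cov: "\<And>i j. i < j \<Longrightarrow> expectation (\<lambda>\<omega>. Y i \<omega> * Y j \<omega>) \<le> C * B\<^sup>2 * real (j - i) powr (- r)"
    and r: "0 < r" "r < 1" and C: "0 \<le> C"
  shows "integrable M (\<lambda>\<omega>. (\<Sum>i<m. Y (a + i) \<omega>)\<^sup>2)" (is "?int m")
    and "expectation (\<lambda>\<omega>. (\<Sum>i<m. Y (a + i) \<omega>)\<^sup>2) \<le> (1 + 2 * C / (1 - r)) * B\<^sup>2 * real m powr (2 - r)"
proof -
  have prod: "integrable M (\<lambda>\<omega>. Y i \<omega> * Y j \<omega>)" for i j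
  proof (rule Bochner_Integration.integrable_bound)
    show "integrable M (\<lambda>\<omega>. (Y i \<omega>)\<^sup>2 + (Y j \<omega>)\<^sup>2)" using sq by auto
    show "AE \<omega> in M. norm (Y i \<omega> * Y j \<omega>) \<le> norm ((Y i \<omega>)\<^sup>2 + (Y j \<omega>)\<^sup>2)"
    proof (rule AE_I2)
      fix \<omega>
      have "2 * (\<bar>Y i \<omega>\<bar> * \<bar>Y j \<omega>\<bar>) \<le> (Y i \<omega>)\<^sup>2 + (Y j \<omega>)\<^sup>2"
        using sum_squares_bound[of "\<bar>Y i \<omega>\<bar>" "\<bar>Y j \<omega>\<bar>"] by simp
      moreover have "0 \<le> \<bar>Y i \<omega>\<bar> * \<bar>Y j \<omega>\<bar>" by auto
      ultimately have "\<bar>Y i \<omega>\<bar> * \<bar>Y j \<omega>\<bar> \<le> (Y i \<omega>)\<^sup>2 + (Y j \<omega>)\<^sup>2" by linarith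
      then show "norm (Y i \<omega> * Y j \<omega>) \<le> norm ((Y i \<omega>)\<^sup>2 + (Y j \<omega>)\<^sup>2)"
        by (simp add: abs_mult)
    qed
  qed simp
  have ex: "(\<Sum>i<Suc m. Y (a + i) \<omega>)\<^sup>2 =
     (\<Sum>i<m. Y (a + i) \<omega>)\<^sup>2 + 2 * (\<Sum>i<m. Y (a + i) \<omega> * Y (a + m) \<omega>) + (Y (a + m) \<omega>)\<^sup>2" for m \<omega>
    by (simp add: power2_eq_square algebra_simps sum_distrib_left)
  define H where "H m = (\<Sum>d=1..m. real d powr (- r))" for m
  have H: "H m \<le> H (Suc m)" "0 \<le> H m" for m
    unfolding H_def by (auto intro!: sum_nonneg)
  have *: "?int m \<and> expectation (\<lambda>\<omega>. (\<Sum>i<m. Y (a + i) \<omega>)\<^sup>2) \<le> real m * B\<^sup>2 * (1 + 2 * C * H m)" for m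
  proof (induction m)
    case (Suc m)
    have int: "?int (Suc m)" unfolding ex using Suc sq prod by auto
    have "expectation (\<lambda>\<omega>. (\<Sum>i<Suc m. Y (a + i) \<omega>)\<^sup>2) =
        expectation (\<lambda>\<omega>. (\<Sum>i<m. Y (a + i) \<omega>)\<^sup>2) +
        2 * (\<Sum>i<m. expectation (\<lambda>\<omega>. Y (a + i) \<omega> * Y (a + m) \<omega>)) + expectation (\<lambda>\<omega>. (Y (a + m) \<omega>)\<^sup>2)"
      unfolding ex using Suc sq prod by simp
    also have "(\<Sum>i<m. expectation (\<lambda>\<omega>. Y (a + i) \<omega> * Y (a + m) \<omega>)) \<le> (\<Sum>i<m. C * B\<^sup>2 * real (m - i) powr (- r))"
      by (rule sum_mono) (use cov[of "a + _" "a + m"] in auto)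
    also have "(\<Sum>i<m. C * B\<^sup>2 * real (m - i) powr (- r)) = C * B\<^sup>2 * H m"
      unfolding sum_distrib_left[symmetric] H_def
      by (intro arg_cong[where f="\<lambda>x. C * B\<^sup>2 * x"] sum.reindex_bij_witness[of _ "\<lambda>d. m - d" "\<lambda>i. m - i"]) auto
    finally have "expectation (\<lambda>\<omega>. (\<Sum>i<Suc m. Y (a + i) \<omega>)\<^sup>2)
        \<le> real m * B\<^sup>2 * (1 + 2 * C * H m) + 2 * (C * B\<^sup>2 * H m) + B\<^sup>2"
      using Suc var[of "a + m"] by simp
    also have "\<dots> = real (Suc m) * B\<^sup>2 * (1 + 2 * C * H m)" by (simp add: algebra_simps)
    also have "\<dots> \<le> real (Suc m) * B\<^sup>2 * (1 + 2 * C * H (Suc m))"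
      using H C by (intro mult_left_mono add_left_mono) auto
    finally show ?case using int by blast
  qed simp
  show "?int m" using * by blast
  have Hm: "H m \<le> real m powr (1 - r) / (1 - r)" unfolding H_def by (rule sum_powr_neg_le[OF r])
  show "expectation (\<lambda>\<omega>. (\<Sum>i<m. Y (a + i) \<omega>)\<^sup>2) \<le> (1 + 2 * C / (1 - r)) * B\<^sup>2 * real m powr (2 - r)"
  proof (cases "m = 0")
    case False
    have m1: "1 \<le> real m powr (1 - r)" using False r by (intro ge_one_powr_ge_zero) auto
    have "1 + 2 * C * H m \<le> real m powr (1 - r) + 2 * C * (real m powr (1 - r) / (1 - r))"
      using m1 Hm C by (intro add_mono mult_left_mono) auto
    also have "\<dots> = (1 + 2 * C / (1 - r)) * real m powr (1 - r)" by (simp add: algebra_simps)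
    finally have "real m * B\<^sup>2 * (1 + 2 * C * H m) \<le> real m * B\<^sup>2 * ((1 + 2 * C / (1 - r)) * real m powr (1 - r))"
      by (intro mult_left_mono) auto
    also have "\<dots> = (1 + 2 * C / (1 - r)) * B\<^sup>2 * (real m powr 1 * real m powr (1 - r))"
      using False by simp
    also have "real m powr 1 * real m powr (1 - r) = real m powr (2 - r)"
      unfolding powr_add[symmetric] by simp
    finally show ?thesis using *[of m] by linarith
  qed simp
qed

lemma sum_geometric_le:
  fixes x :: real
  assumes "1 < x"
  shows "(\<Sum>l\<le>p. x ^ l) \<le> x / (x - 1) * x ^ p"
proof -
  have "(\<Sum>l\<le>p. x ^ l) = (x ^ Suc p - 1) / (x - 1)"
    using geometric_sum[of x "Suc p"] assms by (simp add: lessThan_Suc_atMost)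
  also have "\<dots> \<le> x ^ Suc p / (x - 1)" using assms by (intro divide_right_mono) auto
  finally show ?thesis by simp
qed

text \<open>The first factor is the square root of the constant in
  \<open>second_moment_sum_le\<close>, the second comes from a geometric sum with ratio
  \<open>2 powr ((1 - r) / 2)\<close> and blows up as \<open>r\<close> approaches 1.\<close>

definition max_const :: "real \<Rightarrow> real \<Rightarrow> real" where
  "max_const C r = sqrt (1 + 2 * C / (1 - r)) * (2 powr ((1 - r) / 2) / (2 powr ((1 - r) / 2) - 1))"

lemma max_const_nonneg: "0 \<le> C \<Longrightarrow> r < 1 \<Longrightarrow> 0 \<le> max_const C r"
  unfolding max_const_def by (auto intro!: mult_nonneg_nonneg divide_nonneg_nonneg ge_one_powr_ge_zero)

text \<open>With second moments of order \<open>m powr (2 - r)\<close>, chaining level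
  \<open>l\<close> contributes \<open>2 powr (p / 2)\<close> times
  \<open>2 powr (l * (1 - r) / 2)\<close>. The top level dominates, so the maximum is of the same
  order as the bound for a single sum of full length.\<close>

lemma (in prob_space) maximal_inequality:
  assumes meas: "\<And>i. Y i \<in> borel_measurable M"
    and sq: "\<And>i. integrable M (\<lambda>\<omega>. (Y i \<omega>)\<^sup>2)"
    and var: "\<And>i. expectation (\<lambda>\<omega>. (Y i \<omega>)\<^sup>2) \<le> B\<^sup>2"
    and cov: "\<And>i j. i < j \<Longrightarrow> expectation (\<lambda>\<omega>. Y i \<omega> * Y j \<omega>) \<le> C * B\<^sup>2 * real (j - i) powr (- r)"
    and r: "0 < r" "r < 1" and C: "0 \<le> C" and B: "0 \<le> B"
  shows "(\<integral>\<^sup>+\<omega>. max_partial p Y \<omega> \<partial>M) \<le> ennreal (max_const C r * B * 2 powr (real p * (1 - r / 2)))"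
proof -
  define c where "c = 1 + 2 * C / (1 - r)"
  define x where "x = 2 powr ((1 - r) / 2)"
  have c: "0 \<le> c" using C r by (auto simp: c_def)
  have x: "1 < x" using r by (simp add: x_def)
  note sm = second_moment_sum_le[OF meas sq var cov r C, folded c_def]
  have "(\<integral>\<^sup>+\<omega>. max_partial p Y \<omega> \<partial>M)
      \<le> ennreal (\<Sum>l\<le>p. sqrt (2^(p - l) * (c * B\<^sup>2 * real (2^l) powr (2 - r))))"
    by (rule nn_integral_max_partial_le) (use meas sq sm in auto)
  also have "(\<Sum>l\<le>p. sqrt (2^(p - l) * (c * B\<^sup>2 * real (2^l) powr (2 - r))))
      = (\<Sum>l\<le>p. sqrt c * B * 2 powr (real p / 2) * x ^ l)"
  proof (rule sum.cong[OF refl])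
    fix l assume "l \<in> {..p}"
    then have "(2::real)^(p - l) * real (2^l) powr (2 - r) = 2 powr (real p - real l) * 2 powr (real l * (2 - r))"
      by (simp add: powr_realpow[symmetric] of_nat_diff powr_powr)
    also have "\<dots> = (2 powr (real p / 2) * x ^ l)\<^sup>2"
      by (simp add: x_def powr_realpow[symmetric] powr_powr powr_add[symmetric] power2_eq_square)
        (simp add: field_simps)
    finally have "2^(p - l) * (c * B\<^sup>2 * real (2^l) powr (2 - r)) = c * (B * (2 powr (real p / 2) * x ^ l))\<^sup>2"
      by (simp add: mult_ac power_mult_distrib)
    then show "sqrt (2^(p - l) * (c * B\<^sup>2 * real (2^l) powr (2 - r))) = sqrt c * B * 2 powr (real p / 2) * x ^ l"
      using B x by (simp only:) (simp add: real_sqrt_mult)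
  qed
  also have "\<dots> \<le> sqrt c * B * 2 powr (real p / 2) * (x / (x - 1) * x ^ p)"
    unfolding sum_distrib_left[symmetric] using c B x by (intro mult_left_mono sum_geometric_le) auto
  also have "\<dots> = max_const C r * B * (2 powr (real p / 2) * x ^ p)"
    by (simp add: max_const_def c_def x_def)
  also have "2 powr (real p / 2) * x ^ p = 2 powr (real p * (1 - r / 2))"
    by (simp add: x_def powr_realpow[symmetric] powr_powr powr_add[symmetric] field_simps)
  finally show ?thesis by (simp add: ennreal_leI)
qed

section \<open>Real estimates\<close>

lemma powr_mvt_lower:
  fixes \<gamma> t \<tau> :: real
  assumes \<gamma>: "0 \<le> \<gamma>" "\<gamma> < 1" and t: "0 < t" "t \<le> \<tau>" "\<tau> \<le> 1"
  shows "(1 - \<gamma>) * (\<tau> - t) \<le> \<tau> powr (1 - \<gamma>) - t powr (1 - \<gamma>)"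
proof (cases "t = \<tau>")
  case False
  then have "t < \<tau>" using t by simp
  then have "\<exists>z>t. z < \<tau> \<and> \<tau> powr (1 - \<gamma>) - t powr (1 - \<gamma>) = (\<tau> - t) * ((1 - \<gamma>) * z powr (- \<gamma>))"
  proof (rule MVT2)
    fix x assume "t \<le> x"
    then show "((\<lambda>x. x powr (1 - \<gamma>)) has_real_derivative (1 - \<gamma>) * x powr (- \<gamma>)) (at x)"
      using has_real_derivative_powr[of x "1 - \<gamma>"] t by simp
  qed
  then obtain z where z: "t < z" "z < \<tau>"
    "\<tau> powr (1 - \<gamma>) - t powr (1 - \<gamma>) = (\<tau> - t) * ((1 - \<gamma>) * z powr (- \<gamma>))" by auto
  have "1 \<le> z powr (- \<gamma>)"
    using powr_mono2'[of "-\<gamma>" z 1] z t \<gamma> by simp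
  then have "(\<tau> - t) * ((1 - \<gamma>) * 1) \<le> (\<tau> - t) * ((1 - \<gamma>) * z powr (- \<gamma>))"
    using t \<gamma> by (intro mult_left_mono) auto
  then show ?thesis using z by (simp add: mult.commute)
qed simp

text \<open>The coefficient of \<open>P - Q\<close> in \<open>D_k\<close> without noise, for
  \<open>t = k / n\<close> and change point \<open>\<tau>\<close>. Left of \<open>\<tau>\<close> the
  second average is contaminated by \<open>P\<close>, which leaves the fraction
  \<open>(1 - \<tau>) / (1 - t)\<close> of the difference; right of it the first average is
  contaminated by \<open>Q\<close>, which leaves \<open>\<tau> / t\<close>.\<close>

definition cusum_drift :: "real \<Rightarrow> real \<Rightarrow> real \<Rightarrow> real" where
  "cusum_drift \<gamma> \<tau> t = (t * (1 - t)) powr (1 - \<gamma>) * (if t \<le> \<tau> then (1 - \<tau>) / (1 - t) else \<tau> / t)"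

lemma cusum_drift_flip:
  assumes "0 < t" "t < 1"
  shows "cusum_drift \<gamma> (1 - \<tau>) (1 - t) = cusum_drift \<gamma> \<tau> t"
  using assms by (auto simp: cusum_drift_def mult.commute)

text \<open>Left of \<open>\<tau>\<close> the drift is \<open>1 - \<tau>\<close> times
  \<open>t powr (1 - \<gamma>)\<close> times \<open>(1 - t) powr (- \<gamma>)\<close>. The last
  factor is at least 1 and nondecreasing, and the middle one has slope at least
  \<open>1 - \<gamma>\<close> on the unit interval. So the peak is a kink, not a quadratic
  maximum.\<close>

lemma cusum_drift_gap_left:
  assumes \<gamma>: "0 \<le> \<gamma>" "\<gamma> < 1" and t: "0 < t" "t \<le> \<tau>" "\<tau> < 1"
  shows "(1 - \<gamma>) * (1 - \<tau>) * (\<tau> - t) \<le> cusum_drift \<gamma> \<tau> \<tau> - cusum_drift \<gamma> \<tau> t"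
proof -
  have form: "cusum_drift \<gamma> \<tau> s = (1 - \<tau>) * (s powr (1 - \<gamma>) * (1 - s) powr (- \<gamma>))"
    if "0 < s" "s \<le> \<tau>" for s
  proof -
    have "(1 - s) powr (1 - \<gamma>) = (1 - s) powr 1 * (1 - s) powr (- \<gamma>)"
      unfolding powr_add[symmetric] by simp
    then show ?thesis using that t by (simp add: cusum_drift_def powr_mult)
  qed
  have mono: "(1 - t) powr (- \<gamma>) \<le> (1 - \<tau>) powr (- \<gamma>)" using t \<gamma> by (intro powr_mono2') auto
  have one: "1 \<le> (1 - t) powr (- \<gamma>)" using powr_mono2'[of "-\<gamma>" "1-t" 1] t \<gamma> by simp
  have p: "(1 - \<gamma>) * (\<tau> - t) \<le> \<tau> powr (1 - \<gamma>) - t powr (1 - \<gamma>)"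
    using powr_mvt_lower[OF \<gamma>, of t \<tau>] t by auto
  have p0: "0 \<le> (1 - \<gamma>) * (\<tau> - t)" using t \<gamma> by auto
  have "(1 - \<gamma>) * (\<tau> - t) \<le> (\<tau> powr (1 - \<gamma>) - t powr (1 - \<gamma>)) * (1 - t) powr (- \<gamma>)"
    using mult_mono[OF p one] p p0 by simp
  also have "\<dots> \<le> \<tau> powr (1 - \<gamma>) * (1 - \<tau>) powr (- \<gamma>) - t powr (1 - \<gamma>) * (1 - t) powr (- \<gamma>)"
    using mult_left_mono[OF mono, of "\<tau> powr (1 - \<gamma>)"] by (simp add: left_diff_distrib)
  finally have "(1 - \<tau>) * ((1 - \<gamma>) * (\<tau> - t)) \<le>
    (1 - \<tau>) * (\<tau> powr (1 - \<gamma>) * (1 - \<tau>) powr (- \<gamma>) - t powr (1 - \<gamma>) * (1 - t) powr (- \<gamma>))"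
    using t by (intro mult_left_mono) auto
  then show ?thesis using form[of t] form[of \<tau>] t by (simp add: algebra_simps)
qed

lemma cusum_drift_gap:
  assumes \<gamma>: "0 \<le> \<gamma>" "\<gamma> < 1" and t: "0 < t" "t < 1" "0 < \<tau>" "\<tau> < 1"
  shows "(1 - \<gamma>) * min \<tau> (1 - \<tau>) * \<bar>t - \<tau>\<bar> \<le> cusum_drift \<gamma> \<tau> \<tau> - cusum_drift \<gamma> \<tau> t"
proof (cases "t \<le> \<tau>")
  case True
  have "(1 - \<gamma>) * min \<tau> (1 - \<tau>) * \<bar>t - \<tau>\<bar> \<le> (1 - \<gamma>) * (1 - \<tau>) * (\<tau> - t)"
    using True assms by (intro mult_mono) auto
  also have "\<dots> \<le> cusum_drift \<gamma> \<tau> \<tau> - cusum_drift \<gamma> \<tau> t"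
    by (rule cusum_drift_gap_left) (use assms True in auto)
  finally show ?thesis .
next
  case False
  \<comment> \<open>Reversing time exchanges \<open>t\<close> with \<open>1 - t\<close> and
    \<open>\<tau>\<close> with \<open>1 - \<tau>\<close>, which reduces this side to the left
    one.\<close>
  have "(1 - \<gamma>) * min \<tau> (1 - \<tau>) * \<bar>t - \<tau>\<bar> \<le> (1 - \<gamma>) * (1 - (1 - \<tau>)) * ((1 - \<tau>) - (1 - t))"
    using False \<gamma> t by (intro mult_mono) auto
  also have "\<dots> \<le> cusum_drift \<gamma> (1 - \<tau>) (1 - \<tau>) - cusum_drift \<gamma> (1 - \<tau>) (1 - t)"
    by (rule cusum_drift_gap_left) (use assms False in auto)
  finally show ?thesis using cusum_drift_flip[of t] cusum_drift_flip[of \<tau>] t by simp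
qed

lemma cusum_drift_pos: "0 < t \<Longrightarrow> t < 1 \<Longrightarrow> 0 < \<tau> \<Longrightarrow> \<tau> < 1 \<Longrightarrow> 0 < cusum_drift \<gamma> \<tau> t"
  unfolding cusum_drift_def by auto

lemma cusum_drift_peak:
  assumes "0 < \<tau>" "\<tau> < 1" "0 \<le> \<gamma>" "\<gamma> < 1"
  shows "\<tau> * (1 - \<tau>) \<le> cusum_drift \<gamma> \<tau> \<tau>" "cusum_drift \<gamma> \<tau> \<tau> \<le> 1"
proof -
  have u: "0 < \<tau> * (1 - \<tau>)" "\<tau> * (1 - \<tau>) \<le> 1" using assms mult_mono[of \<tau> 1 "1 - \<tau>" 1] by auto
  have e: "cusum_drift \<gamma> \<tau> \<tau> = (\<tau> * (1 - \<tau>)) powr (1 - \<gamma>)" using assms by (simp add: cusum_drift_def)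
  show "\<tau> * (1 - \<tau>) \<le> cusum_drift \<gamma> \<tau> \<tau>"
    unfolding e using powr_mono'[of "1 - \<gamma>" 1 "\<tau> * (1 - \<tau>)"] u assms by simp
  show "cusum_drift \<gamma> \<tau> \<tau> \<le> 1"
    unfolding e using powr_mono2[of "1 - \<gamma>" "\<tau> * (1 - \<tau>)" 1] u assms by simp
qed

section \<open>Weights away from the end points\<close>

lemma powr_neg_le_inverse:
  fixes u u0 \<gamma> :: real
  assumes "0 < u0" "u0 \<le> 1" "u0 \<le> u" "0 \<le> \<gamma>" "\<gamma> \<le> 1"
  shows "u powr (- \<gamma>) \<le> 1 / u0"
proof -
  have "u powr (- \<gamma>) \<le> u0 powr (- \<gamma>)" using assms by (intro powr_mono2') auto
  also have "\<dots> \<le> u0 powr (- 1)" using assms by (intro powr_mono') auto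
  also have "\<dots> = 1 / u0" using assms by (simp add: powr_minus_divide)
  finally show ?thesis .
qed

text \<open>Since \<open>u0 \<le> 1\<close>, the bound \<open>u0 powr (- \<gamma> - 1)\<close> for
  the derivative can be coarsened to \<open>u0 powr (- 2)\<close>, which frees the constant from
  \<open>\<gamma>\<close>.\<close>

lemma powr_neg_lipschitz_le:
  fixes u v u0 \<gamma> :: real
  assumes u0: "0 < u0" "u0 \<le> 1" "u0 \<le> u" "u \<le> v" and \<gamma>: "0 \<le> \<gamma>" "\<gamma> \<le> 1"
  shows "\<bar>v powr (- \<gamma>) - u powr (- \<gamma>)\<bar> \<le> (v - u) / u0\<^sup>2"
proof (cases "u = v")
  case False
  then have "u < v" using u0 by simp
  then have "\<exists>z>u. z < v \<and> v powr (- \<gamma>) - u powr (- \<gamma>) = (v - u) * ((- \<gamma>) * z powr (- \<gamma> - 1))"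
  proof (rule MVT2)
    fix x assume "u \<le> x"
    then show "((\<lambda>x. x powr (- \<gamma>)) has_real_derivative (- \<gamma>) * x powr (- \<gamma> - 1)) (at x)"
      using has_real_derivative_powr[of x "- \<gamma>"] u0 by simp
  qed
  then obtain z where z: "u < z" "z < v"
    "v powr (- \<gamma>) - u powr (- \<gamma>) = (v - u) * ((- \<gamma>) * z powr (- \<gamma> - 1))" by auto
  have "z powr (- \<gamma> - 1) \<le> u0 powr (- \<gamma> - 1)" using z u0 \<gamma> by (intro powr_mono2') auto
  also have "\<dots> \<le> u0 powr (- 2)" using u0 \<gamma> by (intro powr_mono') auto
  also have "\<dots> = 1 / u0\<^sup>2" using u0 by (simp add: powr_minus_divide)
  finally have "\<gamma> * z powr (- \<gamma> - 1) \<le> 1 * (1 / u0\<^sup>2)" using \<gamma> by (intro mult_mono) auto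
  then have "(v - u) * (\<gamma> * z powr (- \<gamma> - 1)) \<le> (v - u) * (1 / u0\<^sup>2)"
    using u0 by (intro mult_left_mono) auto
  moreover have "0 \<le> (v - u) * (\<gamma> * z powr (- \<gamma> - 1))" using u0 \<gamma> by auto
  ultimately show ?thesis using z(3) by (simp add: abs_mult)
qed simp

lemma powr_neg_lipschitz:
  fixes u v u0 \<gamma> :: real
  assumes "0 < u0" "u0 \<le> 1" "u0 \<le> u" "u0 \<le> v" and \<gamma>: "0 \<le> \<gamma>" "\<gamma> \<le> 1"
  shows "\<bar>v powr (- \<gamma>) - u powr (- \<gamma>)\<bar> \<le> \<bar>v - u\<bar> / u0\<^sup>2"
  using powr_neg_lipschitz_le[of u0 u v \<gamma>] powr_neg_lipschitz_le[of u0 v u \<gamma>] assms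
  by (cases "u \<le> v") (auto simp: abs_minus_commute)

section \<open>Dyadic sums\<close>

lemma two_power_le_imp_le_ln: "2 ^ J \<le> n \<Longrightarrow> real J \<le> 2 * ln (real n)" for J n :: nat
proof -
  assume J: "2 ^ J \<le> n"
  have "real J * (1 / 2) \<le> real J * ln 2" using ln2_ge_two_thirds by (intro mult_left_mono) linarith+
  also have "\<dots> = ln (real (2 ^ J))" by (simp add: ln_realpow)
  also have "\<dots> \<le> ln (real n)" using J by (subst ln_le_cancel_iff) (auto simp: of_nat_le_iff simp del: of_nat_power intro: less_le_trans[of 0 "2^J"])
  finally show ?thesis by simp
qed

text \<open>The sign of \<open>\<beta>\<close> decides. For \<open>\<beta> > 0\<close> the last term
  dominates; for \<open>\<beta> = 0\<close> the terms are counted, which gives the logarithm; for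
  \<open>\<beta> < 0\<close> the sum is bounded, which the summand 1 covers. With
  \<open>\<beta> = 1 - r / 2 - \<gamma>\<close> this produces the shape of the rate hypothesis,
  including its indicator.\<close>

lemma sum_dyadic_powr_le:
  fixes \<beta> :: real
  obtains K where "0 < K" "\<And>J n. 2 ^ J \<le> n \<Longrightarrow>
    (\<Sum>j\<le>J. 2 powr (real j * \<beta>)) \<le> K * (real n powr \<beta> * (1 + ln (real n) * (if \<beta> = 0 then 1 else 0)) + 1)"
proof -
  have pw: "2 powr (real j * \<beta>) = (2 powr \<beta>) ^ j" for j :: nat
    by (simp add: powr_realpow[symmetric] powr_powr mult.commute)
  have n0: "0 < n" if "2 ^ J \<le> n" for J n :: nat using that by (metis not_gr0 le_zero_eq power_not_zero zero_neq_numeral)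
  consider "\<beta> = 0" | "\<beta> > 0" | "\<beta> < 0" by linarith
  then show ?thesis
  proof cases
    case 1
    show ?thesis
    proof (rule that[of 2])
      fix J n :: nat assume J: "2 ^ J \<le> n"
      have "(\<Sum>j\<le>J. 2 powr (real j * \<beta>)) = real J + 1" using 1 by simp
      also have "\<dots> \<le> 2 * ln (real n) + 1" using two_power_le_imp_le_ln[OF J] by simp
      finally show "(\<Sum>j\<le>J. 2 powr (real j * \<beta>)) \<le> 2 * (real n powr \<beta> * (1 + ln (real n) * (if \<beta> = 0 then 1 else 0)) + 1)"
        using 1 n0[OF J] by simp
    qed simp
  next
    case 2
    define x where "x = 2 powr \<beta>"
    have x: "1 < x" using 2 by (simp add: x_def)
    show ?thesis
    proof (rule that[of "x / (x - 1)"])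
      fix J n :: nat assume J: "2 ^ J \<le> n"
      have "(\<Sum>j\<le>J. 2 powr (real j * \<beta>)) = (x ^ Suc J - 1) / (x - 1)"
        unfolding pw x_def[symmetric] using geometric_sum[of x "Suc J"] x by (simp add: lessThan_Suc_atMost)
      also have "\<dots> \<le> x / (x - 1) * x ^ J" using x by (simp add: divide_right_mono)
      also have "x ^ J = (2 ^ J) powr \<beta>"
        unfolding x_def by (simp add: powr_realpow[symmetric] powr_powr mult.commute)
      also have "x / (x - 1) * (2 ^ J) powr \<beta> \<le> x / (x - 1) * real n powr \<beta>"
        using J x 2 of_nat_mono[OF J, where 'a=real] by (intro mult_left_mono powr_mono2) auto
      also have "\<dots> \<le> x / (x - 1) * (real n powr \<beta> + 1)" using x by (intro mult_left_mono) auto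
      finally show "(\<Sum>j\<le>J. 2 powr (real j * \<beta>)) \<le> x / (x - 1) * (real n powr \<beta> * (1 + ln (real n) * (if \<beta> = 0 then 1 else 0)) + 1)"
        using 2 by simp
    qed (use x in auto)
  next
    case 3
    define x where "x = 2 powr \<beta>"
    have x: "0 < x" "x < 1" using 3 powr_less_mono[of \<beta> 0 "2::real"] by (auto simp: x_def)
    show ?thesis
    proof (rule that[of "1 / (1 - x)"])
      fix J n :: nat assume J: "2 ^ J \<le> n"
      have "(\<Sum>j\<le>J. 2 powr (real j * \<beta>)) = (1 - x ^ Suc J) / (1 - x)"
        unfolding pw x_def[symmetric] using sum_gp0[of x J] x by simp
      also have "\<dots> \<le> 1 / (1 - x) * 1" using x by (simp add: divide_right_mono)
      also have "\<dots> \<le> 1 / (1 - x) * (real n powr \<beta> + 1)" using x by (intro mult_left_mono) auto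
      finally show "(\<Sum>j\<le>J. 2 powr (real j * \<beta>)) \<le> 1 / (1 - x) * (real n powr \<beta> * (1 + ln (real n) * (if \<beta> = 0 then 1 else 0)) + 1)"
        using 3 by simp
    qed (use x in auto)
  qed
qed

lemma sum_dyadic_tail_le:
  fixes s :: real
  assumes s: "0 < s"
  shows "(\<Sum>j\<in>{p..J}. 2 powr (- real j * s)) \<le> 2 powr (- real p * s) / (1 - 2 powr (- s))"
proof -
  define x where "x = 2 powr (- s)"
  have x: "0 < x" "x < 1" using s by (auto simp: x_def powr_minus field_simps)
  have pw: "2 powr (- real j * s) = x ^ j" for j :: nat
    by (simp add: x_def powr_realpow[symmetric] powr_powr mult.commute)
  have "(\<Sum>j\<in>{p..J}. x ^ j) \<le> x ^ p / (1 - x)"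
  proof (cases "p \<le> J")
    case True
    then have "(\<Sum>j\<in>{p..J}. x ^ j) = (x ^ p - x ^ Suc J) / (1 - x)"
      using sum_gp[of x p J] x by auto
    also have "\<dots> \<le> x ^ p / (1 - x)" using x by (intro divide_right_mono) auto
    finally show ?thesis .
  qed (use x in auto)
  then show ?thesis unfolding pw x_def[symmetric] .
qed

section \<open>A single sample\<close>

lemma borel_measurable_nn_integral_count_space:
  fixes f :: "'i \<Rightarrow> 'a \<Rightarrow> ennreal"
  assumes "countable I" and [measurable]: "\<And>i. i \<in> I \<Longrightarrow> f i \<in> borel_measurable M"
  shows "(\<lambda>x. \<integral>\<^sup>+i. f i x \<partial>count_space I) \<in> borel_measurable M"
proof (cases "finite I")
  case True
  then show ?thesis by (simp add: nn_integral_count_space_finite)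
next
  case False
  note * = bij_betw_from_nat_into[OF \<open>countable I\<close> False]
  have "from_nat_into I m \<in> I" for m using False by (intro from_nat_into) auto
  then show ?thesis
    by (simp add: nn_integral_bij_count_space[symmetric, OF *] nn_integral_count_space_nat)
qed

text \<open>A single sample size, so that every bound is explicit in \<open>n\<close> and the
  remaining parameters and can be made uniform afterwards. \<open>B f\<close> is a real number
  standing for the norm of \<open>f\<close>, and \<open>ks\<close> is the last index with law
  \<open>P\<close>. The seminorm is passed lemma by lemma, because it may vary with the
  outcome.\<close>

locale change_point_sample = prob_space M for M :: "'w measure" +
  fixes E :: "'e measure" and Z :: "nat \<Rightarrow> 'w \<Rightarrow> 'e" and P Q :: "'e measure"
    and \<F> :: "('e \<Rightarrow> real) set" and B d :: "('e \<Rightarrow> real) \<Rightarrow> real"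
    and C r \<gamma> D :: real and n ks :: nat
  assumes ks: "1 \<le> ks" "ks < n"
    and Z_meas: "\<And>i. i \<in> {1..n} \<Longrightarrow> Z i \<in> measurable M E"
    and P: "prob_space P" "sets P = sets E" and Q: "prob_space Q" "sets Q = sets E"
    and law_P: "\<And>i. i \<in> {1..ks} \<Longrightarrow> distr M E (Z i) = P"
    and law_Q: "\<And>i. i \<in> {ks<..n} \<Longrightarrow> distr M E (Z i) = Q"
    and F_count: "countable \<F>" and F_meas: "\<F> \<subseteq> borel_measurable E"
    and d_nonneg: "\<And>f. f \<in> \<F> \<Longrightarrow> 0 \<le> d f"
    and B_nonneg: "\<And>f. f \<in> \<F> \<Longrightarrow> 0 \<le> B f"
    and B_P: "\<And>f. f \<in> \<F> \<Longrightarrow> (\<integral>\<^sup>+x. ennreal ((f x)\<^sup>2) \<partial>P) \<le> ennreal ((B f)\<^sup>2)"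
    and B_Q: "\<And>f. f \<in> \<F> \<Longrightarrow> (\<integral>\<^sup>+x. ennreal ((f x)\<^sup>2) \<partial>Q) \<le> ennreal ((B f)\<^sup>2)"
    and corr_decay: "\<And>i j f. 1 \<le> i \<Longrightarrow> i < j \<Longrightarrow> j \<le> n \<Longrightarrow> f \<in> \<F> \<Longrightarrow>
      \<bar>corr M (\<lambda>\<omega>. f (Z i \<omega>)) (\<lambda>\<omega>. f (Z j \<omega>))\<bar> \<le> C * real (j - i) powr (- r)"
    and r: "0 < r" "r < 1" and C_nonneg: "0 \<le> C" and gamma: "0 \<le> \<gamma>" "\<gamma> < 1"
    and D_nonneg: "0 \<le> D"
    and D: "(\<integral>\<^sup>+f. ennreal (d f) * ennreal (B f) \<partial>count_space \<F>) \<le> ennreal D"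
begin

lemma F_measurable: "f \<in> \<F> \<Longrightarrow> f \<in> borel_measurable E"
  using F_meas by auto

lemma fZ_measurable: "f \<in> \<F> \<Longrightarrow> i \<in> {1..n} \<Longrightarrow> (\<lambda>\<omega>. f (Z i \<omega>)) \<in> borel_measurable M"
  using measurable_compose[OF Z_meas F_measurable] by auto

lemma law: "i \<in> {1..n} \<Longrightarrow> distr M E (Z i) = (if i \<le> ks then P else Q)"
  using law_P law_Q by auto

lemma fZ_square:
  assumes f: "f \<in> \<F>" and i: "i \<in> {1..n}"
  shows "integrable M (\<lambda>\<omega>. (f (Z i \<omega>))\<^sup>2)"
    and "expectation (\<lambda>\<omega>. (f (Z i \<omega>))\<^sup>2) \<le> (B f)\<^sup>2"
    and "integrable M (\<lambda>\<omega>. f (Z i \<omega>))"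
proof -
  note [measurable] = F_measurable[OF f] Z_meas[OF i] fZ_measurable[OF f i]
  have "(\<integral>\<^sup>+\<omega>. ennreal ((f (Z i \<omega>))\<^sup>2) \<partial>M) = (\<integral>\<^sup>+x. ennreal ((f x)\<^sup>2) \<partial>distr M E (Z i))"
    by (subst nn_integral_distr) auto
  also have "\<dots> \<le> ennreal ((B f)\<^sup>2)" using B_P[OF f] B_Q[OF f] law[OF i] by auto
  finally have le: "(\<integral>\<^sup>+\<omega>. ennreal ((f (Z i \<omega>))\<^sup>2) \<partial>M) \<le> ennreal ((B f)\<^sup>2)" .
  then show int: "integrable M (\<lambda>\<omega>. (f (Z i \<omega>))\<^sup>2)"
    by (intro integrableI_bounded) (auto intro: le_less_trans)
  show "expectation (\<lambda>\<omega>. (f (Z i \<omega>))\<^sup>2) \<le> (B f)\<^sup>2"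
    using le by (subst (asm) nn_integral_eq_integral[OF int]) auto
  show "integrable M (\<lambda>\<omega>. f (Z i \<omega>))"
    by (rule square_integrable_imp_integrable) (use int in auto)
qed

section \<open>Centred observations and their covariances\<close>

definition mean :: "('e \<Rightarrow> real) \<Rightarrow> nat \<Rightarrow> real" where
  "mean f i = (if i \<le> ks then \<integral>x. f x \<partial>P else \<integral>x. f x \<partial>Q)"

lemma mean_eq: "f \<in> \<F> \<Longrightarrow> i \<in> {1..n} \<Longrightarrow> expectation (\<lambda>\<omega>. f (Z i \<omega>)) = mean f i"
  using integral_distr[OF Z_meas F_measurable, of i f] law[of i] by (auto simp: mean_def split: if_splits)

lemma integrable_PQ:
  assumes f: "f \<in> \<F>"
  shows "integrable P f" "integrable Q f"
proof -
  have "integrable (distr M E (Z i)) f" if "i \<in> {1..n}" for i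
    using fZ_square(3)[OF f that] by (subst integrable_distr_eq[OF Z_meas[OF that] F_measurable[OF f]])
  from this[of ks] this[of n] show "integrable P f" "integrable Q f"
    using law[of ks] law[of n] ks by auto
qed

text \<open>Extended by 0 beyond the sample, so that dyadic blocks may overrun it and the maximal
  inequality sees a full sequence.\<close>

definition noise :: "('e \<Rightarrow> real) \<Rightarrow> nat \<Rightarrow> 'w \<Rightarrow> real" where
  "noise f i \<omega> = (if i \<in> {1..n} then f (Z i \<omega>) - mean f i else 0)"

lemma noise_measurable: "f \<in> \<F> \<Longrightarrow> noise f i \<in> borel_measurable M"
  unfolding noise_def[abs_def] using fZ_measurable by (cases "i \<in> {1..n}") auto

lemma noise_square:
  assumes f: "f \<in> \<F>"
  shows "integrable M (\<lambda>\<omega>. (noise f i \<omega>)\<^sup>2)" "expectation (\<lambda>\<omega>. (noise f i \<omega>)\<^sup>2) \<le> (B f)\<^sup>2"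
proof -
  have "integrable M (\<lambda>\<omega>. (noise f i \<omega>)\<^sup>2) \<and> expectation (\<lambda>\<omega>. (noise f i \<omega>)\<^sup>2) \<le> (B f)\<^sup>2"
  proof (cases "i \<in> {1..n}")
    case True
    note fi = fZ_square[OF f True]
    have "integrable M (\<lambda>\<omega>. (f (Z i \<omega>) - mean f i)\<^sup>2)"
      unfolding power2_diff using fi by auto
    moreover have "expectation (\<lambda>\<omega>. (f (Z i \<omega>) - mean f i)\<^sup>2) \<le> (B f)\<^sup>2"
      using variance_eq[OF fi(3,1)] fi(2) zero_le_power2[of "mean f i"]
      unfolding mean_eq[OF f True] by linarith
    ultimately show ?thesis using True by (simp add: noise_def)
  qed (auto simp: noise_def)
  then show "integrable M (\<lambda>\<omega>. (noise f i \<omega>)\<^sup>2)" "expectation (\<lambda>\<omega>. (noise f i \<omega>)\<^sup>2) \<le> (B f)\<^sup>2" by auto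
qed

text \<open>The covariance is the correlation times two standard deviations, each at most
  \<open>B f\<close>. If a variance is zero, division by zero makes the correlation 0 and the decay
  hypothesis is void; but then one factor vanishes almost everywhere, and so does the
  covariance.\<close>

lemma noise_cov_le:
  assumes f: "f \<in> \<F>" and ij: "i < j"
  shows "expectation (\<lambda>\<omega>. noise f i \<omega> * noise f j \<omega>) \<le> C * (B f)\<^sup>2 * real (j - i) powr (- r)"
proof (cases "1 \<le> i \<and> j \<le> n")
  case True
  have i: "i \<in> {1..n}" and j: "j \<in> {1..n}" using True ij by auto
  define U where "U = (\<lambda>\<omega>. f (Z i \<omega>))"
  define V where "V = (\<lambda>\<omega>. f (Z j \<omega>))"
  have nz: "noise f i = (\<lambda>\<omega>. U \<omega> - expectation U)" "noise f j = (\<lambda>\<omega>. V \<omega> - expectation V)"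
    using i j mean_eq[OF f i] mean_eq[OF f j] by (auto simp: noise_def[abs_def] U_def V_def)
  have cv: "expectation (\<lambda>\<omega>. noise f i \<omega> * noise f j \<omega>) = cov M U V"
    "expectation (\<lambda>\<omega>. (noise f i \<omega>)\<^sup>2) = cov M U U" "expectation (\<lambda>\<omega>. (noise f j \<omega>)\<^sup>2) = cov M V V"
    by (simp_all add: nz cov_def power2_eq_square)
  have le: "cov M U U \<le> (B f)\<^sup>2" "cov M V V \<le> (B f)\<^sup>2"
    using noise_square(2)[OF f, of i] noise_square(2)[OF f, of j] cv by auto
  have ge: "0 \<le> cov M U U" "0 \<le> cov M V V"
    unfolding cv[symmetric] by (auto intro!: integral_nonneg_AE)
  have rhs: "0 \<le> C * (B f)\<^sup>2 * real (j - i) powr (- r)" using C_nonneg by auto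
  show ?thesis
  proof (cases "cov M U U * cov M V V = 0")
    case False
    define s where "s = sqrt (cov M U U * cov M V V)"
    have s: "0 < s" unfolding s_def using False ge by (simp add: less_le)
    have "cov M U U * cov M V V \<le> ((B f)\<^sup>2)\<^sup>2"
      unfolding power2_eq_square[of "(B f)\<^sup>2"] using le ge by (intro mult_mono) auto
    then have sB: "s \<le> (B f)\<^sup>2" unfolding s_def by (simp add: real_le_lsqrt)
    have "corr M U V \<le> C * real (j - i) powr (- r)"
      using corr_decay[OF _ ij _ f] True unfolding U_def V_def by fastforce
    then have "cov M U V \<le> C * real (j - i) powr (- r) * s"
      using s unfolding corr_def s_def[symmetric] by (simp add: pos_divide_le_eq)
    also have "\<dots> \<le> C * real (j - i) powr (- r) * (B f)\<^sup>2" using sB C_nonneg by (intro mult_left_mono) auto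
    finally show ?thesis unfolding cv by (simp add: mult_ac)
  next
    case True
    have z: "AE \<omega> in M. noise f k \<omega> = 0" if "expectation (\<lambda>\<omega>. (noise f k \<omega>)\<^sup>2) = 0" for k
      using that integral_nonneg_eq_0_iff_AE[OF noise_square(1)[OF f, of k]] by auto
    have "AE \<omega> in M. noise f i \<omega> * noise f j \<omega> = 0"
      using True z[of i] z[of j] unfolding cv by auto
    then have "expectation (\<lambda>\<omega>. noise f i \<omega> * noise f j \<omega>) = 0"
      by (rule integral_eq_zero_AE)
    then show ?thesis using rhs by simp
  qed
next
  case False
  then have "(\<lambda>\<omega>. noise f i \<omega> * noise f j \<omega>) = (\<lambda>_. 0)" using ij by (auto simp: noise_def)
  then show ?thesis using C_nonneg by simp
qed

text \<open>The right-hand side of the bound on \<open>N\<close>, kept in \<open>ennreal\<close>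
  because for a fixed outcome nothing guarantees that it is finite.\<close>

definition gsum :: "(('e \<Rightarrow> real) \<Rightarrow> real) \<Rightarrow> ennreal" where
  "gsum z = (\<integral>\<^sup>+f. ennreal (d f * \<bar>z f\<bar>) \<partial>count_space \<F>)"

lemma gsum_le2:
  assumes "\<And>f. f \<in> \<F> \<Longrightarrow> \<bar>z f\<bar> \<le> \<alpha> * \<bar>z1 f\<bar> + \<beta> * \<bar>z2 f\<bar>" "0 \<le> \<alpha>" "0 \<le> \<beta>"
  shows "gsum z \<le> ennreal \<alpha> * gsum z1 + ennreal \<beta> * gsum z2"
proof -
  have "gsum z \<le> (\<integral>\<^sup>+f. ennreal \<alpha> * ennreal (d f * \<bar>z1 f\<bar>) + ennreal \<beta> * ennreal (d f * \<bar>z2 f\<bar>) \<partial>count_space \<F>)"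
    unfolding gsum_def
  proof (rule nn_integral_mono)
    fix f assume "f \<in> space (count_space \<F>)"
    then have f: "f \<in> \<F>" by simp
    have "d f * \<bar>z f\<bar> \<le> d f * (\<alpha> * \<bar>z1 f\<bar> + \<beta> * \<bar>z2 f\<bar>)"
      using assms(1)[OF f] d_nonneg[OF f] by (rule mult_left_mono)
    also have "\<dots> = \<alpha> * (d f * \<bar>z1 f\<bar>) + \<beta> * (d f * \<bar>z2 f\<bar>)" by (simp add: algebra_simps)
    finally show "ennreal (d f * \<bar>z f\<bar>) \<le> ennreal \<alpha> * ennreal (d f * \<bar>z1 f\<bar>) + ennreal \<beta> * ennreal (d f * \<bar>z2 f\<bar>)"
      using assms d_nonneg[OF f]
      by (simp add: ennreal_mult[symmetric] ennreal_plus[symmetric] ennreal_leI del: ennreal_plus)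
  qed
  also have "\<dots> = ennreal \<alpha> * gsum z1 + ennreal \<beta> * gsum z2"
    unfolding gsum_def by (subst nn_integral_add) (auto simp: nn_integral_cmult)
  finally show ?thesis .
qed

lemma gsum_abs_cong: "(\<And>f. f \<in> \<F> \<Longrightarrow> \<bar>z f\<bar> = \<bar>z' f\<bar>) \<Longrightarrow> gsum z = gsum z'"
  unfolding gsum_def by (rule nn_integral_cong) simp

definition part_sum :: "('e \<Rightarrow> real) \<Rightarrow> nat \<Rightarrow> 'w \<Rightarrow> real" where
  "part_sum f k \<omega> = (\<Sum>i=1..k. noise f i \<omega>)"

text \<open>\<open>noise f 0 = 0\<close> absorbs the truncated subtraction \<open>a - i\<close>.\<close>
definition osc :: "nat \<Rightarrow> nat \<Rightarrow> 'w \<Rightarrow> ennreal" where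
  "osc a j \<omega> = (\<integral>\<^sup>+f. ennreal (d f) * (max_partial j (\<lambda>i. noise f (a + 1 + i)) \<omega>
     + max_partial j (\<lambda>i. noise f (a - i)) \<omega>) \<partial>count_space \<F>)"

lemma osc_measurable [measurable]: "osc a j \<in> borel_measurable M"
proof -
  have "(\<lambda>\<omega>. ennreal (d f) * (max_partial j (\<lambda>i. noise f (a + 1 + i)) \<omega>
     + max_partial j (\<lambda>i. noise f (a - i)) \<omega>)) \<in> borel_measurable M" if "f \<in> \<F>" for f
  proof -
    note [measurable] = noise_measurable[OF that]
    show ?thesis by measurable
  qed
  then show ?thesis
    unfolding osc_def[abs_def] by (intro borel_measurable_nn_integral_count_space F_count)
qed

lemma osc_ge:
  assumes k: "k \<le> a + 2 ^ j" "a \<le> k + 2 ^ j"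
  shows "gsum (\<lambda>f. part_sum f k \<omega> - part_sum f a \<omega>) \<le> osc a j \<omega>"
  unfolding gsum_def osc_def
proof (rule nn_integral_mono)
  fix f assume "f \<in> space (count_space \<F>)"
  then have f: "f \<in> \<F>" by simp
  have "ennreal \<bar>part_sum f k \<omega> - part_sum f a \<omega>\<bar>
    \<le> max_partial j (\<lambda>i. noise f (a + 1 + i)) \<omega> + max_partial j (\<lambda>i. noise f (a - i)) \<omega>"
  proof (cases "a \<le> k")
    case True
    have "part_sum f k \<omega> = part_sum f a \<omega> + (\<Sum>i<k - a. noise f (a + 1 + i) \<omega>)"
    proof -
      have "{1..k} = {1..a} \<union> {a+1..k}" using True by auto
      then have "part_sum f k \<omega> = part_sum f a \<omega> + (\<Sum>i\<in>{a+1..k}. noise f i \<omega>)"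
        unfolding part_sum_def by (simp add: sum.union_disjoint)
      also have "(\<Sum>i\<in>{a+1..k}. noise f i \<omega>) = (\<Sum>i<k - a. noise f (a + 1 + i) \<omega>)"
        by (rule sum.reindex_bij_witness[of _ "\<lambda>i. a + 1 + i" "\<lambda>i. i - a - 1"]) auto
      finally show ?thesis .
    qed
    then have "ennreal \<bar>part_sum f k \<omega> - part_sum f a \<omega>\<bar> \<le> max_partial j (\<lambda>i. noise f (a + 1 + i)) \<omega>"
      using max_partial_ge[of "k - a" j "\<lambda>i. noise f (a + 1 + i)" \<omega>] k by auto
    then show ?thesis by (rule order_trans) simp
  next
    case False
    have "part_sum f a \<omega> = part_sum f k \<omega> + (\<Sum>i<a - k. noise f (a - i) \<omega>)"
    proof -
      have "{1..a} = {1..k} \<union> {k+1..a}" using False by auto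
      then have "part_sum f a \<omega> = part_sum f k \<omega> + (\<Sum>i\<in>{k+1..a}. noise f i \<omega>)"
        unfolding part_sum_def by (simp add: sum.union_disjoint)
      also have "(\<Sum>i\<in>{k+1..a}. noise f i \<omega>) = (\<Sum>i<a - k. noise f (a - i) \<omega>)"
        by (rule sum.reindex_bij_witness[of _ "\<lambda>i. a - i" "\<lambda>i. a - i"]) auto
      finally show ?thesis .
    qed
    then have "ennreal \<bar>part_sum f k \<omega> - part_sum f a \<omega>\<bar> \<le> max_partial j (\<lambda>i. noise f (a - i)) \<omega>"
      using max_partial_ge[of "a - k" j "\<lambda>i. noise f (a - i)" \<omega>] k by auto
    then show ?thesis by (rule order_trans) simp
  qed
  then show "ennreal (d f * \<bar>part_sum f k \<omega> - part_sum f a \<omega>\<bar>) \<le>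
      ennreal (d f) * (max_partial j (\<lambda>i. noise f (a + 1 + i)) \<omega> + max_partial j (\<lambda>i. noise f (a - i)) \<omega>)"
    using d_nonneg[OF f] by (subst ennreal_mult) (auto intro: mult_left_mono)
qed

definition osc_const :: real where "osc_const = 2 * max_const C r * D"

lemma osc_const_nonneg: "0 \<le> osc_const"
  unfolding osc_const_def using max_const_nonneg[OF C_nonneg r(2)] D_nonneg by simp

text \<open>Tonelli's theorem moves the expectation inside the sum over \<open>\<F>\<close>, the
  maximal inequality bounds each block by a multiple of \<open>B f\<close>, and \<open>D\<close>
  bounds the weighted sum. The backward block is a reversed sequence, for which the covariance bound
  is the same since it depends on the distance only; the two directions give the factor 2 in
  \<open>osc_const\<close>.\<close>

lemma nn_integral_osc_le: "(\<integral>\<^sup>+\<omega>. osc a j \<omega> \<partial>M) \<le> ennreal (osc_const * 2 powr (real j * (1 - r / 2)))"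
proof -
  define c where "c = max_const C r * 2 powr (real j * (1 - r / 2))"
  have c0: "0 \<le> c" unfolding c_def using max_const_nonneg[OF C_nonneg r(2)] by simp
  have mi: "(\<integral>\<^sup>+\<omega>. max_partial j (\<lambda>i. noise f (a + 1 + i)) \<omega> \<partial>M) \<le> ennreal (c * B f)"
       "(\<integral>\<^sup>+\<omega>. max_partial j (\<lambda>i. noise f (a - i)) \<omega> \<partial>M) \<le> ennreal (c * B f)" if f: "f \<in> \<F>" for f
  proof -
    have "(\<integral>\<^sup>+\<omega>. max_partial j (\<lambda>i. noise f (a + 1 + i)) \<omega> \<partial>M)
        \<le> ennreal (max_const C r * B f * 2 powr (real j * (1 - r / 2)))"
    proof (rule maximal_inequality)
      fix i k :: nat assume "i < k"
      then show "expectation (\<lambda>\<omega>. noise f (a + 1 + i) \<omega> * noise f (a + 1 + k) \<omega>)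
          \<le> C * (B f)\<^sup>2 * real (k - i) powr (- r)"
        using noise_cov_le[OF f, of "a + 1 + i" "a + 1 + k"] by simp
    qed (use noise_square[OF f] noise_measurable[OF f] r C_nonneg B_nonneg[OF f] in auto)
    then show "(\<integral>\<^sup>+\<omega>. max_partial j (\<lambda>i. noise f (a + 1 + i)) \<omega> \<partial>M) \<le> ennreal (c * B f)"
      by (simp add: c_def mult_ac)
    have "(\<integral>\<^sup>+\<omega>. max_partial j (\<lambda>i. noise f (a - i)) \<omega> \<partial>M)
        \<le> ennreal (max_const C r * B f * 2 powr (real j * (1 - r / 2)))"
    proof (rule maximal_inequality)
      fix i k :: nat assume ik: "i < k"
      show "expectation (\<lambda>\<omega>. noise f (a - i) \<omega> * noise f (a - k) \<omega>)
          \<le> C * (B f)\<^sup>2 * real (k - i) powr (- r)"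
      proof (cases "k \<le> a")
        case True
        then show ?thesis using noise_cov_le[OF f, of "a - k" "a - i"] ik
          by (simp add: mult.commute)
      next
        case False
        then have "noise f (a - k) \<omega> = 0" for \<omega> by (simp add: noise_def)
        then show ?thesis using C_nonneg by simp
      qed
    qed (use noise_square[OF f] noise_measurable[OF f] r C_nonneg B_nonneg[OF f] in auto)
    then show "(\<integral>\<^sup>+\<omega>. max_partial j (\<lambda>i. noise f (a - i)) \<omega> \<partial>M) \<le> ennreal (c * B f)"
      by (simp add: c_def mult_ac)
  qed
  have meas: "max_partial j (\<lambda>i. noise f (a + 1 + i)) \<in> borel_measurable M"
    "max_partial j (\<lambda>i. noise f (a - i)) \<in> borel_measurable M" if "f \<in> \<F>" for f
    using noise_measurable[OF that] by auto
  have "(\<integral>\<^sup>+\<omega>. osc a j \<omega> \<partial>M) = (\<integral>\<^sup>+f. (\<integral>\<^sup>+\<omega>. ennreal (d f) * (max_partial j (\<lambda>i. noise f (a + 1 + i)) \<omega>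
     + max_partial j (\<lambda>i. noise f (a - i)) \<omega>) \<partial>M) \<partial>count_space \<F>)"
    unfolding osc_def using meas by (intro nn_integral_count_space_nn_integral F_count) auto
  also have "\<dots> \<le> (\<integral>\<^sup>+f. ennreal (2 * c) * (ennreal (d f) * ennreal (B f)) \<partial>count_space \<F>)"
  proof (rule nn_integral_mono)
    fix f assume "f \<in> space (count_space \<F>)"
    then have f: "f \<in> \<F>" by simp
    note [measurable] = meas[OF f]
    have "(\<integral>\<^sup>+\<omega>. ennreal (d f) * (max_partial j (\<lambda>i. noise f (a + 1 + i)) \<omega>
         + max_partial j (\<lambda>i. noise f (a - i)) \<omega>) \<partial>M)
       = ennreal (d f) * ((\<integral>\<^sup>+\<omega>. max_partial j (\<lambda>i. noise f (a + 1 + i)) \<omega> \<partial>M)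
         + (\<integral>\<^sup>+\<omega>. max_partial j (\<lambda>i. noise f (a - i)) \<omega> \<partial>M))"
      using meas[OF f]
      by (subst nn_integral_cmult) (auto intro!: arg_cong[where f="\<lambda>x. ennreal (d f) * x"] nn_integral_add)
    also have "\<dots> \<le> ennreal (d f) * (ennreal (c * B f) + ennreal (c * B f))"
      using mi[OF f] by (intro mult_left_mono add_mono) auto
    also have "\<dots> = ennreal (2 * c) * (ennreal (d f) * ennreal (B f))"
      using c0 d_nonneg[OF f] B_nonneg[OF f]
      by (simp add: ennreal_mult[symmetric] ennreal_plus[symmetric] mult_ac del: ennreal_plus)
    finally show "(\<integral>\<^sup>+\<omega>. ennreal (d f) * (max_partial j (\<lambda>i. noise f (a + 1 + i)) \<omega>
         + max_partial j (\<lambda>i. noise f (a - i)) \<omega>) \<partial>M) \<le> ennreal (2 * c) * (ennreal (d f) * ennreal (B f))" .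
  qed
  also have "\<dots> = ennreal (2 * c) * (\<integral>\<^sup>+f. ennreal (d f) * ennreal (B f) \<partial>count_space \<F>)"
    by (rule nn_integral_cmult) simp
  also have "\<dots> \<le> ennreal (2 * c) * ennreal D"
    by (intro mult_left_mono D) simp
  also have "\<dots> = ennreal (osc_const * 2 powr (real j * (1 - r / 2)))"
    using c0 D_nonneg by (simp add: ennreal_mult[symmetric] c_def osc_const_def mult_ac)
  finally show ?thesis .
qed

end

text \<open>The quotient is the factor in front of the noise, singular at the ends of the sample.
  For \<open>k\<close> of size at least \<open>2 ^ j\<close> it is traded for the dyadic weight that
  will multiply an oscillation over about \<open>2 ^ j\<close> terms. The extra factor
  \<open>t\<close> in the second bound belongs to the full sum and removes the singularity, because
  \<open>t powr (1 - \<gamma>) \<le> 1\<close>. The half \<open>2 * k \<le> n\<close> suffices by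
  the symmetry of \<open>t * (1 - t)\<close>.\<close>

lemma weight_bounds:
  fixes k n j :: nat
  assumes \<gamma>: "0 \<le> \<gamma>" "\<gamma> < 1" and k: "2 ^ j \<le> k" "2 * k \<le> n"
  defines "t \<equiv> real k / real n"
  shows "(t * (1 - t)) powr (- \<gamma>) / n \<le> 2 * (real n powr (\<gamma> - 1) * 2 powr (- real j * \<gamma>))"
    and "(t * (1 - t)) powr (- \<gamma>) / n * t \<le> 2 / n"
proof -
  have k0: "0 < k" using k(1) by (metis gr0I le_zero_eq power_not_zero zero_neq_numeral)
  then have n0: "0 < n" using k by auto
  have t: "0 < t" "t \<le> 1 / 2" using k0 n0 k by (auto simp: t_def field_simps)
  have "(t * (1 - t)) powr (- \<gamma>) \<le> (t * (1 / 2)) powr (- \<gamma>)"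
    using t \<gamma> by (intro powr_mono2' mult_left_mono) auto
  also have "\<dots> = t powr (- \<gamma>) * 2 powr \<gamma>"
    using t by (simp add: powr_mult powr_divide powr_minus field_simps)
  also have "\<dots> \<le> t powr (- \<gamma>) * 2"
    using \<gamma> powr_mono[of \<gamma> 1 "2::real"] by (intro mult_left_mono) auto
  finally have w: "(t * (1 - t)) powr (- \<gamma>) \<le> 2 * t powr (- \<gamma>)" by simp
  have "t powr (- \<gamma>) = real k powr (- \<gamma>) * real n powr \<gamma>"
    unfolding t_def using k0 n0 by (simp add: powr_divide powr_minus field_simps)
  also have "\<dots> \<le> (2 ^ j) powr (- \<gamma>) * real n powr \<gamma>"
    using \<gamma> of_nat_mono[OF k(1), where 'a=real] by (intro mult_right_mono powr_mono2') auto
  also have "(2 ^ j) powr (- \<gamma>) = (2::real) powr (- real j * \<gamma>)"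
    by (simp add: powr_realpow[symmetric] powr_powr)
  finally have "t powr (- \<gamma>) \<le> 2 powr (- real j * \<gamma>) * real n powr \<gamma>" .
  then have "(t * (1 - t)) powr (- \<gamma>) / n \<le> 2 * (2 powr (- real j * \<gamma>) * real n powr \<gamma>) / n"
    using w n0 by (intro divide_right_mono) auto
  also have "\<dots> = 2 * (real n powr (\<gamma> - 1) * 2 powr (- real j * \<gamma>))"
    using n0 by (simp add: powr_diff)
  finally show "(t * (1 - t)) powr (- \<gamma>) / n \<le> 2 * (real n powr (\<gamma> - 1) * 2 powr (- real j * \<gamma>))" .
  have "(t * (1 - t)) powr (- \<gamma>) * t \<le> 2 * t powr (- \<gamma>) * t"
    using w t by (intro mult_right_mono) auto
  also have "\<dots> = 2 * (t powr (- \<gamma>) * t powr 1)" using t by simp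
  also have "t powr (- \<gamma>) * t powr 1 = t powr (1 - \<gamma>)"
    unfolding powr_add[symmetric] by simp
  also have "2 * t powr (1 - \<gamma>) \<le> 2 * 1"
    using t \<gamma> by (intro mult_left_mono powr_le1) auto
  finally show "(t * (1 - t)) powr (- \<gamma>) / n * t \<le> 2 / n"
    using n0 by (simp add: divide_right_mono)
qed

context change_point_sample
begin

section \<open>Drift and noise of the weighted CUSUM process\<close>

definition \<tau> :: real where "\<tau> = real ks / real n"

lemma tau: "0 < \<tau>" "\<tau> < 1"
  using ks by (auto simp: \<tau>_def)

definition drift :: "nat \<Rightarrow> real" where "drift k = cusum_drift \<gamma> \<tau> (real k / real n)"

text \<open>The noise part in bridge form. With \<open>S\<close> the partial sums of the noise and
  \<open>u = t * (1 - t)\<close>, the difference \<open>S_k / k - (S_n - S_k) / (n - k)\<close>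
  equals \<open>(S_k - t * S_n) / (n * u)\<close>, so one factor \<open>u\<close> of the weight
  cancels.\<close>

definition delta :: "('e \<Rightarrow> real) \<Rightarrow> nat \<Rightarrow> 'w \<Rightarrow> real" where
  "delta f k \<omega> = (real k / real n * (1 - real k / real n)) powr (- \<gamma>) / n
     * (part_sum f k \<omega> - real k / real n * part_sum f n \<omega>)"

definition cusum :: "nat \<Rightarrow> 'w \<Rightarrow> 'e set \<Rightarrow> real" where
  "cusum k \<omega> = Dk E (\<lambda>_. Z) \<gamma> n k \<omega>"

definition cusum_val :: "('e \<Rightarrow> real) \<Rightarrow> nat \<Rightarrow> 'w \<Rightarrow> real" where
  "cusum_val f k \<omega> = (real k / real n * (1 - real k / real n)) powr (1 - \<gamma>) *
     (1 / real k * (\<Sum>i\<in>{1..k}. f (Z i \<omega>)) - 1 / real (n - k) * (\<Sum>i\<in>{k+1..n}. f (Z i \<omega>)))"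

text \<open>The measure is a linear combination of Dirac measures. Outside the sigma-algebra both
  sides are 0, by the convention for \<open>measure\<close> and by the case distinction in
  \<open>Dk\<close>.\<close>

lemma cusum_functional:
  assumes \<omega>: "\<omega> \<in> space M" and k: "1 \<le> k" "k < n"
  shows "sm_functional E \<F> (cusum k \<omega>) (\<lambda>f. cusum_val f k \<omega>)"
proof -
  define c where "c i = (real k / real n * (1 - real k / real n)) powr (1 - \<gamma>)
    * (if i \<le> k then 1 / real k else - 1 / real (n - k))" for i
  have split: "(\<Sum>i\<in>{1..n}. c i * g i) = (real k / real n * (1 - real k / real n)) powr (1 - \<gamma>) *
     (1 / real k * (\<Sum>i\<in>{1..k}. g i) - 1 / real (n - k) * (\<Sum>i\<in>{k+1..n}. g i))" for g :: "nat \<Rightarrow> real"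
  proof -
    have "{1..n} = {1..k} \<union> {k+1..n}" using k by auto
    then have "(\<Sum>i\<in>{1..n}. c i * g i) = (\<Sum>i\<in>{1..k}. c i * g i) + (\<Sum>i\<in>{k+1..n}. c i * g i)"
      by (simp add: sum.union_disjoint)
    then show ?thesis
      by (simp add: c_def sum_distrib_left sum_negf right_diff_distrib mult.assoc)
  qed
  have "sm_functional E \<F> (\<lambda>A. \<Sum>i\<in>{1..n}. c i * measure (return E (Z i \<omega>)) A) (\<lambda>f. \<Sum>i\<in>{1..n}. c i * f (Z i \<omega>))"
    using ks \<omega> measurable_space[OF Z_meas \<omega>]
    by (intro sm_functional_sum sm_functional_scale sm_functional_return F_meas) auto
  moreover have "(\<lambda>A. \<Sum>i\<in>{1..n}. c i * measure (return E (Z i \<omega>)) A) = cusum k \<omega>"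
  proof
    fix A
    show "(\<Sum>i\<in>{1..n}. c i * measure (return E (Z i \<omega>)) A) = cusum k \<omega> A"
    proof (cases "A \<in> sets E")
      case True
      then have "measure (return E x) A = indicator A x" for x
        by (simp add: measure_return)
      then show ?thesis unfolding split using True by (simp add: cusum_def Dk_def)
    next
      case False
      then show ?thesis by (simp add: cusum_def Dk_def measure_notin_sets)
    qed
  qed
  ultimately show ?thesis unfolding split cusum_val_def by simp
qed

lemma cusum_val_eq:
  assumes f: "f \<in> \<F>" and k: "1 \<le> k" "k < n"
  shows "cusum_val f k \<omega> = drift k * ((\<integral>x. f x \<partial>P) - (\<integral>x. f x \<partial>Q)) + delta f k \<omega>"
proof -
  define p where "p = (\<integral>x. f x \<partial>P)"
  define q where "q = (\<integral>x. f x \<partial>Q)"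
  define u where "u = real k / real n * (1 - real k / real n)"
  have u: "0 < u" using k by (simp add: u_def)
  have fz: "f (Z i \<omega>) = noise f i \<omega> + mean f i" if "i \<in> {1..n}" for i
    using that by (simp add: noise_def)
  have s1: "(\<Sum>i\<in>{1..k}. f (Z i \<omega>)) = part_sum f k \<omega> + (\<Sum>i\<in>{1..k}. mean f i)"
    unfolding part_sum_def sum.distrib[symmetric] by (rule sum.cong) (use k fz in auto)
  have pn: "part_sum f n \<omega> = part_sum f k \<omega> + (\<Sum>i\<in>{k+1..n}. noise f i \<omega>)"
  proof -
    have "{1..n} = {1..k} \<union> {k+1..n}" using k by auto
    then show ?thesis unfolding part_sum_def by (simp add: sum.union_disjoint)
  qed
  have s2: "(\<Sum>i\<in>{k+1..n}. f (Z i \<omega>)) = part_sum f n \<omega> - part_sum f k \<omega> + (\<Sum>i\<in>{k+1..n}. mean f i)"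
    unfolding pn add_diff_cancel_left' sum.distrib[symmetric] by (rule sum.cong) (use k fz in auto)
  have w: "u powr (1 - \<gamma>) = u powr (- \<gamma>) * u"
  proof -
    have "u powr (1 - \<gamma>) = u powr (- \<gamma>) * u powr 1" unfolding powr_add[symmetric] by simp
    then show ?thesis using u by simp
  qed
  have pos: "real k > 0" "real n > 0" "real n - real k > 0" using k by auto
  have key: "u * (1 / real k * (a + m1) - 1 / (real n - real k) * (b - a + m2))
    = u * (m1 / real k - m2 / (real n - real k)) + 1 / n * (a - real k / real n * b)" for a b m1 m2
    unfolding u_def using pos by (simp add: field_simps)
  \<comment> \<open>Only the average over the block that straddles the change point mixes
    \<open>P\<close> and \<open>Q\<close>; splitting it at \<open>ks\<close> yields the two branches
    of \<open>cusum_drift\<close>.\<close>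
  have m: "u powr (1 - \<gamma>) * ((\<Sum>i\<in>{1..k}. mean f i) / real k - (\<Sum>i\<in>{k+1..n}. mean f i) / (real n - real k))
    = drift k * (p - q)"
  proof (cases "k \<le> ks")
    case True
    have "{k+1..n} = {k+1..ks} \<union> {ks+1..n}" using ks True by auto
    then have "(\<Sum>i\<in>{k+1..n}. mean f i) = (\<Sum>i\<in>{k+1..ks}. mean f i) + (\<Sum>i\<in>{ks+1..n}. mean f i)"
      by (simp add: sum.union_disjoint)
    also have "(\<Sum>i\<in>{k+1..ks}. mean f i) = (real ks - real k) * p"
      using True by (simp add: mean_def p_def of_nat_diff)
    also have "(\<Sum>i\<in>{ks+1..n}. mean f i) = (\<Sum>i\<in>{ks+1..n}. q)"
      by (rule sum.cong) (auto simp: mean_def q_def)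
    also have "\<dots> = (real n - real ks) * q" using ks by (simp add: of_nat_diff)
    finally have b: "(\<Sum>i\<in>{k+1..n}. mean f i) = (real ks - real k) * p + (real n - real ks) * q" .
    have a: "(\<Sum>i\<in>{1..k}. mean f i) = real k * p" using True by (simp add: mean_def p_def)
    have "drift k = u powr (1 - \<gamma>) * ((real n - real ks) / (real n - real k))"
      unfolding drift_def cusum_drift_def u_def \<tau>_def using True pos by (simp add: divide_right_mono field_simps)
    moreover have "real k * p / real k - ((real ks - real k) * p + (real n - real ks) * q) / (real n - real k)
        = (real n - real ks) / (real n - real k) * (p - q)"
      using pos by (simp add: field_simps)
    ultimately show ?thesis unfolding a b by simp
  next
    case False
    have "{1..k} = {1..ks} \<union> {ks+1..k}" using ks False by auto
    then have "(\<Sum>i\<in>{1..k}. mean f i) = (\<Sum>i\<in>{1..ks}. mean f i) + (\<Sum>i\<in>{ks+1..k}. mean f i)"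
      by (simp add: sum.union_disjoint)
    also have "(\<Sum>i\<in>{1..ks}. mean f i) = real ks * p" by (simp add: mean_def p_def)
    also have "(\<Sum>i\<in>{ks+1..k}. mean f i) = (\<Sum>i\<in>{ks+1..k}. q)"
      by (rule sum.cong) (auto simp: mean_def q_def)
    also have "\<dots> = (real k - real ks) * q" using False by (simp add: of_nat_diff)
    finally have a: "(\<Sum>i\<in>{1..k}. mean f i) = real ks * p + (real k - real ks) * q" .
    have "(\<Sum>i\<in>{k+1..n}. mean f i) = (\<Sum>i\<in>{k+1..n}. q)"
      by (rule sum.cong) (use False in \<open>auto simp: mean_def q_def\<close>)
    then have b: "(\<Sum>i\<in>{k+1..n}. mean f i) = (real n - real k) * q" using k by (simp add: of_nat_diff)
    have "\<not> real k / real n \<le> real ks / real n" using False pos by (simp add: divide_le_cancel)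
    then have "drift k = u powr (1 - \<gamma>) * (real ks / real k)"
      unfolding drift_def cusum_drift_def u_def \<tau>_def using pos by simp
    moreover have "(real ks * p + (real k - real ks) * q) / real k - (real n - real k) * q / (real n - real k)
        = real ks / real k * (p - q)"
      using pos by (simp add: field_simps)
    ultimately show ?thesis unfolding a b by simp
  qed
  have nk: "real (n - k) = real n - real k" using k by (simp add: of_nat_diff)
  have "cusum_val f k \<omega> = u powr (- \<gamma>) * (u * (1 / real k * (part_sum f k \<omega> + (\<Sum>i\<in>{1..k}. mean f i))
      - 1 / (real n - real k) * (part_sum f n \<omega> - part_sum f k \<omega> + (\<Sum>i\<in>{k+1..n}. mean f i))))"
    unfolding cusum_val_def s1 s2 u_def[symmetric] w nk by simp
  also have "\<dots> = u powr (1 - \<gamma>) * ((\<Sum>i\<in>{1..k}. mean f i) / real k - (\<Sum>i\<in>{k+1..n}. mean f i) / (real n - real k))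
      + u powr (- \<gamma>) / n * (part_sum f k \<omega> - real k / real n * part_sum f n \<omega>)"
    unfolding key w by (simp add: distrib_left mult.assoc)
  also have "\<dots> = drift k * (p - q) + delta f k \<omega>"
    unfolding m delta_def u_def[symmetric] ..
  finally show ?thesis unfolding p_def q_def .
qed

lemma PQ_functional: "sm_functional E \<F> (msub P Q) (\<lambda>f. (\<integral>x. f x \<partial>P) - (\<integral>x. f x \<partial>Q))"
  using P Q integrable_PQ by (intro sm_functional_msub) (auto intro: prob_space.finite_measure)

lemma seminorm_le_gsum:
  assumes bd: "\<And>\<nu>. fsm E \<nu> \<Longrightarrow> (\<forall>f\<in>\<F>. sm_integrable E \<nu> f) \<Longrightarrow>
      ennreal (N \<nu>) \<le> (\<integral>\<^sup>+f. ennreal (d f * \<bar>sm_integral E \<nu> f\<bar>) \<partial>count_space \<F>)"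
    and \<nu>: "sm_functional E \<F> \<nu> L"
  shows "ennreal (N \<nu>) \<le> gsum L"
proof -
  have "ennreal (N \<nu>) \<le> gsum (sm_integral E \<nu>)"
    unfolding gsum_def using sm_functionalD[OF \<nu>] by (intro bd) auto
  also have "\<dots> = gsum L" by (rule gsum_abs_cong) (simp add: sm_functionalD(3)[OF \<nu>])
  finally show ?thesis .
qed

lemma drift_bounds:
  assumes k: "1 \<le> k" "k < n"
  shows "0 < drift k" "(1 - \<gamma>) * min \<tau> (1 - \<tau>) * \<bar>real k / real n - \<tau>\<bar> \<le> drift ks - drift k"
    "\<tau> * (1 - \<tau>) \<le> drift ks" "drift ks \<le> 1"
proof -
  have t: "0 < real k / real n" "real k / real n < 1" using k by auto
  have d: "drift ks = cusum_drift \<gamma> \<tau> \<tau>" by (simp add: drift_def \<tau>_def)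
  show "0 < drift k" unfolding drift_def by (rule cusum_drift_pos) (use t tau in auto)
  show "(1 - \<gamma>) * min \<tau> (1 - \<tau>) * \<bar>real k / real n - \<tau>\<bar> \<le> drift ks - drift k"
    unfolding d unfolding drift_def by (rule cusum_drift_gap) (use t tau gamma in auto)
  show "\<tau> * (1 - \<tau>) \<le> drift ks" "drift ks \<le> 1"
    unfolding d using cusum_drift_peak[OF tau gamma] by auto
qed

text \<open>With \<open>s = drift k / drift ks\<close> the measure \<open>cusum k - s * cusum ks\<close> has no \<open>P - Q\<close> part, so
  \<open>N\<close> of it is controlled by the noise alone.\<close>
lemma argmax_drift_le:
  assumes sem: "sm_seminorm E N"
    and bd: "\<And>\<nu>. fsm E \<nu> \<Longrightarrow> (\<forall>f\<in>\<F>. sm_integrable E \<nu> f) \<Longrightarrow>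
      ennreal (N \<nu>) \<le> (\<integral>\<^sup>+f. ennreal (d f * \<bar>sm_integral E \<nu> f\<bar>) \<partial>count_space \<F>)"
    and \<omega>: "\<omega> \<in> space M" and k: "1 \<le> k" "k < n"
    and b: "0 < b" "b < N (msub P Q)"
    and max: "N (cusum ks \<omega>) \<le> N (cusum k \<omega>)"
    and small: "gsum (\<lambda>f. delta f ks \<omega>) \<le> ennreal (drift ks * b / 4)"
  shows "ennreal ((drift ks - drift k) * b / 2) \<le> gsum (\<lambda>f. delta f k \<omega> - delta f ks \<omega>)"
proof -
  define s where "s = drift k / drift ks"
  define a where "a = drift ks"
  have a0: "0 < a" unfolding a_def using drift_bounds[OF ks] by auto
  have gap0: "0 \<le> drift ks - drift k"
    using drift_bounds(2)[OF k] gamma tau by (smt (verit) mult_nonneg_nonneg)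
  have s: "0 < s" "s \<le> 1" "(1 - s) * a = drift ks - drift k"
    using drift_bounds(1)[OF k] a0 gap0 by (auto simp: s_def a_def field_simps)
  have scale: "N (\<lambda>A. c * \<nu> A) = \<bar>c\<bar> * N \<nu>" if "fsm E \<nu>" for c \<nu>
    using sem that unfolding sm_seminorm_def by blast
  have tri: "N (\<lambda>A. \<nu> A + \<mu> A) \<le> N \<nu> + N \<mu>" if "fsm E \<nu>" "fsm E \<mu>" for \<nu> \<mu>
    using sem that unfolding sm_seminorm_def by blast
  note F1 = cusum_functional[OF \<omega> k] and F0 = cusum_functional[OF \<omega> ks] and FP = PQ_functional
  have Fd: "sm_functional E \<F> (\<lambda>A. cusum k \<omega> A + (- s) * cusum ks \<omega> A)
      (\<lambda>f. cusum_val f k \<omega> + (- s) * cusum_val f ks \<omega>)"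
    by (intro sm_functional_add sm_functional_scale F1 F0)
  have Fn: "sm_functional E \<F> (\<lambda>A. cusum ks \<omega> A + (- a) * msub P Q A)
      (\<lambda>f. cusum_val f ks \<omega> + (- a) * ((\<integral>x. f x \<partial>P) - (\<integral>x. f x \<partial>Q)))"
    by (intro sm_functional_add sm_functional_scale F0 FP)
  define Nd where "Nd = N (\<lambda>A. cusum k \<omega> A + (- s) * cusum ks \<omega> A)"
  define Nn where "Nn = N (\<lambda>A. cusum ks \<omega> A + (- a) * msub P Q A)"
  have fs: "fsm E (cusum ks \<omega>)" "fsm E (msub P Q)" "fsm E (\<lambda>A. s * cusum ks \<omega> A)"
    "fsm E (\<lambda>A. (-1) * (cusum ks \<omega> A + (- a) * msub P Q A))"
    using sm_functionalD(1)[OF F0] sm_functionalD(1)[OF FP]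
      sm_functionalD(1)[OF sm_functional_scale[OF F0, of s]]
      sm_functionalD(1)[OF sm_functional_scale[OF Fn, of "-1"]] by auto
  \<comment> \<open>Maximality enters here: \<open>N (cusum ks \<omega>)\<close> is at most
    \<open>N (cusum k \<omega>)\<close>, hence at most
    \<open>Nd + s * N (cusum ks \<omega>)\<close>.\<close>
  have "N (cusum k \<omega>) = N (\<lambda>A. (cusum k \<omega> A + (- s) * cusum ks \<omega> A) + s * cusum ks \<omega> A)" by simp
  also have "\<dots> \<le> Nd + N (\<lambda>A. s * cusum ks \<omega> A)"
    unfolding Nd_def by (rule tri) (use sm_functionalD(1)[OF Fd] fs in auto)
  also have "N (\<lambda>A. s * cusum ks \<omega> A) = s * N (cusum ks \<omega>)" using scale[OF fs(1)] s by simp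
  finally have 1: "(1 - s) * N (cusum ks \<omega>) \<le> Nd" using max by (simp add: left_diff_distrib)
  \<comment> \<open>A lower bound for the height of the peak: removing the noise, at most
    \<open>a * b / 4\<close>, from \<open>a * N (msub P Q)\<close> leaves at least three quarters of
    \<open>a * b\<close>.\<close>
  have "a * N (msub P Q) = N (\<lambda>A. a * msub P Q A)" using scale[OF fs(2)] a0 by simp
  also have "(\<lambda>A. a * msub P Q A) = (\<lambda>A. cusum ks \<omega> A + (-1) * (cusum ks \<omega> A + (- a) * msub P Q A))"
    by auto
  also have "N \<dots> \<le> N (cusum ks \<omega>) + N (\<lambda>A. (-1) * (cusum ks \<omega> A + (- a) * msub P Q A))"
    by (rule tri) (use fs in auto)
  also have "N (\<lambda>A. (-1) * (cusum ks \<omega> A + (- a) * msub P Q A)) = Nn"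
    unfolding Nn_def using scale[OF sm_functionalD(1)[OF Fn], of "-1"] by simp
  finally have 2: "a * N (msub P Q) \<le> N (cusum ks \<omega>) + Nn" .
  have "ennreal Nn \<le> gsum (\<lambda>f. cusum_val f ks \<omega> + (- a) * ((\<integral>x. f x \<partial>P) - (\<integral>x. f x \<partial>Q)))"
    unfolding Nn_def by (rule seminorm_le_gsum[OF bd Fn])
  also have "\<dots> = gsum (\<lambda>f. delta f ks \<omega>)"
    by (rule gsum_abs_cong) (simp add: cusum_val_eq[OF _ ks] a_def)
  also have "\<dots> \<le> ennreal (a * b / 4)" using small by (simp add: a_def)
  finally have 3: "Nn \<le> a * b / 4" using a0 b by (subst (asm) ennreal_le_iff) auto
  have "a * b \<le> a * N (msub P Q)" using a0 b by (intro mult_left_mono) auto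
  with 2 3 have 4: "3 / 4 * (a * b) \<le> N (cusum ks \<omega>)" by simp
  have "(1 - s) * (3 / 4 * (a * b)) \<le> (1 - s) * N (cusum ks \<omega>)"
    using 4 s by (intro mult_left_mono) auto
  with 1 have 5: "(1 - s) * (3 / 4 * (a * b)) \<le> Nd" by simp
  have "ennreal Nd \<le> gsum (\<lambda>f. cusum_val f k \<omega> + (- s) * cusum_val f ks \<omega>)"
    unfolding Nd_def by (rule seminorm_le_gsum[OF bd Fd])
  also have "\<dots> = gsum (\<lambda>f. delta f k \<omega> - s * delta f ks \<omega>)"
  proof (rule gsum_abs_cong)
    fix f assume f: "f \<in> \<F>"
    have sd: "s * drift ks = drift k" using a0 by (simp add: s_def a_def)
    show "\<bar>cusum_val f k \<omega> + (- s) * cusum_val f ks \<omega>\<bar> = \<bar>delta f k \<omega> - s * delta f ks \<omega>\<bar>"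
      unfolding cusum_val_eq[OF f k] cusum_val_eq[OF f ks]
      by (simp add: distrib_left mult.assoc[symmetric] sd)
  qed
  \<comment> \<open>The mismatch \<open>(1 - s) * delta f ks \<omega>\<close> costs a quarter of
    \<open>(1 - s) * a * b\<close>. Against the three quarters from the peak one half remains, and
    \<open>(1 - s) * a\<close> is the drift gap.\<close>
  also have "\<dots> \<le> ennreal 1 * gsum (\<lambda>f. delta f k \<omega> - delta f ks \<omega>) + ennreal (1 - s) * gsum (\<lambda>f. delta f ks \<omega>)"
  proof (rule gsum_le2)
    fix f
    have "delta f k \<omega> - s * delta f ks \<omega> = (delta f k \<omega> - delta f ks \<omega>) + (1 - s) * delta f ks \<omega>"
      by (simp add: algebra_simps)
    then show "\<bar>delta f k \<omega> - s * delta f ks \<omega>\<bar> \<le> 1 * \<bar>delta f k \<omega> - delta f ks \<omega>\<bar> + (1 - s) * \<bar>delta f ks \<omega>\<bar>"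
      using s by (metis abs_mult abs_of_nonneg abs_triangle_ineq diff_ge_0_iff_ge mult_1)
  qed (use s in auto)
  also have "\<dots> \<le> gsum (\<lambda>f. delta f k \<omega> - delta f ks \<omega>) + ennreal (1 - s) * ennreal (a * b / 4)"
    using small by (auto simp: a_def intro!: add_left_mono mult_left_mono)
  finally have 6: "ennreal Nd \<le> gsum (\<lambda>f. delta f k \<omega> - delta f ks \<omega>) + ennreal ((1 - s) * (a * b / 4))"
    using s a0 b by (simp add: ennreal_mult[symmetric])
  show ?thesis
  proof (cases "gsum (\<lambda>f. delta f k \<omega> - delta f ks \<omega>)" rule: ennreal_cases)
    case (real g)
    have "ennreal Nd \<le> ennreal (g + (1 - s) * (a * b / 4))"
      using 6 real s a0 b by (simp add: ennreal_plus)
    then have "Nd \<le> g + (1 - s) * (a * b / 4)"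
      using real s a0 b by (subst (asm) ennreal_le_iff) auto
    with 5 have "(1 - s) * (3 / 4 * (a * b)) - (1 - s) * (a * b / 4) \<le> g" by linarith
    moreover have "(1 - s) * (3 / 4 * (a * b)) - (1 - s) * (a * b / 4) = ((1 - s) * a) * b / 2"
      by (simp add: field_simps)
    ultimately have "(drift ks - drift k) * b / 2 \<le> g" unfolding s(3) by linarith
    then show ?thesis using real by (simp add: ennreal_leI)
  qed simp
qed

text \<open>One random variable that dominates the noise for all \<open>k\<close>, up to a factor 2.
  Summand \<open>j\<close> covers the indices at distance about \<open>2 ^ j\<close> from either
  end, with the weight from \<open>weight_bounds\<close>; the final term covers the full sum, for
  which no singular weight is left.\<close>

definition noise_bound :: "nat \<Rightarrow> 'w \<Rightarrow> ennreal" where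
  "noise_bound J \<omega> = ennreal (real n powr (\<gamma> - 1)) * (\<Sum>j\<le>J. ennreal (2 powr (- real j * \<gamma>)) *
      (osc 0 (Suc j) \<omega> + osc n (Suc j) \<omega>)) + ennreal (1 / n) * osc 0 (Suc J) \<omega>"

lemma noise_bound_measurable [measurable]: "noise_bound J \<in> borel_measurable M"
  unfolding noise_bound_def[abs_def] by measurable

lemma gsum_part_sum_le:
  assumes "n < 2 ^ Suc J" "k \<le> n"
  shows "ennreal (1 / n) * gsum (\<lambda>f. part_sum f k \<omega>) \<le> noise_bound J \<omega>"
proof -
  have "gsum (\<lambda>f. part_sum f k \<omega>) = gsum (\<lambda>f. part_sum f k \<omega> - part_sum f 0 \<omega>)"
    by (simp add: part_sum_def)
  also have "\<dots> \<le> osc 0 (Suc J) \<omega>" using assms by (intro osc_ge) auto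
  finally have "ennreal (1 / n) * gsum (\<lambda>f. part_sum f k \<omega>) \<le> ennreal (1 / n) * osc 0 (Suc J) \<omega>"
    by (intro mult_left_mono) auto
  also have "\<dots> \<le> noise_bound J \<omega>" unfolding noise_bound_def by simp
  finally show ?thesis .
qed

text \<open>The partial sum is measured from the nearer end: from 0 if \<open>2 * k \<le> n\<close>,
  otherwise from \<open>n\<close>, where \<open>S_k - t * S_n = (S_k - S_n) + (1 - t) * S_n\<close>.
  Either way the full sum carries the small factor \<open>t'\<close>, and the dyadic size of the
  distance \<open>k'\<close> to that end selects one summand of \<open>noise_bound\<close>.\<close>

lemma gsum_delta_le:
  assumes J: "n < 2 ^ Suc J" and k: "1 \<le> k" "k < n"
  shows "gsum (\<lambda>f. delta f k \<omega>) \<le> 2 * noise_bound J \<omega>"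
proof -
  define t where "t = real k / real n"
  have n0: "0 < real n" using k by simp
  have osc_part: "ennreal (2 * (real n powr (\<gamma> - 1) * 2 powr (- real j * \<gamma>))) * osc x (Suc j) \<omega>
      + ennreal (2 / n) * osc 0 (Suc J) \<omega> \<le> 2 * noise_bound J \<omega>" if "j \<le> J" "x = 0 \<or> x = n" for j x
  proof -
    have "osc x (Suc j) \<omega> \<le> osc 0 (Suc j) \<omega> + osc n (Suc j) \<omega>" using that by auto
    then have "ennreal (2 powr (- real j * \<gamma>)) * osc x (Suc j) \<omega>
        \<le> ennreal (2 powr (- real j * \<gamma>)) * (osc 0 (Suc j) \<omega> + osc n (Suc j) \<omega>)"
      by (intro mult_left_mono) auto
    also have "\<dots> \<le> (\<Sum>j\<le>J. ennreal (2 powr (- real j * \<gamma>)) * (osc 0 (Suc j) \<omega> + osc n (Suc j) \<omega>))"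
      using that by (intro member_le_sum) auto
    finally have "ennreal (real n powr (\<gamma> - 1)) * (ennreal (2 powr (- real j * \<gamma>)) * osc x (Suc j) \<omega>)
        + ennreal (1 / n) * osc 0 (Suc J) \<omega> \<le> noise_bound J \<omega>"
      unfolding noise_bound_def by (intro add_right_mono mult_left_mono) auto
    then have "2 * (ennreal (real n powr (\<gamma> - 1)) * (ennreal (2 powr (- real j * \<gamma>)) * osc x (Suc j) \<omega>)
        + ennreal (1 / n) * osc 0 (Suc J) \<omega>) \<le> 2 * noise_bound J \<omega>"
      by (intro mult_left_mono) auto
    moreover have "ennreal (2 * (real n powr (\<gamma> - 1) * 2 powr (- real j * \<gamma>))) =
        2 * (ennreal (real n powr (\<gamma> - 1)) * ennreal (2 powr (- real j * \<gamma>)))"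
      by (simp add: ennreal_mult)
    moreover have "ennreal (2 / n) = 2 * ennreal (1 / n)"
      using ennreal_mult[of 2 "1 / real n"] by simp
    ultimately show ?thesis by (simp add: distrib_left mult.assoc)
  qed
  define k' where "k' = (if 2 * k \<le> n then k else n - k)"
  define x where "x = (if 2 * k \<le> n then 0 else n)"
  define t' where "t' = real k' / real n"
  have k': "1 \<le> k'" "2 * k' \<le> n" using k by (auto simp: k'_def)
  have tt: "t' = (if 2 * k \<le> n then t else 1 - t)"
    using k n0 by (simp add: t'_def t_def k'_def of_nat_diff diff_divide_distrib)
  have tw: "t' * (1 - t') = t * (1 - t)" by (simp add: tt mult.commute)
  obtain j where j: "2 ^ j \<le> k'" "k' < 2 ^ (j + 1)" using ex_power_ivl1[of 2 k'] k' by auto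
  have "(2::nat) ^ j < 2 ^ Suc J" using j(1) k'(2) J by linarith
  then have jJ: "j \<le> J" using power_less_imp_less_exp[of "2::nat" j "Suc J"] by simp
  note wb = weight_bounds[OF gamma j(1) k'(2), folded t'_def, unfolded tw]
  have t'0: "0 \<le> t'" by (simp add: t'_def)
  define w where "w = (t * (1 - t)) powr (- \<gamma>) / n"
  have w0: "0 \<le> w" by (simp add: w_def)
  have "gsum (\<lambda>f. delta f k \<omega>) \<le> ennreal (2 * (real n powr (\<gamma> - 1) * 2 powr (- real j * \<gamma>))) *
      gsum (\<lambda>f. part_sum f k \<omega> - part_sum f x \<omega>) + ennreal (2 / n) * gsum (\<lambda>f. part_sum f n \<omega> - part_sum f 0 \<omega>)"
  proof (rule gsum_le2)
    fix f
    have "\<bar>delta f k \<omega>\<bar> = w * \<bar>part_sum f k \<omega> - t * part_sum f n \<omega>\<bar>"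
      unfolding delta_def w_def t_def[symmetric] by (simp add: abs_mult)
    also have "\<bar>part_sum f k \<omega> - t * part_sum f n \<omega>\<bar>
        \<le> \<bar>part_sum f k \<omega> - part_sum f x \<omega>\<bar> + t' * \<bar>part_sum f n \<omega> - part_sum f 0 \<omega>\<bar>"
    proof (cases "2 * k \<le> n")
      case True
      then show ?thesis
        using abs_triangle_ineq4[of "part_sum f k \<omega>" "t * part_sum f n \<omega>"] t'0
        by (simp add: x_def tt part_sum_def[of _ 0] abs_mult)
    next
      case False
      have "part_sum f k \<omega> - t * part_sum f n \<omega> = (part_sum f k \<omega> - part_sum f n \<omega>) + t' * part_sum f n \<omega>"
        using False by (simp add: tt algebra_simps)
      then show ?thesis
        using abs_triangle_ineq[of "part_sum f k \<omega> - part_sum f n \<omega>" "t' * part_sum f n \<omega>"] t'0 False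
        by (simp add: x_def part_sum_def[of _ 0] abs_mult)
    qed
    also have "w * (\<bar>part_sum f k \<omega> - part_sum f x \<omega>\<bar> + t' * \<bar>part_sum f n \<omega> - part_sum f 0 \<omega>\<bar>)
        = w * \<bar>part_sum f k \<omega> - part_sum f x \<omega>\<bar> + (w * t') * \<bar>part_sum f n \<omega> - part_sum f 0 \<omega>\<bar>"
      by (simp add: algebra_simps)
    also have "\<dots> \<le> 2 * (real n powr (\<gamma> - 1) * 2 powr (- real j * \<gamma>)) * \<bar>part_sum f k \<omega> - part_sum f x \<omega>\<bar>
        + 2 / n * \<bar>part_sum f n \<omega> - part_sum f 0 \<omega>\<bar>"
      using wb unfolding w_def[symmetric] by (intro add_mono mult_right_mono) auto
    finally show "\<bar>delta f k \<omega>\<bar> \<le> 2 * (real n powr (\<gamma> - 1) * 2 powr (- real j * \<gamma>)) * \<bar>part_sum f k \<omega> - part_sum f x \<omega>\<bar>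
        + 2 / n * \<bar>part_sum f n \<omega> - part_sum f 0 \<omega>\<bar>"
      using w0 by (simp add: mult_left_mono)
  qed auto
  also have "\<dots> \<le> ennreal (2 * (real n powr (\<gamma> - 1) * 2 powr (- real j * \<gamma>))) * osc x (Suc j) \<omega>
      + ennreal (2 / n) * osc 0 (Suc J) \<omega>"
    by (intro add_mono mult_left_mono osc_ge)
      (use j J k in \<open>auto simp: x_def k'_def split: if_splits\<close>)
  also have "\<dots> \<le> 2 * noise_bound J \<omega>"
    by (rule osc_part) (use jJ in \<open>auto simp: x_def\<close>)
  finally show ?thesis .
qed

end

section \<open>Localisation of the maximiser\<close>

lemma emeasure_ge_le_nn_integral:
  fixes x :: real
  assumes [measurable]: "f \<in> borel_measurable M" and x: "0 < x"
  shows "emeasure M {\<omega> \<in> space M. ennreal x \<le> f \<omega>} \<le> ennreal (1 / x) * (\<integral>\<^sup>+\<omega>. f \<omega> \<partial>M)"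
proof -
  have eq: "{\<omega> \<in> space M. ennreal x \<le> f \<omega>} \<subseteq> {\<omega> \<in> space M. 1 \<le> ennreal (1 / x) * f \<omega>}"
  proof safe
    fix \<omega> assume "ennreal x \<le> f \<omega>"
    then have "ennreal (1 / x) * ennreal x \<le> ennreal (1 / x) * f \<omega>" by (intro mult_left_mono) auto
    then show "1 \<le> ennreal (1 / x) * f \<omega>" using x by (simp add: ennreal_mult[symmetric])
  qed
  have "emeasure M {\<omega> \<in> space M. ennreal x \<le> f \<omega>} \<le> emeasure M {\<omega> \<in> space M. 1 \<le> ennreal (1 / x) * f \<omega>}"
    by (rule emeasure_mono[OF eq]) measurable
  also have "\<dots> \<le> ennreal (1 / x) * (\<integral>\<^sup>+\<omega>. f \<omega> * indicator (space M) \<omega> \<partial>M)"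
    by (rule nn_integral_Markov_inequality) auto
  also have "(\<integral>\<^sup>+\<omega>. f \<omega> * indicator (space M) \<omega> \<partial>M) = (\<integral>\<^sup>+\<omega>. f \<omega> \<partial>M)"
    by (rule nn_integral_cong) simp
  finally show ?thesis .
qed

context change_point_sample
begin

text \<open>By Cauchy-Schwarz each mean is at most \<open>B f\<close>. Consequently \<open>b\<close>
  stays below \<open>2 * D\<close> as soon as \<open>N (msub P Q)\<close> exceeds it for some
  outcome. So the target rate cannot fall below a fixed multiple of \<open>1 / n\<close>, and
  rounding the change point to an integer does no harm.\<close>

lemma mean_diff_le:
  assumes bd: "\<And>\<nu>. fsm E \<nu> \<Longrightarrow> (\<forall>f\<in>\<F>. sm_integrable E \<nu> f) \<Longrightarrow>
      ennreal (N \<nu>) \<le> (\<integral>\<^sup>+f. ennreal (d f * \<bar>sm_integral E \<nu> f\<bar>) \<partial>count_space \<F>)"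
  shows "N (msub P Q) \<le> 2 * D"
proof -
  have abs_le: "\<bar>\<integral>x. f x \<partial>p\<bar> \<le> B f"
    if f: "f \<in> \<F>" and p: "prob_space p" "sets p = sets E" "integrable p f"
      "(\<integral>\<^sup>+x. ennreal ((f x)\<^sup>2) \<partial>p) \<le> ennreal ((B f)\<^sup>2)" for f p
  proof -
    interpret p: prob_space p by fact
    have [measurable]: "f \<in> borel_measurable p" using p(3) by auto
    have int: "integrable p (\<lambda>x. (f x)\<^sup>2)"
      using p(4) by (intro integrableI_bounded) (auto intro: le_less_trans)
    have "p.expectation (\<lambda>x. (f x)\<^sup>2) \<le> (B f)\<^sup>2"
      using p(4) by (subst (asm) nn_integral_eq_integral[OF int]) auto
    then have "(p.expectation f)\<^sup>2 \<le> (B f)\<^sup>2"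
      using p.variance_eq[OF p(3) int] p.variance_positive[of f] by simp
    then show ?thesis using B_nonneg[OF f] by (metis abs_le_square_iff abs_of_nonneg)
  qed
  have "ennreal (N (msub P Q)) \<le> gsum (\<lambda>f. (\<integral>x. f x \<partial>P) - (\<integral>x. f x \<partial>Q))"
    by (rule seminorm_le_gsum[OF bd PQ_functional])
  also have "\<dots> \<le> (\<integral>\<^sup>+f. ennreal 2 * (ennreal (d f) * ennreal (B f)) \<partial>count_space \<F>)"
    unfolding gsum_def
  proof (rule nn_integral_mono)
    fix f assume "f \<in> space (count_space \<F>)"
    then have f: "f \<in> \<F>" by simp
    have "\<bar>(\<integral>x. f x \<partial>P) - (\<integral>x. f x \<partial>Q)\<bar> \<le> 2 * B f"
      using abs_le[OF f P integrable_PQ(1)[OF f] B_P[OF f]] abs_le[OF f Q integrable_PQ(2)[OF f] B_Q[OF f]] by linarith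
    then have "d f * \<bar>(\<integral>x. f x \<partial>P) - (\<integral>x. f x \<partial>Q)\<bar> \<le> d f * (2 * B f)"
      using d_nonneg[OF f] by (rule mult_left_mono)
    then have "ennreal (d f * \<bar>(\<integral>x. f x \<partial>P) - (\<integral>x. f x \<partial>Q)\<bar>) \<le> ennreal (2 * (d f * B f))"
      by (intro ennreal_leI) simp
    then show "ennreal (d f * \<bar>(\<integral>x. f x \<partial>P) - (\<integral>x. f x \<partial>Q)\<bar>) \<le> ennreal 2 * (ennreal (d f) * ennreal (B f))"
      using d_nonneg[OF f] B_nonneg[OF f] by (simp add: ennreal_mult)
  qed
  also have "\<dots> = ennreal 2 * (\<integral>\<^sup>+f. ennreal (d f) * ennreal (B f) \<partial>count_space \<F>)"
    by (rule nn_integral_cmult) simp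
  also have "\<dots> \<le> ennreal 2 * ennreal D" by (intro mult_left_mono D) simp
  also have "\<dots> = ennreal (2 * D)" using D_nonneg by (simp add: ennreal_mult)
  finally show ?thesis using D_nonneg by (subst (asm) ennreal_le_iff) auto
qed

text \<open>The weight \<open>2 powr (- j * \<gamma>)\<close> meets the mean oscillation
  \<open>2 powr (j * (1 - r / 2))\<close>. The factor 4 collects the two ends and the step from
  \<open>j\<close> to \<open>Suc j\<close>; \<open>2 ^ J \<le> n\<close> turns the last term into
  \<open>n powr (- r / 2)\<close>.\<close>

lemma nn_integral_noise_bound_le:
  assumes J: "2 ^ J \<le> n"
  shows "(\<integral>\<^sup>+\<omega>. noise_bound J \<omega> \<partial>M) \<le> ennreal (4 * osc_const *
    (real n powr (\<gamma> - 1) * (\<Sum>j\<le>J. 2 powr (real j * (1 - r / 2 - \<gamma>))) + real n powr (- r / 2)))"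
proof -
  have n0: "0 < n" using ks by simp
  note oc = osc_const_nonneg
  have osc2: "(\<integral>\<^sup>+\<omega>. osc a (Suc j) \<omega> \<partial>M) \<le> ennreal (2 * osc_const * 2 powr (real j * (1 - r / 2)))" for a j
  proof -
    have "2 powr (real (Suc j) * (1 - r / 2)) = 2 powr (1 - r / 2) * 2 powr (real j * (1 - r / 2))"
      unfolding powr_add[symmetric] by (simp add: algebra_simps add_divide_distrib)
    also have "\<dots> \<le> 2 * 2 powr (real j * (1 - r / 2))"
      using r powr_mono[of "1 - r / 2" 1 "2::real"] by (intro mult_right_mono) auto
    finally have "osc_const * 2 powr (real (Suc j) * (1 - r / 2)) \<le> osc_const * (2 * 2 powr (real j * (1 - r / 2)))"
      using oc by (rule mult_left_mono)
    then show ?thesis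
      by (intro order_trans[OF nn_integral_osc_le] ennreal_leI) simp
  qed
  have "(\<integral>\<^sup>+\<omega>. noise_bound J \<omega> \<partial>M) = ennreal (real n powr (\<gamma> - 1)) * (\<Sum>j\<le>J. ennreal (2 powr (- real j * \<gamma>)) *
      ((\<integral>\<^sup>+\<omega>. osc 0 (Suc j) \<omega> \<partial>M) + (\<integral>\<^sup>+\<omega>. osc n (Suc j) \<omega> \<partial>M))) + ennreal (1 / n) * (\<integral>\<^sup>+\<omega>. osc 0 (Suc J) \<omega> \<partial>M)"
    unfolding noise_bound_def
    by (simp add: nn_integral_add nn_integral_cmult nn_integral_sum)
  also have "\<dots> \<le> ennreal (real n powr (\<gamma> - 1)) * (\<Sum>j\<le>J. ennreal (2 powr (- real j * \<gamma>)) *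
      (ennreal (2 * osc_const * 2 powr (real j * (1 - r / 2))) + ennreal (2 * osc_const * 2 powr (real j * (1 - r / 2)))))
      + ennreal (1 / n) * ennreal (2 * osc_const * 2 powr (real J * (1 - r / 2)))"
    by (intro add_mono mult_left_mono sum_mono osc2) auto
  also have "\<dots> = ennreal (real n powr (\<gamma> - 1) * (\<Sum>j\<le>J. 2 powr (- real j * \<gamma>) *
      (2 * osc_const * 2 powr (real j * (1 - r / 2)) + 2 * osc_const * 2 powr (real j * (1 - r / 2))))
      + 1 / n * (2 * osc_const * 2 powr (real J * (1 - r / 2))))"
    using oc by (simp add: ennreal_mult[symmetric] ennreal_plus[symmetric] sum_nonneg del: ennreal_plus)
  also have "\<dots> \<le> ennreal (4 * osc_const *
    (real n powr (\<gamma> - 1) * (\<Sum>j\<le>J. 2 powr (real j * (1 - r / 2 - \<gamma>))) + real n powr (- r / 2)))"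
  proof (rule ennreal_leI)
    have "2 powr (- real j * \<gamma>) * (2 * osc_const * 2 powr (real j * (1 - r / 2)) + 2 * osc_const * 2 powr (real j * (1 - r / 2)))
        = 4 * osc_const * 2 powr (real j * (1 - r / 2 - \<gamma>))" for j
    proof -
      have "2 powr (- real j * \<gamma>) * 2 powr (real j * (1 - r / 2)) = (2::real) powr (real j * (1 - r / 2 - \<gamma>))"
        unfolding powr_add[symmetric] by (simp add: algebra_simps)
      then show ?thesis by (simp add: algebra_simps)
    qed
    then have s: "(\<Sum>j\<le>J. 2 powr (- real j * \<gamma>) * (2 * osc_const * 2 powr (real j * (1 - r / 2)) + 2 * osc_const * 2 powr (real j * (1 - r / 2))))
        = 4 * osc_const * (\<Sum>j\<le>J. 2 powr (real j * (1 - r / 2 - \<gamma>)))"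
      by (simp only: sum_distrib_left)
    have "2 powr (real J * (1 - r / 2)) = real (2 ^ J) powr (1 - r / 2)"
      by (simp add: powr_realpow[symmetric] powr_powr)
    also have "\<dots> \<le> real n powr (1 - r / 2)"
      using J r by (intro powr_mono2) (auto simp del: of_nat_power)
    also have "\<dots> = real n * real n powr (- r / 2)"
      using n0 powr_add[of "real n" 1 "- r / 2"] by simp
    finally have "1 / n * (2 * osc_const * 2 powr (real J * (1 - r / 2)))
        \<le> 1 / n * (2 * osc_const * (real n * real n powr (- r / 2)))"
      using oc by (intro mult_left_mono) auto
    also have "\<dots> \<le> 4 * osc_const * real n powr (- r / 2)"
      using n0 oc by (simp add: mult_right_mono)
    finally show "real n powr (\<gamma> - 1) * (\<Sum>j\<le>J. 2 powr (- real j * \<gamma>) *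
      (2 * osc_const * 2 powr (real j * (1 - r / 2)) + 2 * osc_const * 2 powr (real j * (1 - r / 2))))
      + 1 / n * (2 * osc_const * 2 powr (real J * (1 - r / 2)))
      \<le> 4 * osc_const * (real n powr (\<gamma> - 1) * (\<Sum>j\<le>J. 2 powr (real j * (1 - r / 2 - \<gamma>))) + real n powr (- r / 2))"
      unfolding s by (simp add: algebra_simps)
  qed
  finally show ?thesis .
qed

text \<open>A pathwise argument in two stages. Small noise first confines \<open>k / n\<close> to a
  neighbourhood of \<open>\<tau>\<close> in which the weights are bounded and Lipschitz. There the
  increment of the noise consists of an increment of partial sums and of terms bounded by the
  distance of \<open>k / n\<close> from \<open>\<tau>\<close> times a small factor. Half of the
  available drift absorbs the latter, and the partial sums must account for the rest.\<close>

lemma argmax_osc_ge: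
  assumes sem: "sm_seminorm E N"
    and bd: "\<And>\<nu>. fsm E \<nu> \<Longrightarrow> (\<forall>f\<in>\<F>. sm_integrable E \<nu> f) \<Longrightarrow>
      ennreal (N \<nu>) \<le> (\<integral>\<^sup>+f. ennreal (d f * \<bar>sm_integral E \<nu> f\<bar>) \<partial>count_space \<F>)"
    and \<omega>: "\<omega> \<in> space M" and k: "1 \<le> k" "k < n"
    and b: "0 < b" "b < N (msub P Q)"
    and max: "N (cusum ks \<omega>) \<le> N (cusum k \<omega>)"
    and m0: "0 < m0" "m0 \<le> \<tau>" "m0 \<le> 1 - \<tau>"
    and J: "n < 2 ^ Suc J"
    and NB: "noise_bound J \<omega> \<le> ennreal ((1 - \<gamma>) * m0 ^ 3 / 256 * b)"
    and j: "2 ^ j \<le> \<bar>real k - real ks\<bar>" "\<bar>real k - real ks\<bar> \<le> 2 ^ Suc j"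
  shows "ennreal ((1 - \<gamma>) * m0\<^sup>2 / 16 * 2 ^ j * b) \<le> osc ks (Suc j) \<omega>"
proof -
  \<comment> \<open>The value is \<open>c * u0\<^sup>2 / 16\<close> with \<open>c\<close> and
    \<open>u0\<close> as defined below. It makes the terms caused by changing \<open>t\<close> and
    the weight cost \<open>c * \<bar>t - \<tau>\<bar> * b / 4\<close>, half of what the drift
    supplies.\<close>
  define \<kappa> where "\<kappa> = (1 - \<gamma>) * m0 ^ 3 / 256"
  define c where "c = (1 - \<gamma>) * m0"
  define t where "t = real k / real n"
  define u0 where "u0 = m0 / 4"
  define u where "u s = s * (1 - s)" for s :: real
  have n0: "0 < real n" using k by simp
  have g1: "0 < 1 - \<gamma>" "1 - \<gamma> \<le> 1" using gamma by auto
  have m05: "m0 \<le> 1 / 2" using m0 by simp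
  have \<kappa>0: "0 < \<kappa>" and c0: "0 < c" using g1 m0 by (auto simp: \<kappa>_def c_def)
  have \<kappa>c: "\<kappa> = c * m0\<^sup>2 / 256" by (simp add: \<kappa>_def c_def power2_eq_square power3_eq_cube)
  have NB2: "noise_bound J \<omega> \<le> ennreal (\<kappa> * b)" using NB by (simp add: \<kappa>_def)
  have u_ge: "m0' / 2 \<le> u s" if "0 < m0'" "m0' \<le> s" "m0' \<le> 1 - s" for s m0'
  proof (cases "s \<le> 1 / 2")
    case True
    then show ?thesis using that mult_mono[of m0' s "1/2" "1 - s"] by (simp add: u_def)
  next
    case False
    then show ?thesis using that mult_mono[of "1/2" s m0' "1 - s"] by (simp add: u_def)
  qed
  have gd: "gsum (\<lambda>f. delta f i \<omega>) \<le> ennreal (2 * \<kappa> * b)" if "1 \<le> i" "i < n" for i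
  proof -
    have "gsum (\<lambda>f. delta f i \<omega>) \<le> 2 * noise_bound J \<omega>" by (rule gsum_delta_le[OF J that])
    also have "\<dots> \<le> 2 * ennreal (\<kappa> * b)" by (intro mult_left_mono NB2) auto
    also have "\<dots> = ennreal (2 * \<kappa> * b)"
      using \<kappa>0 b ennreal_mult[of 2 "\<kappa> * b"] by (simp add: mult.assoc)
    finally show ?thesis .
  qed
  \<comment> \<open>This is the smallness that \<open>argmax_drift_le\<close> needs: the peak of the
    drift is at least \<open>m0 / 2\<close>, so \<open>2 * \<kappa>\<close> is at most a quarter of
    it.\<close>
  have "\<kappa> \<le> m0 / 16"
  proof -
    have "c * m0\<^sup>2 \<le> m0 * 1"
      unfolding c_def using g1 m0 m05 mult_mono[of "1 - \<gamma>" 1 m0 m0]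
      by (intro mult_mono) (auto simp: power_le_one)
    then show ?thesis unfolding \<kappa>c using m0 by simp
  qed
  moreover have "m0 / 2 \<le> drift ks" using u_ge[OF m0] drift_bounds(3)[OF k] by (simp add: u_def)
  ultimately have "2 * \<kappa> \<le> drift ks / 4" by simp
  then have "2 * \<kappa> * b \<le> drift ks / 4 * b" using b by (intro mult_right_mono) auto
  then have small: "gsum (\<lambda>f. delta f ks \<omega>) \<le> ennreal (drift ks * b / 4)"
    by (intro order_trans[OF gd[OF ks]] ennreal_leI) simp
  have gap: "c * \<bar>t - \<tau>\<bar> \<le> drift ks - drift k"
  proof -
    have "c * \<bar>t - \<tau>\<bar> \<le> (1 - \<gamma>) * min \<tau> (1 - \<tau>) * \<bar>t - \<tau>\<bar>"
      unfolding c_def using g1 m0 by (intro mult_right_mono mult_left_mono) auto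
    then show ?thesis using drift_bounds(2)[OF k] by (simp add: t_def)
  qed
  have main: "ennreal (c * \<bar>t - \<tau>\<bar> * b / 2) \<le> gsum (\<lambda>f. delta f k \<omega> - delta f ks \<omega>)"
  proof -
    have "c * \<bar>t - \<tau>\<bar> * b / 2 \<le> (drift ks - drift k) * b / 2"
      using gap b by (intro divide_right_mono mult_right_mono) auto
    then have "ennreal (c * \<bar>t - \<tau>\<bar> * b / 2) \<le> ennreal ((drift ks - drift k) * b / 2)" by (rule ennreal_leI)
    also have "\<dots> \<le> gsum (\<lambda>f. delta f k \<omega> - delta f ks \<omega>)"
      by (rule argmax_drift_le[OF sem bd \<omega> k b max small])
    finally show ?thesis .
  qed
  \<comment> \<open>Coarse localisation: bounding the two noise terms separately already gives
    \<open>m0\<^sup>2 / 32\<close>. Hence \<open>t\<close> keeps a distance of at least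
    \<open>m0 / 2\<close> from 0 and 1, which explains \<open>u0 = m0 / 4\<close>.\<close>
  have near: "\<bar>t - \<tau>\<bar> \<le> m0 / 2"
  proof -
    have "gsum (\<lambda>f. delta f k \<omega> - delta f ks \<omega>)
        \<le> ennreal 1 * gsum (\<lambda>f. delta f k \<omega>) + ennreal 1 * gsum (\<lambda>f. delta f ks \<omega>)"
      by (rule gsum_le2) auto
    also have "\<dots> \<le> ennreal (2 * \<kappa> * b) + ennreal (2 * \<kappa> * b)"
      using gd[OF k] gd[OF ks] by (auto intro: add_mono)
    also have "\<dots> = ennreal (4 * \<kappa> * b)" using \<kappa>0 b by (simp add: ennreal_plus[symmetric] del: ennreal_plus)
    finally have "ennreal (c * \<bar>t - \<tau>\<bar> * b / 2) \<le> ennreal (4 * \<kappa> * b)" using main by (rule order_trans[rotated])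
    then have "c * \<bar>t - \<tau>\<bar> * b / 2 \<le> 4 * \<kappa> * b" using \<kappa>0 b by (subst (asm) ennreal_le_iff) auto
    then have "c * \<bar>t - \<tau>\<bar> \<le> c * (m0\<^sup>2 / 32)" using b by (simp add: \<kappa>c)
    then have "\<bar>t - \<tau>\<bar> \<le> m0\<^sup>2 / 32" using c0 by simp
    also have "\<dots> \<le> m0 / 2"
      using m0 m05 mult_left_mono[of m0 1 m0] by (simp add: power2_eq_square)
    finally show ?thesis .
  qed
  have ut: "u0 \<le> u t" "u0 \<le> u \<tau>"
  proof -
    have "m0 / 2 \<le> t" "m0 / 2 \<le> 1 - t" using near m0 unfolding abs_le_iff by linarith+
    then show "u0 \<le> u t" using u_ge[of "m0 / 2" t] m0 by (simp add: u0_def)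
    show "u0 \<le> u \<tau>" using u_ge[OF m0] m0 by (simp add: u0_def)
  qed
  have u0: "0 < u0" "u0 \<le> 1" using m0 m05 by (auto simp: u0_def)
  define w where "w s = u s powr (- \<gamma>)" for s
  have wt: "0 \<le> w t" "w t \<le> 1 / u0" unfolding w_def
    using powr_neg_le_inverse[of u0 "u t" \<gamma>] u0 ut gamma by auto
  have wl: "\<bar>w t - w \<tau>\<bar> \<le> \<bar>t - \<tau>\<bar> / u0\<^sup>2"
  proof -
    have "\<bar>w t - w \<tau>\<bar> \<le> \<bar>u t - u \<tau>\<bar> / u0\<^sup>2"
      unfolding w_def using u0 ut gamma by (intro powr_neg_lipschitz) auto
    also have "u t - u \<tau> = (t - \<tau>) * (1 - t - \<tau>)" by (simp add: u_def algebra_simps)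
    also have "\<bar>(t - \<tau>) * (1 - t - \<tau>)\<bar> \<le> \<bar>t - \<tau>\<bar> * 1"
    proof -
      have "0 < t" "t < 1" using k by (auto simp: t_def)
      then have "\<bar>1 - t - \<tau>\<bar> \<le> 1" using tau by (simp add: abs_le_iff)
      then show ?thesis unfolding abs_mult by (intro mult_left_mono) auto
    qed
    finally show ?thesis by (simp add: divide_right_mono)
  qed
  have inv: "1 / u0 \<le> 1 / u0\<^sup>2"
    using u0 by (simp add: power2_eq_square field_simps)
  define z2 where "z2 f = \<bar>part_sum f ks \<omega>\<bar> + \<bar>part_sum f n \<omega>\<bar>" for f
  have d_le: "\<bar>delta f k \<omega> - delta f ks \<omega>\<bar> \<le> 1 / (u0 * n) * \<bar>part_sum f k \<omega> - part_sum f ks \<omega>\<bar>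
      + 2 * \<bar>t - \<tau>\<bar> / u0\<^sup>2 / n * \<bar>z2 f\<bar>" for f
  proof -
    define a where "a = part_sum f k \<omega>"
    define a' where "a' = part_sum f ks \<omega>"
    define e where "e = part_sum f n \<omega>"
    have "n * (delta f k \<omega> - delta f ks \<omega>) = w t * (a - t * e) - w \<tau> * (a' - \<tau> * e)"
      unfolding delta_def w_def u_def a_def a'_def e_def \<tau>_def[symmetric] t_def[symmetric]
      using n0 by (simp add: right_diff_distrib)
    \<comment> \<open>Three effects of moving from \<open>ks\<close> to \<open>k\<close>: the
      partial sum changes, the multiple of the full sum changes, the weight changes. The last two
      are bounded by multiples of \<open>\<bar>t - \<tau>\<bar>\<close>.\<close>
    also have "\<dots> = w t * (a - a') - w t * ((t - \<tau>) * e) + (w t - w \<tau>) * (a' - \<tau> * e)"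
      by (simp add: algebra_simps)
    finally have eq: "n * (delta f k \<omega> - delta f ks \<omega>) =
        w t * (a - a') - w t * ((t - \<tau>) * e) + (w t - w \<tau>) * (a' - \<tau> * e)" .
    have "n * \<bar>delta f k \<omega> - delta f ks \<omega>\<bar> = \<bar>n * (delta f k \<omega> - delta f ks \<omega>)\<bar>"
      using n0 by (simp add: abs_mult)
    also have "\<dots> \<le> \<bar>w t * (a - a')\<bar> + \<bar>w t * ((t - \<tau>) * e)\<bar> + \<bar>(w t - w \<tau>) * (a' - \<tau> * e)\<bar>"
      unfolding eq by linarith
    also have "\<bar>w t * (a - a')\<bar> \<le> 1 / u0 * \<bar>a - a'\<bar>"
      unfolding abs_mult using wt by (intro mult_right_mono) auto
    also have "\<bar>w t * ((t - \<tau>) * e)\<bar> \<le> 1 / u0\<^sup>2 * (\<bar>t - \<tau>\<bar> * \<bar>e\<bar>)"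
      unfolding abs_mult using wt inv by (intro mult_right_mono) auto
    also have "\<bar>(w t - w \<tau>) * (a' - \<tau> * e)\<bar> \<le> \<bar>t - \<tau>\<bar> / u0\<^sup>2 * (\<bar>a'\<bar> + \<bar>e\<bar>)"
    proof -
      have "\<bar>\<tau> * e\<bar> \<le> 1 * \<bar>e\<bar>" unfolding abs_mult using tau by (intro mult_right_mono) auto
      then have "\<bar>a' - \<tau> * e\<bar> \<le> \<bar>a'\<bar> + \<bar>e\<bar>" by linarith
      then show ?thesis unfolding abs_mult using wl by (intro mult_mono) auto
    qed
    also have "1 / u0 * \<bar>a - a'\<bar> + 1 / u0\<^sup>2 * (\<bar>t - \<tau>\<bar> * \<bar>e\<bar>) + \<bar>t - \<tau>\<bar> / u0\<^sup>2 * (\<bar>a'\<bar> + \<bar>e\<bar>)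
        \<le> 1 / u0 * \<bar>a - a'\<bar> + 2 * \<bar>t - \<tau>\<bar> / u0\<^sup>2 * (\<bar>a'\<bar> + \<bar>e\<bar>)"
    proof -
      have "0 \<le> \<bar>t - \<tau>\<bar> / u0\<^sup>2 * \<bar>a'\<bar>" by simp
      moreover have "2 * \<bar>t - \<tau>\<bar> / u0\<^sup>2 * (\<bar>a'\<bar> + \<bar>e\<bar>) = 1 / u0\<^sup>2 * (\<bar>t - \<tau>\<bar> * \<bar>e\<bar>)
          + \<bar>t - \<tau>\<bar> / u0\<^sup>2 * (\<bar>a'\<bar> + \<bar>e\<bar>) + \<bar>t - \<tau>\<bar> / u0\<^sup>2 * \<bar>a'\<bar>"
        using u0 by (simp add: field_simps)
      ultimately show ?thesis by linarith
    qed
    finally have "\<bar>delta f k \<omega> - delta f ks \<omega>\<bar> \<le> (1 / u0 * \<bar>a - a'\<bar> + 2 * \<bar>t - \<tau>\<bar> / u0\<^sup>2 * (\<bar>a'\<bar> + \<bar>e\<bar>)) / n"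
      using n0 by (simp add: pos_le_divide_eq mult.commute)
    also have "\<dots> = 1 / (u0 * n) * \<bar>a - a'\<bar> + 2 * \<bar>t - \<tau>\<bar> / u0\<^sup>2 / n * (\<bar>a'\<bar> + \<bar>e\<bar>)"
      by (simp add: add_divide_distrib)
    finally show ?thesis by (simp add: z2_def a_def a'_def e_def)
  qed
  have "gsum z2 \<le> ennreal 1 * gsum (\<lambda>f. part_sum f ks \<omega>) + ennreal 1 * gsum (\<lambda>f. part_sum f n \<omega>)"
    by (rule gsum_le2) (auto simp: z2_def)
  then have "ennreal (1 / n) * gsum z2 \<le> ennreal (1 / n) * gsum (\<lambda>f. part_sum f ks \<omega>) + ennreal (1 / n) * gsum (\<lambda>f. part_sum f n \<omega>)"
    unfolding distrib_left[symmetric] by (intro mult_left_mono) auto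
  also have "\<dots> \<le> noise_bound J \<omega> + noise_bound J \<omega>"
    using ks by (intro add_mono gsum_part_sum_le J) auto
  also have "\<dots> \<le> ennreal (\<kappa> * b) + ennreal (\<kappa> * b)" by (intro add_mono NB2)
  also have "\<dots> = ennreal (2 * \<kappa> * b)" using \<kappa>0 b by (simp add: ennreal_plus[symmetric] del: ennreal_plus)
  finally have z2_le: "ennreal (1 / n) * gsum z2 \<le> ennreal (2 * \<kappa> * b)" .
  have split: "gsum (\<lambda>f. delta f k \<omega> - delta f ks \<omega>) \<le> ennreal (1 / (u0 * n)) * gsum (\<lambda>f. part_sum f k \<omega> - part_sum f ks \<omega>)
      + ennreal (2 * \<bar>t - \<tau>\<bar> / u0\<^sup>2 / n) * gsum z2"
    by (rule gsum_le2) (use d_le u0 in auto)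
  have osc_k: "gsum (\<lambda>f. part_sum f k \<omega> - part_sum f ks \<omega>) \<le> osc ks (Suc j) \<omega>"
  proof (rule osc_ge)
    have "real k \<le> real (ks + 2 ^ Suc j)" "real ks \<le> real (k + 2 ^ Suc j)" using j(2) by (auto simp: abs_le_iff)
    then show "k \<le> ks + 2 ^ Suc j" "ks \<le> k + 2 ^ Suc j" by linarith+
  qed
  have "ennreal (2 * \<bar>t - \<tau>\<bar> / u0\<^sup>2 / n) = ennreal (2 * \<bar>t - \<tau>\<bar> / u0\<^sup>2) * ennreal (1 / n)"
    by (subst ennreal_mult[symmetric]) auto
  then have "ennreal (2 * \<bar>t - \<tau>\<bar> / u0\<^sup>2 / n) * gsum z2 \<le> ennreal (2 * \<bar>t - \<tau>\<bar> / u0\<^sup>2) * ennreal (2 * \<kappa> * b)"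
    using mult_left_mono[OF z2_le, of "ennreal (2 * \<bar>t - \<tau>\<bar> / u0\<^sup>2)"] by (simp add: mult.assoc)
  also have "\<dots> = ennreal (c * \<bar>t - \<tau>\<bar> * b / 4)"
  proof -
    have "ennreal (2 * \<bar>t - \<tau>\<bar> / u0\<^sup>2) * ennreal (2 * \<kappa> * b) = ennreal (2 * \<bar>t - \<tau>\<bar> / u0\<^sup>2 * (2 * \<kappa> * b))"
      using \<kappa>0 b by (intro ennreal_mult[symmetric]) auto
    also have "2 * \<bar>t - \<tau>\<bar> / u0\<^sup>2 * (2 * \<kappa> * b) = c * \<bar>t - \<tau>\<bar> * b / 4"
      unfolding \<kappa>c u0_def using m0 by (simp add: power2_eq_square)
    finally show ?thesis .
  qed
  finally have rest: "ennreal (2 * \<bar>t - \<tau>\<bar> / u0\<^sup>2 / n) * gsum z2 \<le> ennreal (c * \<bar>t - \<tau>\<bar> * b / 4)" .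
  have fin: "gsum (\<lambda>f. delta f k \<omega> - delta f ks \<omega>) \<le>
      ennreal (1 / (u0 * n)) * osc ks (Suc j) \<omega> + ennreal (c * \<bar>t - \<tau>\<bar> * b / 4)"
    by (rule order_trans[OF split]) (intro add_mono mult_left_mono osc_k rest zero_le)
  show ?thesis
  proof (cases "osc ks (Suc j) \<omega>" rule: ennreal_cases)
    case (real y)
    have "ennreal (c * \<bar>t - \<tau>\<bar> * b / 2) \<le> ennreal (1 / (u0 * n) * y + c * \<bar>t - \<tau>\<bar> * b / 4)"
      using order_trans[OF main fin] real u0 c0 b
      by (simp add: ennreal_mult[symmetric] ennreal_plus[symmetric] del: ennreal_plus)
    then have "c * \<bar>t - \<tau>\<bar> * b / 2 \<le> 1 / (u0 * n) * y + c * \<bar>t - \<tau>\<bar> * b / 4"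
      using real u0 c0 b by (subst (asm) ennreal_le_iff) auto
    then have "c * \<bar>t - \<tau>\<bar> * b / 4 \<le> 1 / (u0 * n) * y" by linarith
    \<comment> \<open>Multiplying by \<open>n\<close> turns \<open>\<bar>t - \<tau>\<bar>\<close>
      into the distance of the indices, which is at least \<open>2 ^ j\<close>.\<close>
    then have le: "c * u0 / 4 * (n * \<bar>t - \<tau>\<bar>) * b \<le> y"
      using u0 n0 by (simp add: pos_le_divide_eq mult_ac)
    have "n * \<bar>t - \<tau>\<bar> = \<bar>real k - real ks\<bar>"
    proof -
      have "n * \<bar>t - \<tau>\<bar> = \<bar>n * (t - \<tau>)\<bar>" using n0 by (simp add: abs_mult)
      also have "n * (t - \<tau>) = real k - real ks" using n0 by (simp add: t_def \<tau>_def right_diff_distrib)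
      finally show ?thesis .
    qed
    then have "c * u0 / 4 * 2 ^ j * b \<le> c * u0 / 4 * (n * \<bar>t - \<tau>\<bar>) * b"
      using j(1) c0 u0 b by (intro mult_right_mono mult_left_mono) auto
    with le have "c * u0 / 4 * 2 ^ j * b \<le> y" by linarith
    moreover have "c * u0 / 4 = (1 - \<gamma>) * m0\<^sup>2 / 16" by (simp add: c_def u0_def power2_eq_square)
    ultimately show ?thesis using real by (simp add: ennreal_leI)
  qed simp
qed

text \<open>The exceptional set is fixed before \<open>\<omega>\<close>, \<open>k\<close> and
  \<open>N\<close>, and is built from the noise alone, so one measurable set serves although
  \<open>N\<close> may be a different seminorm for every outcome. Off \<open>W\<close> the noise is
  small and no shell from \<open>p\<close> on oscillates enough to contain a maximiser.\<close>

lemma tail_probability: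
  assumes b: "0 < b" and m0: "0 < m0" "m0 \<le> \<tau>" "m0 \<le> 1 - \<tau>" and J: "2 ^ J \<le> n" "n < 2 ^ Suc J"
  obtains W where "W \<in> sets M"
    and "\<And>\<omega> k N. sm_seminorm E N \<Longrightarrow>
      (\<And>\<nu>. fsm E \<nu> \<Longrightarrow> (\<forall>f\<in>\<F>. sm_integrable E \<nu> f) \<Longrightarrow>
        ennreal (N \<nu>) \<le> (\<integral>\<^sup>+f. ennreal (d f * \<bar>sm_integral E \<nu> f\<bar>) \<partial>count_space \<F>)) \<Longrightarrow>
      \<omega> \<in> space M \<Longrightarrow> 1 \<le> k \<Longrightarrow> k < n \<Longrightarrow> b < N (msub P Q) \<Longrightarrow>
      N (cusum ks \<omega>) \<le> N (cusum k \<omega>) \<Longrightarrow> 2 ^ p \<le> \<bar>real k - real ks\<bar> \<Longrightarrow> \<omega> \<in> W"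
    and "measure M W \<le> 1024 * osc_const / ((1 - \<gamma>) * m0 ^ 3 * b) *
        (real n powr (\<gamma> - 1) * (\<Sum>j\<le>J. 2 powr (real j * (1 - r / 2 - \<gamma>))) + real n powr (- r / 2))
      + 32 * osc_const / ((1 - \<gamma>) * m0\<^sup>2 * b) * (2 powr (- real p * (r / 2)) / (1 - 2 powr (- (r / 2))))"
proof -
  define \<kappa> where "\<kappa> = (1 - \<gamma>) * m0 ^ 3 / 256"
  define c1 where "c1 = (1 - \<gamma>) * m0\<^sup>2 / 16"
  have pos: "0 < \<kappa>" "0 < c1" using gamma m0 by (auto simp: \<kappa>_def c1_def)
  note oc = osc_const_nonneg
  define R where "R = real n powr (\<gamma> - 1) * (\<Sum>j\<le>J. 2 powr (real j * (1 - r / 2 - \<gamma>))) + real n powr (- r / 2)"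
  have R0: "0 \<le> R" by (auto simp: R_def intro!: sum_nonneg add_nonneg_nonneg mult_nonneg_nonneg)
  define A where "A = {\<omega> \<in> space M. ennreal (\<kappa> * b) \<le> noise_bound J \<omega>}"
  define S where "S j = {\<omega> \<in> space M. ennreal (c1 * 2 ^ j * b) \<le> osc ks (Suc j) \<omega>}" for j
  have meas[measurable]: "A \<in> sets M" "S j \<in> sets M" for j unfolding A_def S_def by measurable
  define W where "W = A \<union> (\<Union>j\<in>{p..J}. S j)"
  show ?thesis
  proof (rule that[of W])
    show "W \<in> sets M" unfolding W_def by measurable
  next
    fix \<omega> k and N :: "('e set \<Rightarrow> real) \<Rightarrow> real"
    assume sem: "sm_seminorm E N"
      and bd: "\<And>\<nu>. fsm E \<nu> \<Longrightarrow> (\<forall>f\<in>\<F>. sm_integrable E \<nu> f) \<Longrightarrow>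
        ennreal (N \<nu>) \<le> (\<integral>\<^sup>+f. ennreal (d f * \<bar>sm_integral E \<nu> f\<bar>) \<partial>count_space \<F>)"
      and \<omega>: "\<omega> \<in> space M" and k: "1 \<le> k" "k < n" and bN: "b < N (msub P Q)"
      and max: "N (cusum ks \<omega>) \<le> N (cusum k \<omega>)" and far: "2 ^ p \<le> \<bar>real k - real ks\<bar>"
    show "\<omega> \<in> W"
    proof (cases "\<omega> \<in> A")
      case False
      then have NB: "noise_bound J \<omega> \<le> ennreal ((1 - \<gamma>) * m0 ^ 3 / 256 * b)"
        using \<omega> by (auto simp: A_def \<kappa>_def)
      \<comment> \<open>The dyadic index of this distance lies between \<open>p\<close>, because
        \<open>k\<close> is far from \<open>ks\<close>, and \<open>J\<close>, because the distance
        is below \<open>n\<close>; so finitely many shells suffice.\<close>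
      define l where "l = nat \<bar>int k - int ks\<bar>"
      have l: "real l = \<bar>real k - real ks\<bar>" by (simp add: l_def)
      have "real (2 ^ p) \<le> real l" using far l by simp
      then have pl: "2 ^ p \<le> l" by (simp only: of_nat_le_iff)
      then have "1 \<le> l" using one_le_power[of "2::nat" p] by linarith
      then obtain j where j: "2 ^ j \<le> l" "l < 2 ^ (j + 1)" using ex_power_ivl1[of 2 l] by auto
      have "(2::nat) ^ p < 2 ^ Suc j" using pl j by simp
      then have pj: "p \<le> j" using power_less_imp_less_exp[of "2::nat" p "Suc j"] by simp
      have "l < n" using k ks by (auto simp: l_def)
      then have "(2::nat) ^ j < 2 ^ Suc J" using j J by linarith
      then have jJ: "j \<le> J" using power_less_imp_less_exp[of "2::nat" j "Suc J"] by simp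
      have j': "2 ^ j \<le> \<bar>real k - real ks\<bar>" "\<bar>real k - real ks\<bar> \<le> 2 ^ Suc j"
        using of_nat_mono[OF j(1), where 'a=real] of_nat_mono[OF less_imp_le[OF j(2)], where 'a=real]
        unfolding l by simp_all
      have "ennreal ((1 - \<gamma>) * m0\<^sup>2 / 16 * 2 ^ j * b) \<le> osc ks (Suc j) \<omega>"
        by (rule argmax_osc_ge[OF sem bd \<omega> k b bN max m0 J(2) NB j'])
      then show ?thesis using \<omega> pj jJ by (auto simp: W_def S_def c1_def)
    qed (simp add: W_def)
  next
    have eA: "emeasure M A \<le> ennreal (4 * osc_const / (\<kappa> * b) * R)"
    proof -
      have "emeasure M A \<le> ennreal (1 / (\<kappa> * b)) * (\<integral>\<^sup>+\<omega>. noise_bound J \<omega> \<partial>M)"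
        unfolding A_def by (rule emeasure_ge_le_nn_integral) (use pos b in auto)
      also have "\<dots> \<le> ennreal (1 / (\<kappa> * b)) * ennreal (4 * osc_const * R)"
        unfolding R_def by (intro mult_left_mono nn_integral_noise_bound_le J) auto
      also have "\<dots> = ennreal (4 * osc_const / (\<kappa> * b) * R)"
        using pos b oc R0 by (simp add: ennreal_mult[symmetric])
      finally show ?thesis .
    qed
    \<comment> \<open>The threshold grows like \<open>2 ^ j\<close>, the mean oscillation only like
      \<open>2 powr (j * (1 - r / 2))\<close>. The quotients decay geometrically, so the bound for
      all shells together is a multiple of the bound for the first.\<close>
    have eS: "emeasure M (S j) \<le> ennreal (2 * osc_const / (c1 * b) * 2 powr (- real j * (r / 2)))" for j
    proof -
      have "emeasure M (S j) \<le> ennreal (1 / (c1 * 2 ^ j * b)) * (\<integral>\<^sup>+\<omega>. osc ks (Suc j) \<omega> \<partial>M)"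
        unfolding S_def by (rule emeasure_ge_le_nn_integral) (use pos b in auto)
      also have "\<dots> \<le> ennreal (1 / (c1 * 2 ^ j * b)) * ennreal (osc_const * 2 powr (real (Suc j) * (1 - r / 2)))"
        by (intro mult_left_mono nn_integral_osc_le) auto
      also have "\<dots> = ennreal (1 / (c1 * 2 ^ j * b) * (osc_const * 2 powr (real (Suc j) * (1 - r / 2))))"
        using pos b oc by (intro ennreal_mult[symmetric]) auto
      also have "\<dots> \<le> ennreal (2 * osc_const / (c1 * b) * 2 powr (- real j * (r / 2)))"
      proof (rule ennreal_leI)
        have "2 powr (real (Suc j) * (1 - r / 2)) = 2 powr (1 - r / 2) * (2 powr real j * 2 powr (- real j * (r / 2)))"
          unfolding powr_add[symmetric] by (simp add: algebra_simps add_divide_distrib)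
        also have "\<dots> \<le> 2 * (2 powr real j * 2 powr (- real j * (r / 2)))"
          using r powr_mono[of "1 - r / 2" 1 "2::real"] by (intro mult_right_mono) auto
        also have "2 powr real j = (2::real) ^ j" by (simp add: powr_realpow)
        finally have "1 / (c1 * 2 ^ j * b) * (osc_const * 2 powr (real (Suc j) * (1 - r / 2)))
          \<le> 1 / (c1 * 2 ^ j * b) * (osc_const * (2 * (2 ^ j * 2 powr (- real j * (r / 2)))))"
          using pos b oc by (intro mult_left_mono) auto
        also have "\<dots> = 2 * osc_const / (c1 * b) * 2 powr (- real j * (r / 2))"
          using pos b by simp
        finally show "1 / (c1 * 2 ^ j * b) * (osc_const * 2 powr (real (Suc j) * (1 - r / 2)))
          \<le> 2 * osc_const / (c1 * b) * 2 powr (- real j * (r / 2))" .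
      qed
      finally show ?thesis .
    qed
    define T where "T = 2 powr (- real p * (r / 2)) / (1 - 2 powr (- (r / 2)))"
    have T: "(\<Sum>j\<in>{p..J}. 2 powr (- real j * (r / 2))) \<le> T"
      unfolding T_def using r by (intro sum_dyadic_tail_le) auto
    have "0 \<le> (\<Sum>j\<in>{p..J}. 2 powr (- real j * (r / 2)))" by (intro sum_nonneg) auto
    then have T0: "0 \<le> T" using T by linarith
    have "emeasure M W \<le> emeasure M A + emeasure M (\<Union>j\<in>{p..J}. S j)"
      unfolding W_def by (rule emeasure_subadditive) auto
    also have "emeasure M (\<Union>j\<in>{p..J}. S j) \<le> (\<Sum>j\<in>{p..J}. emeasure M (S j))"
      by (rule emeasure_subadditive_finite) auto
    also have "\<dots> \<le> (\<Sum>j\<in>{p..J}. ennreal (2 * osc_const / (c1 * b) * 2 powr (- real j * (r / 2))))"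
      by (intro sum_mono eS)
    also have "\<dots> = ennreal (\<Sum>j\<in>{p..J}. 2 * osc_const / (c1 * b) * 2 powr (- real j * (r / 2)))"
      using pos b oc by (intro sum_ennreal) auto
    also have "\<dots> \<le> ennreal (2 * osc_const / (c1 * b) * T)"
      unfolding sum_distrib_left[symmetric] using pos b oc T by (intro ennreal_leI mult_left_mono) auto
    finally have "emeasure M W \<le> emeasure M A + ennreal (2 * osc_const / (c1 * b) * T)"
      by (auto intro: add_left_mono)
    also have "\<dots> \<le> ennreal (4 * osc_const / (\<kappa> * b) * R) + ennreal (2 * osc_const / (c1 * b) * T)"
      by (intro add_right_mono eA)
    also have "\<dots> = ennreal (4 * osc_const / (\<kappa> * b) * R + 2 * osc_const / (c1 * b) * T)"
      using pos b oc R0 T0 by (intro ennreal_plus[symmetric]) auto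
    finally have "measure M W \<le> 4 * osc_const / (\<kappa> * b) * R + 2 * osc_const / (c1 * b) * T"
      unfolding emeasure_eq_measure using pos b oc R0 T0 by (subst (asm) ennreal_le_iff) auto
    then show "measure M W \<le> 1024 * osc_const / ((1 - \<gamma>) * m0 ^ 3 * b) *
        (real n powr (\<gamma> - 1) * (\<Sum>j\<le>J. 2 powr (real j * (1 - r / 2 - \<gamma>))) + real n powr (- r / 2))
      + 32 * osc_const / ((1 - \<gamma>) * m0\<^sup>2 * b) * (2 powr (- real p * (r / 2)) / (1 - 2 powr (- (r / 2))))"
      unfolding R_def T_def \<kappa>_def c1_def by (simp add: mult_ac)
  qed
qed

end

section \<open>Asymptotics\<close>

lemma fnorm_finite_bound:
  assumes fin: "fnorm P Q f < \<infinity>"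
  shows "(\<integral>\<^sup>+x. ennreal ((f x)\<^sup>2) \<partial>P n) \<le> ennreal ((enn2real (fnorm P Q f))\<^sup>2)"
    and "(\<integral>\<^sup>+x. ennreal ((f x)\<^sup>2) \<partial>Q n) \<le> ennreal ((enn2real (fnorm P Q f))\<^sup>2)"
proof -
  define s where "s = (\<integral>\<^sup>+x. ennreal ((f x)\<^sup>2) \<partial>P n) + (\<integral>\<^sup>+x. ennreal ((f x)\<^sup>2) \<partial>Q n)"
  have "(if s = \<infinity> then \<infinity> else ennreal (sqrt (enn2real s))) \<le> fnorm P Q f"
    unfolding fnorm_def Let_def s_def by (rule SUP_upper) simp
  then have s: "s \<noteq> \<infinity>" and le: "ennreal (sqrt (enn2real s)) \<le> fnorm P Q f"
    using fin by (auto split: if_splits simp: top_unique)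
  have "sqrt (enn2real s) \<le> enn2real (fnorm P Q f)"
    using enn2real_mono[OF le] fin by simp
  then have "enn2real s \<le> (enn2real (fnorm P Q f))\<^sup>2" by (simp add: sqrt_le_D)
  then have "s \<le> ennreal ((enn2real (fnorm P Q f))\<^sup>2)"
    using s by (metis ennreal_enn2real_if ennreal_leI infinity_ennreal_def)
  moreover have "(\<integral>\<^sup>+x. ennreal ((f x)\<^sup>2) \<partial>P n) \<le> s" "(\<integral>\<^sup>+x. ennreal ((f x)\<^sup>2) \<partial>Q n) \<le> s"
    by (auto simp: s_def)
  ultimately show "(\<integral>\<^sup>+x. ennreal ((f x)\<^sup>2) \<partial>P n) \<le> ennreal ((enn2real (fnorm P Q f))\<^sup>2)"
    "(\<integral>\<^sup>+x. ennreal ((f x)\<^sup>2) \<partial>Q n) \<le> ennreal ((enn2real (fnorm P Q f))\<^sup>2)" by (auto intro: order_trans)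
qed

text \<open>\<open>LEAST\<close> returns a maximiser only if there is one; for
  \<open>2 \<le> n\<close> the finite index range is non-empty and provides it.\<close>

lemma thetahat_argmax:
  assumes n: "2 \<le> n"
  obtains k where "1 \<le> k" "k < n" "thetahat E X N \<gamma> n \<omega> = real k / real n"
    "\<forall>j. 1 \<le> j \<and> j < n \<longrightarrow> N n \<omega> (Dk E X \<gamma> n j \<omega>) \<le> N n \<omega> (Dk E X \<gamma> n k \<omega>)"
proof -
  define v where "v j = N n \<omega> (Dk E X \<gamma> n j \<omega>)" for j
  define A where "A = (\<lambda>k. 1 \<le> k \<and> k < n \<and> (\<forall>j. 1 \<le> j \<and> j < n \<longrightarrow> v j \<le> v k))"
  have "Max (v ` {1..<n}) \<in> v ` {1..<n}" using n by (intro Max_in) auto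
  then obtain k0 where k0: "k0 \<in> {1..<n}" "v k0 = Max (v ` {1..<n})" by auto
  then have "v j \<le> v k0" if "1 \<le> j" "j < n" for j
    using that by (auto intro!: Max_ge)
  then have "A k0" using k0 by (auto simp: A_def)
  then have "A (LEAST k. A k)" by (rule LeastI)
  moreover have "thetahat E X N \<gamma> n \<omega> = real (LEAST k. A k) / real n"
    by (simp add: thetahat_def A_def v_def)
  ultimately show ?thesis by (intro that[of "LEAST k. A k"]) (auto simp: A_def v_def)
qed

theorem theorem1:
  fixes M :: "nat \<Rightarrow> 'w measure" and E :: "'e measure"
    and X :: "nat \<Rightarrow> nat \<Rightarrow> 'w \<Rightarrow> 'e"
    and P Q :: "nat \<Rightarrow> 'e measure"
    and \<theta> \<gamma> C \<rho> \<epsilon> :: real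
    and N :: "nat \<Rightarrow> 'w \<Rightarrow> ('e set \<Rightarrow> real) \<Rightarrow> real"
    and \<F> :: "('e \<Rightarrow> real) set" and d :: "('e \<Rightarrow> real) \<Rightarrow> real"
    and b :: "nat \<Rightarrow> real"
  assumes M: "\<And>n. prob_space (M n)"
    and X_meas: "\<And>n i. 1 \<le> i \<Longrightarrow> i \<le> n \<Longrightarrow> X n i \<in> measurable (M n) E"
    and theta: "0 < \<theta>" "\<theta> < 1"
    and PQ: "\<And>n. prob_space (P n)" "\<And>n. sets (P n) = sets E"
            "\<And>n. prob_space (Q n)" "\<And>n. sets (Q n) = sets E"
    and law_P: "\<And>n i. 1 \<le> i \<Longrightarrow> real i \<le> real n * \<theta> \<Longrightarrow> distr (M n) E (X n i) = P n"
    and law_Q: "\<And>n i. real n * \<theta> < real i \<Longrightarrow> i \<le> n \<Longrightarrow> distr (M n) E (X n i) = Q n"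
    and gamma: "0 \<le> \<gamma>" "\<gamma> < 1"
    and F_count: "countable \<F>"
    and F_meas: "\<F> \<subseteq> borel_measurable E"
    and C_pos: "C > 0" and rho_pos: "\<rho> > 0"
    and assumption1: "\<And>n m i f. 1 \<le> m \<Longrightarrow> m < n \<Longrightarrow> 1 \<le> i \<Longrightarrow> i \<le> n - m \<Longrightarrow> f \<in> \<F> \<Longrightarrow>
        \<bar>corr (M n) (\<lambda>\<omega>. f (X n i \<omega>)) (\<lambda>\<omega>. f (X n (i + m) \<omega>))\<bar> \<le> C * real m powr (- \<rho>)"
    and d_pos: "\<And>f. f \<in> \<F> \<Longrightarrow> d f > 0"
    and d_sum: "(\<integral>\<^sup>+ f. ennreal (d f) * fnorm P Q f \<partial>count_space \<F>) < \<infinity>"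
    and N_seminorm: "\<And>n \<omega>. \<omega> \<in> space (M n) \<Longrightarrow> sm_seminorm E (N n \<omega>)"
    and N_bound: "\<And>n \<omega> \<nu>. \<omega> \<in> space (M n) \<Longrightarrow> fsm E \<nu> \<Longrightarrow> (\<forall>f\<in>\<F>. sm_integrable E \<nu> f) \<Longrightarrow>
        ennreal (N n \<omega> \<nu>) \<le> (\<integral>\<^sup>+ f. ennreal (d f * \<bar>sm_integral E \<nu> f\<bar>) \<partial>count_space \<F>)"
    and b_pos: "\<And>n. b n > 0"
    and b_prob: "(\<lambda>n. measure (M n) {\<omega> \<in> space (M n). N n \<omega> (msub (P n) (Q n)) > b n}) \<longlonglongrightarrow> 1"
    and eps: "0 < \<epsilon>" "\<epsilon> < 1"
    and rate: "(\<lambda>n. (1 / b n) *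
        (real n powr (- min (1 - \<epsilon>) \<rho> / 2) *
           (1 + ln (real n) * (if \<gamma> - 1 + min (1 - \<epsilon>) \<rho> / 2 = 0 then 1 else 0))
         + real n powr (\<gamma> - 1))) \<longlonglongrightarrow> 0"
    and thetahat_meas: "\<And>n. thetahat E X N \<gamma> n \<in> borel_measurable (M n)"
  shows "\<forall>\<delta>>0. \<exists>K n0. \<forall>n\<ge>n0.
     measure (M n) {\<omega> \<in> space (M n). \<bar>thetahat E X N \<gamma> n \<omega> - \<theta>\<bar>
        > K * ((1 / real n) * b n powr (- 2 / min (1 - \<epsilon>) \<rho>))} < \<delta>"
proof (intro allI impI)
  fix \<delta> :: real assume \<delta>: "0 < \<delta>"
  define r where "r = min (1 - \<epsilon>) \<rho>"
  have r: "0 < r" "r < 1" "r \<le> \<rho>" using eps rho_pos by (auto simp: r_def)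
  define B where "B f = enn2real (fnorm P Q f)" for f
  define D where "D = enn2real (\<integral>\<^sup>+f. ennreal (d f) * fnorm P Q f \<partial>count_space \<F>)"
  \<comment> \<open>A positive weight times an infinite norm would make the weighted sum infinite;
    hence the norms are finite and \<open>B\<close> may be real-valued.\<close>
  have fn: "fnorm P Q f < \<infinity>" if f: "f \<in> \<F>" for f
  proof -
    have "AE f in count_space \<F>. ennreal (d f) * fnorm P Q f \<noteq> \<infinity>"
      using d_sum by (intro nn_integral_noteq_infinite) auto
    then have "ennreal (d f) * fnorm P Q f \<noteq> \<infinity>" using f by (simp add: AE_count_space)
    then show ?thesis using d_pos[OF f] by (auto simp: ennreal_mult_eq_top_iff less_top)
  qed
  have D0: "0 \<le> D" by (simp add: D_def)
  have Dsum: "(\<integral>\<^sup>+f. ennreal (d f) * ennreal (B f) \<partial>count_space \<F>) \<le> ennreal D"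
  proof -
    have "(\<integral>\<^sup>+f. ennreal (d f) * ennreal (B f) \<partial>count_space \<F>) = (\<integral>\<^sup>+f. ennreal (d f) * fnorm P Q f \<partial>count_space \<F>)"
      using fn by (intro nn_integral_cong) (simp add: B_def)
    then show ?thesis using d_sum by (simp add: D_def)
  qed
  define ks where "ks n = nat \<lfloor>real n * \<theta>\<rfloor>" for n
  have ks_le: "real (ks n) \<le> real n * \<theta>" "real n * \<theta> < real (ks n) + 1" for n
    using theta unfolding ks_def by (auto simp: of_nat_nat)
  \<comment> \<open>The rounded change point satisfies \<open>\<tau> \<le> \<theta>\<close> but may
    fall short of \<open>\<theta>\<close> by almost \<open>1 / n\<close>; once
    \<open>n * \<theta> \<ge> 2\<close> it is at least \<open>\<theta> / 2\<close>. The halved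
    minimum is thus a margin at both ends that does not depend on \<open>n\<close>.\<close>
  define m0 where "m0 = min \<theta> (1 - \<theta>) / 2"
  have m0: "0 < m0" "m0 \<le> \<theta> / 2" "m0 \<le> 1 - \<theta>" using theta by (auto simp: m0_def min_def)
  have sample: "change_point_sample (M n) E (X n) (P n) (Q n) \<F> B d C r \<gamma> D n (ks n)"
    if n: "1 \<le> ks n" "ks n < n" for n
  proof (intro change_point_sample.intro M change_point_sample_axioms.intro)
    fix i assume i: "i \<in> {1..ks n}"
    then have "real i \<le> real n * \<theta>" using ks_le(1)[of n] by (simp add: order_trans[of "real i" "real (ks n)"])
    then show "distr (M n) E (X n i) = P n" using i by (intro law_P) auto
  next
    fix i assume i: "i \<in> {ks n<..n}"
    then have "real (ks n) + 1 \<le> real i" by simp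
    then have "real n * \<theta> < real i" using ks_le(2)[of n] by linarith
    then show "distr (M n) E (X n i) = Q n" using i by (intro law_Q) auto
  next
    fix i j f assume ij: "1 \<le> i" "i < j" "j \<le> n" and f: "f \<in> \<F>"
    have "\<bar>corr (M n) (\<lambda>\<omega>. f (X n i \<omega>)) (\<lambda>\<omega>. f (X n (i + (j - i)) \<omega>))\<bar> \<le> C * real (j - i) powr (- \<rho>)"
      using ij f by (intro assumption1) auto
    also have "\<dots> \<le> C * real (j - i) powr (- r)"
      using ij r C_pos by (intro mult_left_mono powr_mono) auto
    finally show "\<bar>corr (M n) (\<lambda>\<omega>. f (X n i \<omega>)) (\<lambda>\<omega>. f (X n j \<omega>))\<bar> \<le> C * real (j - i) powr (- r)"
      using ij by simp
  qed (use n X_meas PQ F_count F_meas d_pos fn r C_pos gamma D0 Dsum in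
      \<open>auto simp: B_def less_imp_le fnorm_finite_bound\<close>)
  define \<beta> where "\<beta> = 1 - r / 2 - \<gamma>"
  define rt where "rt n = real n powr (- r / 2) * (1 + ln (real n) * (if \<gamma> - 1 + r / 2 = 0 then 1 else 0))
    + real n powr (\<gamma> - 1)" for n
  have rate': "(\<lambda>n. 1 / b n * rt n) \<longlonglongrightarrow> 0" using rate by (simp add: rt_def r_def)
  obtain K\<beta> where K\<beta>: "0 < K\<beta>" "\<And>J n. 2 ^ J \<le> n \<Longrightarrow> (\<Sum>j\<le>J. 2 powr (real j * \<beta>)) \<le>
      K\<beta> * (real n powr \<beta> * (1 + ln (real n) * (if \<beta> = 0 then 1 else 0)) + 1)"
    using sum_dyadic_powr_le by blast
  define oc where "oc = 2 * max_const C r * D"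
  have oc0: "0 \<le> oc" using max_const_nonneg[of C r] C_pos r D0 by (simp add: oc_def)
  define c2 where "c2 = 1024 * oc / ((1 - \<gamma>) * m0 ^ 3) * (K\<beta> + 1)"
  have c2: "0 \<le> c2" unfolding c2_def using oc0 gamma m0 K\<beta> by simp
  define q where "q = 1 - 2 powr (- (r / 2))"
  have q: "0 < q" using r by (simp add: q_def powr_minus field_simps)
  define c3 where "c3 = 32 * oc / ((1 - \<gamma>) * m0\<^sup>2) / q + 1"
  have c3: "1 \<le> c3" unfolding c3_def using oc0 gamma m0 q by simp
  \<comment> \<open>The first entry, together with \<open>b n < 2 * D\<close>, makes
    \<open>L\<close> below at least 1; the second lets the shells contribute at most
    \<open>\<delta> / 3\<close>.\<close>
  define K where "K = max (2 * (2 * D) powr (2 / r)) (4 * (3 * c3 / \<delta>) powr (2 / r))"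
  have "\<forall>\<^sub>F n in sequentially. c2 * (1 / b n * rt n) < \<delta> / 3"
  proof -
    have "(\<lambda>n. c2 * (1 / b n * rt n)) \<longlonglongrightarrow> c2 * 0" by (intro tendsto_mult_left rate')
    then show ?thesis using \<delta> by (intro order_tendstoD(2)) auto
  qed
  moreover have "\<forall>\<^sub>F n in sequentially.
      max 0 (1 - \<delta> / 3) < measure (M n) {\<omega> \<in> space (M n). b n < N n \<omega> (msub (P n) (Q n))}"
    using \<delta> by (intro order_tendstoD(1)[OF b_prob]) auto
  moreover have "\<forall>\<^sub>F n in sequentially. 2 / \<theta> \<le> real n"
    by (rule eventually_compose_filterlim[OF eventually_ge_at_top filterlim_real_sequentially])
  ultimately have "\<forall>\<^sub>F n in sequentially. measure (M n) {\<omega> \<in> space (M n).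
      K * (1 / real n * b n powr (- 2 / r)) < \<bar>thetahat E X N \<gamma> n \<omega> - \<theta>\<bar>} < \<delta>"
  proof eventually_elim
    case (elim n)
    note small = elim(1) and prob = elim(2) and large = elim(3)
    define b' where "b' = b n"
    have b': "0 < b'" using b_pos by (simp add: b'_def)
    have n\<theta>: "2 \<le> real n * \<theta>" using large theta by (simp add: field_simps)
    then have "0 < n" using theta by (cases n) auto
    then have n\<theta>1: "real n * \<theta> < real n" using theta by simp
    have kn: "1 \<le> ks n" "ks n < n" using ks_le[of n] n\<theta> n\<theta>1 by linarith+
    then have n2: "2 \<le> n" by simp
    interpret change_point_sample "M n" E "X n" "P n" "Q n" \<F> B d C r \<gamma> D n "ks n"
      by (rule sample[OF kn])
    have cus: "cusum k \<omega> = Dk E X \<gamma> n k \<omega>" for k \<omega>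
      unfolding cusum_def Dk_def ..
    have oc: "osc_const = oc" by (simp add: osc_const_def oc_def)
    have tau_m0: "m0 \<le> \<tau>" "m0 \<le> 1 - \<tau>"
    proof -
      have "\<tau> \<le> \<theta>" unfolding \<tau>_def using ks_le(1)[of n] n2 by (simp add: pos_divide_le_eq mult.commute)
      then show "m0 \<le> 1 - \<tau>" using m0 by linarith
      have "real n * (\<theta> / 2) \<le> real (ks n)" using ks_le(2)[of n] n\<theta> by linarith
      then have "\<theta> / 2 \<le> \<tau>" unfolding \<tau>_def using n2 by (simp add: pos_le_divide_eq mult.commute)
      then show "m0 \<le> \<tau>" using m0 by linarith
    qed
    define A where "A = {\<omega> \<in> space (M n). b' < N n \<omega> (msub (P n) (Q n))}"
    have pA: "0 < measure (M n) A" "1 - \<delta> / 3 < measure (M n) A" using prob by (auto simp: A_def b'_def)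
    \<comment> \<open>\<open>measure\<close> is 0 on non-measurable sets, so a positive value proves
      measurability, and non-emptiness next. This is the purpose of \<open>max 0\<close> in the
      eventual bound.\<close>
    have A: "A \<in> sets (M n)" using pA(1) measure_notin_sets[of A "M n"] by auto
    have "A \<noteq> {}" using pA(1) by auto
    then obtain \<omega>0 where "\<omega>0 \<in> A" by auto
    then have bD: "b' < 2 * D" using mean_diff_le[of "N n \<omega>0"] N_bound[of \<omega>0 n] by (force simp: A_def)
    \<comment> \<open>In index units the tolerated deviation is \<open>2 * L\<close>. Replacing
      \<open>n * \<theta>\<close> by \<open>ks n\<close> costs less than 1, and
      \<open>2 * L - 1 \<ge> L \<ge> 2 ^ p\<close> when \<open>L \<ge> 1\<close>.\<close>
    define L where "L = K / 2 * b' powr (- 2 / r)"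
    have L1: "1 \<le> L"
    proof -
      have "(2 * D) powr (- 2 / r) \<le> b' powr (- 2 / r)" using b' bD r by (intro powr_mono2') auto
      then have "(2 * D) powr (2 / r) * (2 * D) powr (- 2 / r) \<le> K / 2 * b' powr (- 2 / r)"
        unfolding K_def by (intro mult_mono) (auto simp: le_max_iff_disj)
      moreover have "(2 * D) powr (2 / r) * (2 * D) powr (- 2 / r) = 1"
        unfolding powr_add[symmetric] using b' bD by simp
      ultimately show ?thesis by (simp add: L_def)
    qed
    define l where "l = nat \<lfloor>L\<rfloor>"
    have "1 \<le> l" using L1 by (simp add: l_def le_nat_iff)
    then obtain p where p: "2 ^ p \<le> l" "l < 2 ^ (p + 1)" using ex_power_ivl1[of 2 l] by auto
    have pL: "2 ^ p \<le> L" "L \<le> 2 * 2 ^ p"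
    proof -
      have "real (2 ^ p) \<le> real l" using p(1) by (simp only: of_nat_le_iff)
      also have "\<dots> \<le> L" using L1 by (simp add: l_def)
      finally show "2 ^ p \<le> L" by simp
      have "l + 1 \<le> 2 ^ (p + 1)" using p(2) by simp
      then have "real (l + 1) \<le> real (2 ^ (p + 1))" by (simp only: of_nat_le_iff)
      moreover have "L \<le> real (l + 1)" using L1 unfolding l_def by linarith
      ultimately show "L \<le> 2 * 2 ^ p" by simp
    qed
    obtain J where J: "2 ^ J \<le> n" "n < 2 ^ Suc J" using ex_power_ivl1[of 2 n] n2 by auto
    obtain W where W: "W \<in> sets (M n)"
      and inW: "\<And>\<omega> k N. sm_seminorm E N \<Longrightarrow>
        (\<And>\<nu>. fsm E \<nu> \<Longrightarrow> (\<forall>f\<in>\<F>. sm_integrable E \<nu> f) \<Longrightarrow>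
          ennreal (N \<nu>) \<le> (\<integral>\<^sup>+f. ennreal (d f * \<bar>sm_integral E \<nu> f\<bar>) \<partial>count_space \<F>)) \<Longrightarrow>
        \<omega> \<in> space (M n) \<Longrightarrow> 1 \<le> k \<Longrightarrow> k < n \<Longrightarrow> b' < N (msub (P n) (Q n)) \<Longrightarrow>
        N (cusum (ks n) \<omega>) \<le> N (cusum k \<omega>) \<Longrightarrow> 2 ^ p \<le> \<bar>real k - real (ks n)\<bar> \<Longrightarrow> \<omega> \<in> W"
      and pW: "measure (M n) W \<le> 1024 * osc_const / ((1 - \<gamma>) * m0 ^ 3 * b') *
          (real n powr (\<gamma> - 1) * (\<Sum>j\<le>J. 2 powr (real j * (1 - r / 2 - \<gamma>))) + real n powr (- r / 2))
        + 32 * osc_const / ((1 - \<gamma>) * m0\<^sup>2 * b') * (2 powr (- real p * (r / 2)) / (1 - 2 powr (- (r / 2))))"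
      using tail_probability[OF b' m0(1) tau_m0 J, of p] by blast
    \<comment> \<open>Since \<open>n powr (\<gamma> - 1) * n powr \<beta>\<close> is
      \<open>n powr (- r / 2)\<close>, the expected noise is of the order \<open>rt n\<close> of the
      rate hypothesis, and dividing by \<open>b n\<close> makes it negligible.\<close>
    have first: "1024 * osc_const / ((1 - \<gamma>) * m0 ^ 3 * b') *
          (real n powr (\<gamma> - 1) * (\<Sum>j\<le>J. 2 powr (real j * (1 - r / 2 - \<gamma>))) + real n powr (- r / 2)) < \<delta> / 3"
    proof -
      have \<beta>0: "(\<gamma> - 1 + r / 2 = 0) = (\<beta> = 0)" by (auto simp: \<beta>_def)
      have ln0: "0 \<le> ln (real n)" using n2 by simp
      have "real n powr (\<gamma> - 1) * (\<Sum>j\<le>J. 2 powr (real j * \<beta>)) \<le>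
          real n powr (\<gamma> - 1) * (K\<beta> * (real n powr \<beta> * (1 + ln (real n) * (if \<beta> = 0 then 1 else 0)) + 1))"
        by (intro mult_left_mono K\<beta>(2) J) auto
      also have "\<dots> = K\<beta> * (real n powr (\<gamma> - 1) * real n powr \<beta> * (1 + ln (real n) * (if \<beta> = 0 then 1 else 0))
          + real n powr (\<gamma> - 1))" by (simp add: algebra_simps)
      also have "real n powr (\<gamma> - 1) * real n powr \<beta> = real n powr (- r / 2)"
        unfolding powr_add[symmetric] by (simp add: \<beta>_def)
      finally have "real n powr (\<gamma> - 1) * (\<Sum>j\<le>J. 2 powr (real j * \<beta>)) \<le> K\<beta> * rt n"
        by (simp add: rt_def \<beta>0)
      moreover have "real n powr (- r / 2) \<le> rt n"
        unfolding rt_def using ln0 by (simp add: distrib_left add_increasing2)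
      ultimately have "real n powr (\<gamma> - 1) * (\<Sum>j\<le>J. 2 powr (real j * \<beta>)) + real n powr (- r / 2) \<le> (K\<beta> + 1) * rt n"
        by (simp add: distrib_right)
      then have "1024 * oc / ((1 - \<gamma>) * m0 ^ 3 * b') *
          (real n powr (\<gamma> - 1) * (\<Sum>j\<le>J. 2 powr (real j * \<beta>)) + real n powr (- r / 2))
          \<le> 1024 * oc / ((1 - \<gamma>) * m0 ^ 3 * b') * ((K\<beta> + 1) * rt n)"
        using oc0 gamma m0 b' by (intro mult_left_mono) auto
      also have "\<dots> = c2 * (1 / b n * rt n)" by (simp add: c2_def b'_def)
      also note small
      finally show ?thesis unfolding oc \<beta>_def .
    qed
    have second: "32 * osc_const / ((1 - \<gamma>) * m0\<^sup>2 * b') * (2 powr (- real p * (r / 2)) / (1 - 2 powr (- (r / 2)))) \<le> \<delta> / 3"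
    proof -
      \<comment> \<open>By the choice of \<open>K\<close>, \<open>2 ^ p\<close> is at least
        \<open>(y / b') powr (2 / r)\<close>. Its power with exponent \<open>- (r / 2)\<close> is
        then at most \<open>b' / y\<close>, which cancels the \<open>1 / b'\<close> from Markov's
        inequality; this is the origin of the exponent \<open>2 / r\<close> in the rate.\<close>
      define y where "y = 3 * c3 / \<delta>"
      have y: "0 < y" using c3 \<delta> by (simp add: y_def)
      have "4 * y powr (2 / r) \<le> K" unfolding K_def y_def by simp
      then have "4 * y powr (2 / r) * b' powr (- 2 / r) \<le> K * b' powr (- 2 / r)"
        by (intro mult_right_mono) auto
      then have "y powr (2 / r) * b' powr (- 2 / r) \<le> 2 ^ p"
        using pL(2) by (simp add: L_def)
      then have "(2 ^ p) powr (- (r / 2)) \<le> (y powr (2 / r) * b' powr (- 2 / r)) powr (- (r / 2))"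
        using y b' r by (intro powr_mono2') auto
      also have "\<dots> = b' / y"
      proof -
        have e: "2 / r * - (r / 2) = - 1" "- 2 / r * - (r / 2) = 1" using r by auto
        have "(y powr (2 / r) * b' powr (- 2 / r)) powr (- (r / 2))
            = (y powr (2 / r)) powr (- (r / 2)) * (b' powr (- 2 / r)) powr (- (r / 2))"
          by (rule powr_mult)
        also have "\<dots> = y powr (- 1) * b' powr 1" unfolding powr_powr e ..
        finally show ?thesis using y b' by (simp add: powr_minus_divide)
      qed
      also have "(2 ^ p) powr (- (r / 2)) = (2::real) powr (- real p * (r / 2))"
        by (simp add: powr_realpow[symmetric] powr_powr)
      finally have le: "2 powr (- real p * (r / 2)) \<le> b' / y" .
      have "32 * osc_const / ((1 - \<gamma>) * m0\<^sup>2 * b') * (2 powr (- real p * (r / 2)) / q)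
          \<le> 32 * osc_const / ((1 - \<gamma>) * m0\<^sup>2 * b') * ((b' / y) / q)"
        unfolding oc using oc0 gamma m0 b' q le by (intro mult_left_mono divide_right_mono) auto
      also have "\<dots> = (c3 - 1) / y" using b' by (simp add: c3_def oc)
      also have "\<dots> \<le> c3 / y" using y by (intro divide_right_mono) auto
      also have "\<dots> = \<delta> / 3" using c3 \<delta> by (simp add: y_def)
      finally show ?thesis by (simp add: q_def)
    qed
    define bad where "bad = {\<omega> \<in> space (M n). K * (1 / real n * b n powr (- 2 / r)) < \<bar>thetahat E X N \<gamma> n \<omega> - \<theta>\<bar>}"
    have sub: "bad \<subseteq> W \<union> (space (M n) - A)"
    proof
      fix \<omega> assume "\<omega> \<in> bad"
      then have \<omega>: "\<omega> \<in> space (M n)" and far: "K * (1 / real n * b' powr (- 2 / r)) < \<bar>thetahat E X N \<gamma> n \<omega> - \<theta>\<bar>"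
        by (auto simp: bad_def b'_def)
      obtain k where k: "1 \<le> k" "k < n" "thetahat E X N \<gamma> n \<omega> = real k / real n"
        "\<forall>j. 1 \<le> j \<and> j < n \<longrightarrow> N n \<omega> (Dk E X \<gamma> n j \<omega>) \<le> N n \<omega> (Dk E X \<gamma> n k \<omega>)"
        using thetahat_argmax[OF n2, of E X N \<gamma> \<omega>] by blast
      have n0: "0 < real n" using n2 by simp
      have "real n * (K * (1 / real n * b' powr (- 2 / r))) < real n * \<bar>thetahat E X N \<gamma> n \<omega> - \<theta>\<bar>"
        by (rule mult_strict_left_mono[OF far n0])
      also have "\<dots> = \<bar>real n * (real k / real n - \<theta>)\<bar>"
        unfolding k(3) abs_mult by simp
      also have "real n * (real k / real n - \<theta>) = real k - real n * \<theta>"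
        using n0 by (simp only: right_diff_distrib) simp
      also have "real n * (K * (1 / real n * b' powr (- 2 / r))) = 2 * L"
        using n0 unfolding L_def by simp
      finally have far': "2 * L < \<bar>real k - real n * \<theta>\<bar>" .
      have "2 ^ p \<le> \<bar>real k - real (ks n)\<bar>"
        using far' ks_le[of n] L1 pL(1) by linarith
      moreover have "N n \<omega> (cusum (ks n) \<omega>) \<le> N n \<omega> (cusum k \<omega>)"
        unfolding cus using k(4) kn by blast
      ultimately have "\<omega> \<in> W" if "\<omega> \<in> A"
        using that by (intro inW[OF N_seminorm[OF \<omega>] N_bound[OF \<omega>] \<omega> k(1,2)]) (auto simp: A_def)
      then show "\<omega> \<in> W \<union> (space (M n) - A)" using \<omega> by auto
    qed
    \<comment> \<open>A third of \<open>\<delta>\<close> each goes to large noise, to the far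
      shells, and to the failure of the lower bound on \<open>N\<close> of
      \<open>P - Q\<close>.\<close>
    have "measure (M n) bad \<le> measure (M n) (W \<union> (space (M n) - A))"
      using W A by (intro finite_measure_mono sub) auto
    also have "\<dots> \<le> measure (M n) W + measure (M n) (space (M n) - A)"
      using W A by (intro measure_Un_le) auto
    also have "measure (M n) (space (M n) - A) = 1 - measure (M n) A" using A by (rule prob_compl)
    finally show ?case
      using pA(2) pW first second unfolding bad_def by linarith
  qed
  then show "\<exists>K n0. \<forall>n\<ge>n0. measure (M n) {\<omega> \<in> space (M n). \<bar>thetahat E X N \<gamma> n \<omega> - \<theta>\<bar>
        > K * ((1 / real n) * b n powr (- 2 / min (1 - \<epsilon>) \<rho>))} < \<delta>"
    unfolding eventually_sequentially r_def by blast
qed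

end
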